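(* Let $M$ be a complex left $W^a$-module and $k: R^a\to\mathbb{C}$ a $W^a$-invariant multiplicity function. The assignments $$v\mapsto \mathcal{D}_v^{k,M}\quad (v\in V),\qquad w\mapsto w\cdot\quad (w\in W^a)$$ uniquely extend to an algebra homomorphism $\pi_{k,M}: A(k)\rightarrow \mathrm{End}_{\mathbb{C}}\bigl(B^\omega(V;M)\bigr)$.
   Context: Root data. $V$ is a finite-dimensional real Euclidean vector space, $V^*$ its dual with the induced scalar product, $V_{\mathbb{C}},V_{\mathbb{C}}^*$ the complexifications. $R\subset V^*$ is a reduced crystallographic root system, irreducible in its span (it need not span $V^*$). For $0\ne\xi\in V^*$, $\xi^\vee\in V$ is defined by $\eta(\xi^\vee)=2\langle\eta,\xi\rangle/\langle\xi,\xi\rangle$ for all $\eta\in V^*$. $W\subset O(V)$ is the Weyl group generated by $s_\alpha(v)=v-\alpha(v)\alpha^\vee$ ($\alpha\in R$). $X\subset V^*$ is a full lattice containing the root lattice $Q=\mathbb{Z}R$ and such that its dual lattice $Y=\{y\in V\mid \xi(y)\in\mathbb{Z}\ \forall \xi\in X\}$ contains the co-root lattice $Q^\vee=\mathbb{Z}R^\vee$. $t_y(v)=v+y$; $W^a=W\ltimes Y=\{wt_y\}$ is the extended affine Weyl group, acting on $V$ by isometries; $D:W^a\to W$, $D(wt_y)=w$. $R^a=\{\alpha+m1\mid\alpha\in R,m\in\mathbb{Z}\}$ is the affine root system, $a=\alpha+m1$ being the function $a(v)=\alpha(v)+m$ on $V$; $Da:=\alpha$, $Da^\vee:=\alpha^\vee$.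 $W^a$ acts on $R^a$ by $(wa)(v)=a(w^{-1}v)$. $V_a=a^{-1}(0)$ and $s_a(v)=v-a(v)Da^\vee$, an element of $W^a$. Fix a basis $F$ of $R$ with positive/negative roots $R^\pm$ and highest root $\theta$; $a_0=-\theta+1$, $F^a=F\cup\{a_0\}$, $R^{a,+}=(R+\mathbb{Z}_{>0}1)\cup R^+$, $R^{a,-}=-R^{a,+}$; $l(w)=\#(R^{a,+}\cap w^{-1}R^{a,-})$ and $\Omega=\{w\in W^a\mid l(w)=0\}$. A multiplicity function is a $W^a$-invariant function $k:R^a\to\mathbb{C}$, $a\mapsto k_a$. Algebra $A(k)$: the unital associative $\mathbb{C}$-algebra containing $S(V_{\mathbb{C}})$ and $\mathbb{C}[W^a]$ as subalgebras, such that multiplication $S(V_{\mathbb{C}})\otimes_{\mathbb{C}}\mathbb{C}[W^a]\to A(k)$ is a linear isomorphism, with relations $s_a\cdot v-s_{Da}(v)\cdot s_a=-k_a\,Da(v)$ ($a\in F^a$, $v\in V_{\mathbb{C}}$) and $\omega\cdot v=(D\omega)(v)\cdot\omega$ ($\omega\in\Omega$, $v\in V_{\mathbb{C}}$). Function spaces. $C_+=\{v\in V\mid a(v)>0\ \forall a\in F^a\}$; $V_{reg}=V\setminus\bigcup_{a\in R^{a,+}}V_a$; $\mathcal{C}$ is the set of connected components (chambers) of $V_{reg}$, which are the $w(C_+)$, $w\in W^a$. $C^\omega(V)$ is the space of complex-valued real analytic functions on $V$. $B^\omega(V;M)$ is the space of functions $f:V_{reg}\to M$ such that for every $C\in\mathcal{C}$,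 $f|_C=f_C|_C$ for some (unique) $f_C\in C^\omega(V)\otimes_{\mathbb{C}}M$ (algebraic tensor product). $W^a$ acts on it by $(w\cdot f)(v)=w(f(w^{-1}v))$. Dunkl type operators. For $a\in R^{a,+}$ and $v\in V_{reg}$ let $\mathcal{I}_a(v)=1$ if $a(v)<0$ and $\mathcal{I}_a(v)=0$ if $a(v)>0$. For $v\in V$ and $f\in B^\omega(V;M)$, $$\mathcal{D}_v^{k,M}f=\partial_vf-\sum_{a\in R^{a,+}}k_a(Da)(v)\,\mathcal{I}_a(\cdot)\,(s_a\cdot f),$$ where $\partial_v$ is the directional derivative; on each chamber only finitely many terms are nonzero, so this is a well-defined linear operator on $B^\omega(V;M)$. *)

theory Defs
  imports "HOL-Analysis.Analysis" "HOL-Library.Poly_Mapping"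
begin

section \<open>Root data\<close>

text \<open>
  The Euclidean space V is a type of class \<^class>\<open>euclidean_space\<close>; every linear functional on it is
  bounded, so its dual is the type of bounded linear functionals. The induced scalar product on the
  dual is the one making the dual of the orthonormal basis \<^const>\<open>Basis\<close> orthonormal.
\<close>

type_synonym 'v dual = "'v \<Rightarrow>\<^sub>L real"

definition dual_inner :: "'v::euclidean_space dual \<Rightarrow> 'v dual \<Rightarrow> real" where
  "dual_inner \<xi> \<eta> = (\<Sum>b\<in>Basis. blinfun_apply \<xi> b * blinfun_apply \<eta> b)"

definition covec :: "'v::euclidean_space dual \<Rightarrow> 'v" where
  "covec \<xi> = (\<Sum>b\<in>Basis. (2 * blinfun_apply \<xi> b / dual_inner \<xi> \<xi>) *\<^sub>R b)"

lemma covec_eval: "blinfun_apply \<eta> (covec \<xi>) = 2 * dual_inner \<eta> \<xi> / dual_inner \<xi> \<xi>"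
  by (simp add: covec_def dual_inner_def blinfun.sum_right blinfun.scaleR_right
      sum_distrib_left sum_divide_distrib mult_ac)

text \<open>The defining property of the vector attached to a functional; it holds for exactly one vector.\<close>

lemma covec_unique:
  "(\<forall>\<eta>. blinfun_apply \<eta> x = 2 * dual_inner \<eta> \<xi> / dual_inner \<xi> \<xi>) \<longleftrightarrow> x = covec \<xi>"
proof
  assume *: "\<forall>\<eta>. blinfun_apply \<eta> x = 2 * dual_inner \<eta> \<xi> / dual_inner \<xi> \<xi>"
  show "x = covec \<xi>"
  proof (rule euclidean_eqI)
    fix b :: 'a
    have "blinfun_apply (blinfun_inner_left b) x = blinfun_apply (blinfun_inner_left b) (covec \<xi>)"
      using * covec_eval by metis
    then show "x \<bullet> b = covec \<xi> \<bullet> b" by simp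
  qed
qed (simp add: covec_eval)

definition root_refl :: "'v::euclidean_space dual \<Rightarrow> 'v \<Rightarrow> 'v" where
  "root_refl \<alpha> v = v - blinfun_apply \<alpha> v *\<^sub>R covec \<alpha>"

text \<open>
  A reduced crystallographic root system, irreducible in its span. The second clause says that the
  reflection in a root, transported to the dual, permutes the roots.
\<close>

definition irreducible_root_system :: "'v::euclidean_space dual set \<Rightarrow> bool" where
  "irreducible_root_system R \<longleftrightarrow>
     finite R \<and> R \<noteq> {} \<and> 0 \<notin> R \<and>
     (\<forall>\<alpha>\<in>R. \<forall>\<beta>\<in>R. \<beta> - blinfun_apply \<beta> (covec \<alpha>) *\<^sub>R \<alpha> \<in> R) \<and>
     (\<forall>\<alpha>\<in>R. \<forall>\<beta>\<in>R. blinfun_apply \<beta> (covec \<alpha>) \<in> \<int>) \<and>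
     (\<forall>\<alpha>\<in>R. \<forall>c. c *\<^sub>R \<alpha> \<in> R \<longrightarrow> c = 1 \<or> c = -1) \<and>
     \<not> (\<exists>R\<^sub>1 R\<^sub>2. R\<^sub>1 \<noteq> {} \<and> R\<^sub>2 \<noteq> {} \<and> R\<^sub>1 \<inter> R\<^sub>2 = {} \<and> R = R\<^sub>1 \<union> R\<^sub>2 \<and>
          (\<forall>\<alpha>\<in>R\<^sub>1. \<forall>\<beta>\<in>R\<^sub>2. dual_inner \<alpha> \<beta> = 0))"

definition int_span :: "'b::real_vector set \<Rightarrow> 'b set" where
  "int_span S = {\<Sum>b\<in>B. of_int (n b) *\<^sub>R b | B n. finite B \<and> B \<subseteq> S}"

definition full_lattice :: "'b::real_vector set \<Rightarrow> bool" where
  "full_lattice L \<longleftrightarrow> (\<exists>B. independent B \<and> span B = UNIV \<and> L = int_span B)"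

definition dual_lattice :: "'v::euclidean_space dual set \<Rightarrow> 'v set" where
  "dual_lattice X = {y. \<forall>\<xi>\<in>X. blinfun_apply \<xi> y \<in> \<int>}"

definition nonneg_comb :: "'v::euclidean_space dual set \<Rightarrow> 'v dual \<Rightarrow> bool" where
  "nonneg_comb F \<beta> \<longleftrightarrow> (\<exists>n :: 'v dual \<Rightarrow> nat. \<beta> = (\<Sum>\<alpha>\<in>F. of_nat (n \<alpha>) *\<^sub>R \<alpha>))"

definition root_basis :: "'v::euclidean_space dual set \<Rightarrow> 'v dual set \<Rightarrow> bool" where
  "root_basis R F \<longleftrightarrow>
     F \<subseteq> R \<and> independent F \<and> (\<forall>\<beta>\<in>R. nonneg_comb F \<beta> \<or> nonneg_comb F (- \<beta>))"

definition highest_root :: "'v::euclidean_space dual set \<Rightarrow> 'v dual set \<Rightarrow> 'v dual \<Rightarrow> bool" where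
  "highest_root R F \<theta> \<longleftrightarrow> \<theta> \<in> R \<and> (\<forall>\<beta>\<in>R. nonneg_comb F (\<theta> - \<beta>))"

locale affine_root_datum =
  fixes R :: "'v::euclidean_space dual set"
    and X :: "'v dual set"
    and F :: "'v dual set"
    and \<theta> :: "'v dual"
  assumes root_system: "irreducible_root_system R"
    and lattice: "full_lattice X"
    and root_lattice: "int_span R \<subseteq> X"
    and coroot_lattice: "int_span (covec ` R) \<subseteq> dual_lattice X"
    and basis: "root_basis R F"
    and highest: "highest_root R F \<theta>"

inductive_set gen_group :: "('v \<Rightarrow> 'v) set \<Rightarrow> ('v \<Rightarrow> 'v) set" for S where
  one: "id \<in> gen_group S"
| gen: "g \<in> S \<Longrightarrow> g \<in> gen_group S"
| mult: "g \<in> gen_group S \<Longrightarrow> h \<in> gen_group S \<Longrightarrow> g \<circ> h \<in> gen_group S"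
| inv: "g \<in> gen_group S \<Longrightarrow> inv g \<in> gen_group S"

definition weyl :: "'v::euclidean_space dual set \<Rightarrow> ('v \<Rightarrow> 'v) set" where
  "weyl R = gen_group (root_refl ` R)"

definition transl :: "'v::euclidean_space \<Rightarrow> 'v \<Rightarrow> 'v" where
  "transl y v = v + y"

text \<open>The extended affine Weyl group, realised as a group of isometries of V.\<close>

definition aff_weyl :: "'v::euclidean_space dual set \<Rightarrow> 'v dual set \<Rightarrow> ('v \<Rightarrow> 'v) set" where
  "aff_weyl R X = {w \<circ> transl y | w y. w \<in> weyl R \<and> y \<in> dual_lattice X}"

definition lin_part ::
  "'v::euclidean_space dual set \<Rightarrow> 'v dual set \<Rightarrow> ('v \<Rightarrow> 'v) \<Rightarrow> ('v \<Rightarrow> 'v)" where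
  "lin_part R X g = (THE w. w \<in> weyl R \<and> (\<exists>y\<in>dual_lattice X. g = w \<circ> transl y))"

lemma linear_root_refl: "linear (root_refl \<alpha>)"
  by (rule linearI) (auto simp: root_refl_def blinfun.add_right blinfun.scaleR_right algebra_simps)

lemma root_refl_root_refl: "\<alpha> \<noteq> 0 \<Longrightarrow> root_refl \<alpha> (root_refl \<alpha> v) = v"
proof -
  assume "\<alpha> \<noteq> 0"
  then obtain b where "b \<in> Basis" "blinfun_apply \<alpha> b \<noteq> 0"
    using blinfun_euclidean_eqI[of \<alpha> 0] by auto
  then have "dual_inner \<alpha> \<alpha> > 0"
    unfolding dual_inner_def by (intro sum_pos2[of _ b]) (auto simp: zero_less_mult_iff)
  then show ?thesis
    by (simp add: root_refl_def blinfun.diff_right blinfun.scaleR_right covec_eval algebra_simps)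
qed

lemma weyl_linear_bij:
  assumes "0 \<notin> R" "w \<in> weyl R"
  shows "linear w \<and> bij w"
  using assms(2) unfolding weyl_def
proof induction
  case one
  show ?case using bij_id linear_id by blast
next
  case (gen g)
  then obtain \<alpha> where "\<alpha> \<in> R" "g = root_refl \<alpha>" by blast
  with assms(1) have "g (g v) = v" for v using root_refl_root_refl[of \<alpha> v] by auto
  then have "bij g" by (rule involuntory_imp_bij)
  with \<open>g = root_refl \<alpha>\<close> linear_root_refl show ?case by blast
next
  case (mult g h)
  then show ?case using linear_compose bij_comp by blast
next
  case (inv g)
  then have "linear g" "bij g" by auto
  then have g: "g (inv g v) = v" "inv g (g v) = v" for v
    by (simp_all add: bij_is_surj surj_f_inv_f bij_is_inj)
  have "linear (inv g)"
  proof (rule linearI)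
    fix u v :: 'a and c :: real
    have "g (inv g u + inv g v) = u + v" by (simp add: linear_add[OF \<open>linear g\<close>] g)
    then show "inv g (u + v) = inv g u + inv g v" by (metis g(2))
    have "g (c *\<^sub>R inv g u) = c *\<^sub>R u" by (simp add: linear_scale[OF \<open>linear g\<close>] g)
    then show "inv g (c *\<^sub>R u) = c *\<^sub>R inv g u" by (metis g(2))
  qed
  with \<open>bij g\<close> show ?case by (simp add: bij_imp_bij_inv)
qed

lemma lin_part_eq:
  assumes "0 \<notin> R" "w \<in> weyl R" "y \<in> dual_lattice X"
  shows "lin_part R X (w \<circ> transl y) = w"
  unfolding lin_part_def
proof (rule the_equality)
  fix w' assume "w' \<in> weyl R \<and> (\<exists>y'\<in>dual_lattice X. w \<circ> transl y = w' \<circ> transl y')"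
  then obtain y' where w': "w' \<in> weyl R" and eq: "w (v + y) = w' (v + y')" for v
    by (auto simp: fun_eq_iff transl_def)
  have lin: "linear w" "linear w'" using assms w' weyl_linear_bij by blast+
  show "w' = w"
  proof
    fix v
    show "w' v = w v"
      using eq[of v] eq[of 0] by (simp add: linear_add[OF lin(1)] linear_add[OF lin(2)])
  qed
qed (use assms in blast)

section \<open>Affine roots\<close>

text \<open>
  Affine roots are functions on V, so the action of w on them is \<open>a \<circ> inv w\<close>.
\<close>

definition aff_fun :: "'v::euclidean_space dual \<Rightarrow> int \<Rightarrow> 'v \<Rightarrow> real" where
  "aff_fun \<alpha> m v = blinfun_apply \<alpha> v + of_int m"

definition aff_roots :: "'v::euclidean_space dual set \<Rightarrow> ('v \<Rightarrow> real) set" where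
  "aff_roots R = {aff_fun \<alpha> m | \<alpha> m. \<alpha> \<in> R}"

definition grad :: "('v::euclidean_space \<Rightarrow> real) \<Rightarrow> 'v dual" where
  "grad a = (THE \<alpha>. \<exists>m. a = aff_fun \<alpha> m)"

lemma grad_aff_fun: "grad (aff_fun \<alpha> m) = \<alpha>"
  unfolding grad_def
proof (rule the_equality)
  fix \<beta> assume "\<exists>n. aff_fun \<alpha> m = aff_fun \<beta> n"
  then obtain n where n: "aff_fun \<alpha> m v = aff_fun \<beta> n v" for v by auto
  from n[of 0] have "m = n" by (simp add: aff_fun_def)
  with n show "\<beta> = \<alpha>" by (intro blinfun_eqI) (simp add: aff_fun_def)
qed blast

definition aff_refl :: "('v::euclidean_space \<Rightarrow> real) \<Rightarrow> 'v \<Rightarrow> 'v" where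
  "aff_refl a v = v - a v *\<^sub>R covec (grad a)"

definition pos_roots :: "'v::euclidean_space dual set \<Rightarrow> 'v dual set \<Rightarrow> 'v dual set" where
  "pos_roots R F = {\<beta> \<in> R. nonneg_comb F \<beta>}"

definition aff_pos_roots ::
  "'v::euclidean_space dual set \<Rightarrow> 'v dual set \<Rightarrow> ('v \<Rightarrow> real) set" where
  "aff_pos_roots R F =
     {aff_fun \<alpha> m | \<alpha> m. \<alpha> \<in> R \<and> m > 0} \<union> {aff_fun \<alpha> 0 | \<alpha>. \<alpha> \<in> pos_roots R F}"

definition aff_neg_roots ::
  "'v::euclidean_space dual set \<Rightarrow> 'v dual set \<Rightarrow> ('v \<Rightarrow> real) set" where
  "aff_neg_roots R F = (\<lambda>a v. - a v) ` aff_pos_roots R F"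

definition aff_simple_roots ::
  "'v::euclidean_space dual set \<Rightarrow> 'v dual \<Rightarrow> ('v \<Rightarrow> real) set" where
  "aff_simple_roots F \<theta> = insert (aff_fun (- \<theta>) 1) ((\<lambda>\<alpha>. aff_fun \<alpha> 0) ` F)"

text \<open>
  The action of the inverse of w sends a to \<open>a \<circ> w\<close>. The set counted by the length is finite for
  every w in the extended affine Weyl group.
\<close>

definition aff_length ::
  "'v::euclidean_space dual set \<Rightarrow> 'v dual set \<Rightarrow> ('v \<Rightarrow> 'v) \<Rightarrow> nat" where
  "aff_length R F w = card (aff_pos_roots R F \<inter> (\<lambda>a. a \<circ> w) ` aff_neg_roots R F)"

definition length_zero ::
  "'v::euclidean_space dual set \<Rightarrow> 'v dual set \<Rightarrow> 'v dual set \<Rightarrow> ('v \<Rightarrow> 'v) set" where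
  "length_zero R X F = {w \<in> aff_weyl R X. aff_length R F w = 0}"

definition multiplicity_function ::
  "'v::euclidean_space dual set \<Rightarrow> 'v dual set \<Rightarrow> (('v \<Rightarrow> real) \<Rightarrow> complex) \<Rightarrow> bool" where
  "multiplicity_function R X k \<longleftrightarrow>
     (\<forall>w\<in>aff_weyl R X. \<forall>a\<in>aff_roots R. k (a \<circ> inv w) = k a)"

section \<open>The symmetric algebra and the group algebra\<close>

text \<open>
  A vector \<open>(x, y)\<close> of the complexification of V stands for \<open>x + i y\<close>. The symmetric algebra of the
  complexification is the polynomial algebra over the complex numbers with one variable for each
  element of the basis \<^const>\<open>Basis\<close>; \<open>sym_vec\<close> is the inclusion of the complexification as the
  polynomials of degree one.
\<close>

typedef (overloaded) ('v::euclidean_space) coord = "Basis :: 'v set"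
  by (rule nonempty_Basis[unfolded ex_in_conv[symmetric]])

instance coord :: (euclidean_space) finite
proof
  have "UNIV = Abs_coord ` (Basis :: 'a set)"
    by (metis type_definition.Abs_image type_definition_coord)
  then show "finite (UNIV :: 'a coord set)" by (metis finite_Basis finite_imageI)
qed

type_synonym 'v cvec = "'v \<times> 'v"

type_synonym 'v sym_alg = "('v coord \<Rightarrow>\<^sub>0 nat) \<Rightarrow>\<^sub>0 complex"

definition sym_const :: "complex \<Rightarrow> 'v::euclidean_space sym_alg" where
  "sym_const c = Poly_Mapping.single 0 c"

definition sym_vec :: "'v::euclidean_space cvec \<Rightarrow> 'v sym_alg" where
  "sym_vec z = (\<Sum>b\<in>UNIV. Poly_Mapping.single (Poly_Mapping.single b 1)
     (Complex (fst z \<bullet> Rep_coord b) (snd z \<bullet> Rep_coord b)))"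

definition cvec_map :: "('v \<Rightarrow> 'v) \<Rightarrow> 'v::euclidean_space cvec \<Rightarrow> 'v cvec" where
  "cvec_map g z = (g (fst z), g (snd z))"

definition cvec_eval :: "'v::euclidean_space dual \<Rightarrow> 'v cvec \<Rightarrow> complex" where
  "cvec_eval \<xi> z = Complex (blinfun_apply \<xi> (fst z)) (blinfun_apply \<xi> (snd z))"

text \<open>
  The complex group algebra of a group G of transformations consists of the finitely supported
  functions on G, that is, of the \<open>c\<close> with \<^term>\<open>Poly_Mapping.keys c \<subseteq> G\<close>; its product is
  convolution with respect to composition (not the multiplication of \<^theory>\<open>HOL-Library.Poly_Mapping\<close>).
\<close>

definition group_alg :: "('v \<Rightarrow> 'v) set \<Rightarrow> (('v \<Rightarrow> 'v) \<Rightarrow>\<^sub>0 complex) set" where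
  "group_alg G = {c. Poly_Mapping.keys c \<subseteq> G}"

definition group_elt :: "('v \<Rightarrow> 'v) \<Rightarrow> (('v \<Rightarrow> 'v) \<Rightarrow>\<^sub>0 complex)" where
  "group_elt g = Poly_Mapping.single g 1"

definition group_alg_scale ::
  "complex \<Rightarrow> (('v \<Rightarrow> 'v) \<Rightarrow>\<^sub>0 complex) \<Rightarrow> (('v \<Rightarrow> 'v) \<Rightarrow>\<^sub>0 complex)" where
  "group_alg_scale z c = Poly_Mapping.map ((*) z) c"

definition group_alg_mult ::
  "(('v \<Rightarrow> 'v) \<Rightarrow>\<^sub>0 complex) \<Rightarrow> (('v \<Rightarrow> 'v) \<Rightarrow>\<^sub>0 complex) \<Rightarrow> (('v \<Rightarrow> 'v) \<Rightarrow>\<^sub>0 complex)" where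
  "group_alg_mult c d =
     (\<Sum>g\<in>Poly_Mapping.keys c. \<Sum>h\<in>Poly_Mapping.keys d.
        Poly_Mapping.single (g \<circ> h) (Poly_Mapping.lookup c g * Poly_Mapping.lookup d h))"

section \<open>The algebra A(k)\<close>

locale complex_algebra = vector_space scale
  for scale :: "complex \<Rightarrow> 'a::ring_1 \<Rightarrow> 'a" +
  assumes scale_mult_left: "scale c x * y = scale c (x * y)"
    and scale_mult_right: "x * scale c y = scale c (x * y)"

text \<open>
  The algebra is the type \<open>'a\<close> with scalar multiplication \<open>scale\<close>; \<open>iS\<close> and \<open>iW\<close> are the inclusions
  of the symmetric algebra and of the group algebra. Since the group elements form a basis of the
  group algebra, the tensor product of the two is the space of finitely supported functions from the
  group to the symmetric algebra, and \<open>mult_iso\<close> is the bijectivity of the multiplication map.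
\<close>

locale A_algebra = complex_algebra scale
  for R :: "'v::euclidean_space dual set"
    and X :: "'v dual set"
    and F :: "'v dual set"
    and \<theta> :: "'v dual"
    and k :: "('v \<Rightarrow> real) \<Rightarrow> complex"
    and scale :: "complex \<Rightarrow> 'a::ring_1 \<Rightarrow> 'a" +
  fixes iS :: "'v sym_alg \<Rightarrow> 'a"
    and iW :: "(('v \<Rightarrow> 'v) \<Rightarrow>\<^sub>0 complex) \<Rightarrow> 'a"
  assumes iS_one: "iS 1 = 1"
    and iS_add: "iS (p + q) = iS p + iS q"
    and iS_mult: "iS (p * q) = iS p * iS q"
    and iS_scale: "iS (sym_const t * p) = scale t (iS p)"
    and iS_inj: "inj iS"
    and iW_one: "iW (group_elt id) = 1"
    and iW_add: "\<lbrakk>c \<in> group_alg (aff_weyl R X); d \<in> group_alg (aff_weyl R X)\<rbrakk>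
                  \<Longrightarrow> iW (c + d) = iW c + iW d"
    and iW_mult: "\<lbrakk>c \<in> group_alg (aff_weyl R X); d \<in> group_alg (aff_weyl R X)\<rbrakk>
                  \<Longrightarrow> iW (group_alg_mult c d) = iW c * iW d"
    and iW_scale: "c \<in> group_alg (aff_weyl R X) \<Longrightarrow> iW (group_alg_scale t c) = scale t (iW c)"
    and iW_inj: "inj_on iW (group_alg (aff_weyl R X))"
    and mult_iso:
      "bij_betw
         (\<lambda>p :: ('v \<Rightarrow> 'v) \<Rightarrow>\<^sub>0 'v sym_alg.
            \<Sum>w\<in>Poly_Mapping.keys p. iS (Poly_Mapping.lookup p w) * iW (group_elt w))
         {p. Poly_Mapping.keys p \<subseteq> aff_weyl R X} UNIV"
    and cross_relation:
      "a \<in> aff_simple_roots F \<theta> \<Longrightarrow>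
         iW (group_elt (aff_refl a)) * iS (sym_vec z)
           - iS (sym_vec (cvec_map (root_refl (grad a)) z)) * iW (group_elt (aff_refl a))
         = - scale (k a * cvec_eval (grad a) z) 1"
    and length_zero_relation:
      "\<omega> \<in> length_zero R X F \<Longrightarrow>
         iW (group_elt \<omega>) * iS (sym_vec z)
         = iS (sym_vec (cvec_map (lin_part R X \<omega>) z)) * iW (group_elt \<omega>)"

section \<open>Function spaces\<close>

definition regular_set :: "'v::euclidean_space dual set \<Rightarrow> 'v dual set \<Rightarrow> 'v set" where
  "regular_set R F = UNIV - (\<Union>a\<in>aff_pos_roots R F. {v. a v = 0})"

text \<open>
  Real analyticity: local expansion in an unconditionally (hence absolutely) convergent power series,
  whose multi-indices are the functions from \<^const>\<open>Basis\<close> to the natural numbers.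
\<close>

definition real_analytic :: "('v::euclidean_space \<Rightarrow> complex) \<Rightarrow> bool" where
  "real_analytic \<phi> \<longleftrightarrow>
     (\<forall>x. \<exists>c :: ('v \<Rightarrow> nat) \<Rightarrow> complex. \<exists>r>0. \<forall>y\<in>ball x r.
        ((\<lambda>n. c n * of_real (\<Prod>b\<in>Basis. ((y - x) \<bullet> b) ^ n b)) has_sum \<phi> y)
          (Basis \<rightarrow>\<^sub>E UNIV))"

text \<open>
  The functions of the form \<open>v \<mapsto> \<Sum>i<n. \<phi> i v \<cdot> m i\<close> with real analytic \<open>\<phi> i\<close>. As the scalars form a
  field, they are in canonical bijection with the elements of the algebraic tensor product.
\<close>

definition tensor_fun ::
  "(complex \<Rightarrow> 'm::ab_group_add \<Rightarrow> 'm) \<Rightarrow> nat \<Rightarrow> (nat \<Rightarrow> 'v::euclidean_space \<Rightarrow> complex) \<Rightarrow> (nat \<Rightarrow> 'm)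
     \<Rightarrow> 'v \<Rightarrow> 'm" where
  "tensor_fun scaleM n \<phi> m v = (\<Sum>i<n. scaleM (\<phi> i v) (m i))"

definition analytic_tensor ::
  "(complex \<Rightarrow> 'm::ab_group_add \<Rightarrow> 'm) \<Rightarrow> ('v::euclidean_space \<Rightarrow> 'm) set" where
  "analytic_tensor scaleM = {tensor_fun scaleM n \<phi> m | n \<phi> m. \<forall>i<n. real_analytic (\<phi> i)}"

text \<open>A function on the regular set is extended by zero to all of V.\<close>

definition B_space ::
  "'v::euclidean_space dual set \<Rightarrow> 'v dual set \<Rightarrow> (complex \<Rightarrow> 'm::ab_group_add \<Rightarrow> 'm)
     \<Rightarrow> ('v \<Rightarrow> 'm) set" where
  "B_space R F scaleM =
     {f. (\<forall>v. v \<notin> regular_set R F \<longrightarrow> f v = 0) \<and>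
         (\<forall>C\<in>components (regular_set R F). \<exists>g\<in>analytic_tensor scaleM. \<forall>v\<in>C. f v = g v)}"

locale aff_weyl_module = vector_space scaleM
  for R :: "'v::euclidean_space dual set"
    and X :: "'v dual set"
    and scaleM :: "complex \<Rightarrow> 'm::ab_group_add \<Rightarrow> 'm" +
  fixes act :: "('v \<Rightarrow> 'v) \<Rightarrow> 'm \<Rightarrow> 'm"
  assumes act_id: "act id m = m"
    and act_comp: "\<lbrakk>g \<in> aff_weyl R X; h \<in> aff_weyl R X\<rbrakk> \<Longrightarrow> act (g \<circ> h) m = act g (act h m)"
    and act_linear: "g \<in> aff_weyl R X \<Longrightarrow> Vector_Spaces.linear scaleM scaleM (act g)"

definition fun_act :: "(('v \<Rightarrow> 'v) \<Rightarrow> 'm \<Rightarrow> 'm) \<Rightarrow> ('v \<Rightarrow> 'v) \<Rightarrow> ('v \<Rightarrow> 'm) \<Rightarrow> ('v \<Rightarrow> 'm)" where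
  "fun_act act w f = (\<lambda>v. act w (f (inv w v)))"

text \<open>
  M carries no topology: on a chamber, where \<open>f\<close> is given by a tensor, the directional derivative acts
  on the scalar factors of the tensor.
\<close>

definition dir_deriv :: "'v::euclidean_space \<Rightarrow> ('v \<Rightarrow> complex) \<Rightarrow> 'v \<Rightarrow> complex" where
  "dir_deriv v \<phi> x = vector_derivative (\<lambda>t. \<phi> (x + t *\<^sub>R v)) (at 0)"

definition B_deriv ::
  "'v::euclidean_space dual set \<Rightarrow> 'v dual set \<Rightarrow> (complex \<Rightarrow> 'm::ab_group_add \<Rightarrow> 'm)
     \<Rightarrow> 'v \<Rightarrow> ('v \<Rightarrow> 'm) \<Rightarrow> 'v \<Rightarrow> 'm" where
  "B_deriv R F scaleM v f x =
     (if x \<in> regular_set R F then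
        (THE d. \<exists>C\<in>components (regular_set R F). \<exists>n \<phi> m.
           x \<in> C \<and> (\<forall>i<n. real_analytic (\<phi> i)) \<and>
           (\<forall>y\<in>C. f y = tensor_fun scaleM n \<phi> m y) \<and>
           d = tensor_fun scaleM n (\<lambda>i. dir_deriv v (\<phi> i)) m x)
      else 0)"

definition neg_ind :: "('v \<Rightarrow> real) \<Rightarrow> 'v \<Rightarrow> complex" where
  "neg_ind a x = (if a x < 0 then 1 else 0)"

text \<open>
  At each point only finitely many terms of the sum are nonzero; the summation is restricted to the
  affine roots with \<open>neg_ind a x \<noteq> 0\<close> because \<^const>\<open>sum\<close> over an infinite set is 0 by convention.
\<close>

definition dunkl ::
  "'v::euclidean_space dual set \<Rightarrow> 'v dual set \<Rightarrow> (('v \<Rightarrow> real) \<Rightarrow> complex)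
     \<Rightarrow> (complex \<Rightarrow> 'm::ab_group_add \<Rightarrow> 'm) \<Rightarrow> (('v \<Rightarrow> 'v) \<Rightarrow> 'm \<Rightarrow> 'm)
     \<Rightarrow> 'v \<Rightarrow> ('v \<Rightarrow> 'm) \<Rightarrow> ('v \<Rightarrow> 'm)" where
  "dunkl R F k scaleM act v f = (\<lambda>x.
     if x \<in> regular_set R F then
       B_deriv R F scaleM v f x
       - (\<Sum>a\<in>{a \<in> aff_pos_roots R F. neg_ind a x \<noteq> 0}.
            scaleM (k a * of_real (blinfun_apply (grad a) v) * neg_ind a x)
              (fun_act act (aff_refl a) f x))
     else 0)"

section \<open>Endomorphisms\<close>

text \<open>
  Complex linear endomorphisms of a space B of M-valued functions, normalised to be undefined outside
  B, so that two endomorphisms are equal iff they agree on B.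
\<close>

definition endomorphisms ::
  "(complex \<Rightarrow> 'm::ab_group_add \<Rightarrow> 'm) \<Rightarrow> ('v \<Rightarrow> 'm) set \<Rightarrow> (('v \<Rightarrow> 'm) \<Rightarrow> ('v \<Rightarrow> 'm)) set" where
  "endomorphisms scaleM B =
     {T \<in> B \<rightarrow>\<^sub>E B.
        (\<forall>f\<in>B. \<forall>g\<in>B. T (\<lambda>v. f v + g v) = (\<lambda>v. T f v + T g v)) \<and>
        (\<forall>c. \<forall>f\<in>B. T (\<lambda>v. scaleM c (f v)) = (\<lambda>v. scaleM c (T f v)))}"

definition algebra_hom_to_End ::
  "(complex \<Rightarrow> 'a::ring_1 \<Rightarrow> 'a) \<Rightarrow> (complex \<Rightarrow> 'm::ab_group_add \<Rightarrow> 'm) \<Rightarrow> ('v \<Rightarrow> 'm) set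
     \<Rightarrow> ('a \<Rightarrow> ('v \<Rightarrow> 'm) \<Rightarrow> ('v \<Rightarrow> 'm)) \<Rightarrow> bool" where
  "algebra_hom_to_End scaleA scaleM B \<pi> \<longleftrightarrow>
     (\<forall>x. \<pi> x \<in> endomorphisms scaleM B) \<and>
     (\<forall>f\<in>B. \<pi> 1 f = f) \<and>
     (\<forall>x y. \<forall>f\<in>B. \<pi> (x + y) f = (\<lambda>v. \<pi> x f v + \<pi> y f v)) \<and>
     (\<forall>c x. \<forall>f\<in>B. \<pi> (scaleA c x) f = (\<lambda>v. scaleM c (\<pi> x f v))) \<and>
     (\<forall>x y. \<forall>f\<in>B. \<pi> (x * y) f = \<pi> x (\<pi> y f))"

end

theory Submission
  imports Defs "HOL-Complex_Analysis.Cauchy_Integral_Formula" "HOL-Library.Function_Algebras"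
begin

text \<open>
  On the fundamental alcove the operators \<open>D(v)\<close> are the directional derivatives, so they commute
  there. The cross relation with a simple reflection s follows from the fact that s permutes the
  positive affine roots other than its own root, and it shows that s conjugates the commutator of
  \<open>D(v)\<close> and \<open>D(u)\<close> to that of \<open>D(sv)\<close> and \<open>D(su)\<close>. Every regular point is
  carried into the fundamental alcove by simple reflections, each of which lowers the number of
  positive affine roots that are negative at the point; hence the operators commute everywhere, and
  no computation in root systems of rank two is needed. Once the operators satisfy the relations,
  the multiplication isomorphism defines the representation, and multiplicativity need only be
  tested on generators of the algebra.
\<close>

section \<open>Weighted power series\<close>

text \<open>Three obstacles shape the rest. Analyticity is stated by multi-indices in the fixed
  basis, while reflections mix the coordinates; expansions are therefore measured by a weighted sum
  of absolute coefficients, which controls monomials after a linear substitution and permits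
  rearrangement. M carries no topology, so a derivative of an M-valued function exists only through
  a tensor, and its independence of the tensor is checked by linear functionals on M. The group is
  extended by elements of length zero; these preserve the positive affine roots and conjugate D(v)
  without correction, so both kinds of generators g obey one rule g v = L(g) v g + c(g, v), with c =
  0 or c = -k Da(v). The commutator is transported without remainder because the first-order
  corrections to D(v) D(u) are symmetric in u and v. No presentation of the group by generators and
  relations enters: the group acts from the start, and only its generation by these elements is
  used.\<close>

definition multi_indices :: "('v::euclidean_space \<Rightarrow> nat) set" where
  "multi_indices = Basis \<rightarrow>\<^sub>E UNIV"

definition mdeg :: "('v::euclidean_space \<Rightarrow> nat) \<Rightarrow> nat" where
  "mdeg n = (\<Sum>b\<in>Basis. n b)"

definition mpow :: "('v::euclidean_space \<Rightarrow> nat) \<Rightarrow> 'v \<Rightarrow> complex" where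
  "mpow n h = (\<Prod>b\<in>Basis. of_real (h \<bullet> b) ^ n b)"

definition box_at_0 :: "real \<Rightarrow> 'v::euclidean_space set" where
  "box_at_0 \<rho> = {h. \<forall>b\<in>Basis. \<bar>h \<bullet> b\<bar> \<le> \<rho>}"

definition has_pseries ::
  "real \<Rightarrow> (('v::euclidean_space \<Rightarrow> nat) \<Rightarrow> complex) \<Rightarrow> ('v \<Rightarrow> complex) \<Rightarrow> bool" where
  "has_pseries \<rho> c g \<longleftrightarrow>
     (\<lambda>n. norm (c n) * \<rho> ^ mdeg n) summable_on multi_indices \<and>
     (\<forall>h\<in>box_at_0 \<rho>. ((\<lambda>n. c n * mpow n h) has_sum g h) multi_indices)"

text \<open>
  The weighted coefficient norm is submultiplicative and countably subadditive, so bounds by it survive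
  substitution into another absolutely convergent series.
\<close>

definition pseries_bound :: "real \<Rightarrow> ('v::euclidean_space \<Rightarrow> complex) \<Rightarrow> real \<Rightarrow> bool" where
  "pseries_bound \<rho> g C \<longleftrightarrow>
     (\<exists>c. has_pseries \<rho> c g \<and> (\<Sum>\<^sub>\<infinity>n\<in>multi_indices. norm (c n) * \<rho> ^ mdeg n) \<le> C)"

lemma norm_mpow_le:
  assumes "h \<in> box_at_0 \<rho>"
  shows "norm (mpow n h) \<le> \<rho> ^ mdeg n"
proof -
  have "norm (mpow n h) = (\<Prod>b\<in>Basis. \<bar>h \<bullet> b\<bar> ^ n b)"
    by (simp add: mpow_def prod_norm[symmetric] norm_power)
  also have "\<dots> \<le> (\<Prod>b\<in>Basis. \<rho> ^ n b)"
    using assms by (intro prod_mono) (auto simp: box_at_0_def intro!: power_mono)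
  finally show ?thesis by (simp add: mdeg_def power_sum)
qed

lemma norm_le_box:
  fixes \<rho> :: real
  assumes "0 \<le> \<rho>" "h \<in> box_at_0 \<rho>"
  shows "norm (h :: 'v::euclidean_space) \<le> DIM('v) * \<rho>"
proof -
  have "norm h \<le> (\<Sum>b\<in>Basis. \<bar>h \<bullet> b\<bar>)" by (rule norm_le_l1)
  also have "\<dots> \<le> (\<Sum>b\<in>(Basis::'v set). \<rho>)"
    using assms by (intro sum_mono) (auto simp: box_at_0_def)
  finally show ?thesis by simp
qed

lemma ball_subset_box: "norm h \<le> \<rho> \<Longrightarrow> h \<in> box_at_0 \<rho>"
  unfolding box_at_0_def using Basis_le_norm[of _ h] by force

lemma box_mono: "\<rho>' \<le> \<rho> \<Longrightarrow> h \<in> box_at_0 \<rho>' \<Longrightarrow> h \<in> box_at_0 \<rho>"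
  unfolding box_at_0_def by force

lemma mpow_diagonal: "mpow n (\<Sum>b\<in>Basis. \<rho> *\<^sub>R b) = of_real (\<rho> ^ mdeg n)"
proof -
  have "((\<Sum>b'\<in>Basis. \<rho> *\<^sub>R b') \<bullet> b) = \<rho>" if "b \<in> Basis" for b :: 'a
    using that by simp
  then have "mpow n (\<Sum>b\<in>Basis. \<rho> *\<^sub>R b) = (\<Prod>b\<in>Basis. of_real \<rho> ^ n b)"
    unfolding mpow_def by (intro prod.cong) auto
  then show ?thesis by (simp add: mdeg_def power_sum)
qed

lemma real_analytic_iff:
  "real_analytic \<phi> \<longleftrightarrow> (\<forall>x. \<exists>\<rho>>0. \<exists>c. has_pseries \<rho> c (\<lambda>h. \<phi> (x + h)))"
proof
  assume an: "real_analytic \<phi>"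
  show "\<forall>x. \<exists>\<rho>>0. \<exists>c. has_pseries \<rho> c (\<lambda>h. \<phi> (x + h))"
  proof
    fix x :: 'a
    from an obtain c r where r: "r > 0" and s: "\<And>y. y \<in> ball x r \<Longrightarrow>
        ((\<lambda>n. c n * mpow n (y - x)) has_sum \<phi> y) multi_indices"
      unfolding real_analytic_def multi_indices_def mpow_def by (force simp: of_real_prod)
    \<comment> \<open>Points of the box have norm at most DIM times \<rho>, that is r/2, so the box
      lies inside the ball of convergence.\<close>
    define \<rho> where "\<rho> = r / (2 * DIM('a))"
    have \<rho>: "\<rho> > 0" "DIM('a) * \<rho> < r" using r by (auto simp: \<rho>_def)
    have s': "((\<lambda>n. c n * mpow n h) has_sum \<phi> (x + h)) multi_indices" if "h \<in> box_at_0 \<rho>" for h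
      using s[of "x + h"] norm_le_box[OF _ that] \<rho> by (auto simp: dist_norm)
    \<comment> \<open>At this corner of the box every monomial takes its largest absolute value;
      unconditional convergence there is absolute and yields the weighted summability.\<close>
    define h0 :: 'a where "h0 = (\<Sum>b\<in>Basis. \<rho> *\<^sub>R b)"
    have "h0 \<in> box_at_0 \<rho>" using \<rho> by (auto simp: h0_def box_at_0_def)
    from s'[OF this] have "(\<lambda>n. c n * mpow n h0) summable_on multi_indices"
      by (rule has_sum_imp_summable)
    then have "(\<lambda>n. norm (c n * mpow n h0)) summable_on multi_indices"
      by (simp add: summable_on_iff_abs_summable_on_complex)
    moreover have "norm (c n * mpow n h0) = norm (c n) * \<rho> ^ mdeg n" for n
      using \<rho> by (simp add: h0_def mpow_diagonal norm_mult norm_power)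
    ultimately have "has_pseries \<rho> c (\<lambda>h. \<phi> (x + h))"
      using s' by (simp add: has_pseries_def)
    with \<rho> show "\<exists>\<rho>>0. \<exists>c. has_pseries \<rho> c (\<lambda>h. \<phi> (x + h))" by blast
  qed
next
  assume *: "\<forall>x. \<exists>\<rho>>0. \<exists>c. has_pseries \<rho> c (\<lambda>h. \<phi> (x + h))"
  show "real_analytic \<phi>"
    unfolding real_analytic_def
  proof
    fix x
    from * obtain \<rho> c where \<rho>: "\<rho> > 0" "has_pseries \<rho> c (\<lambda>h. \<phi> (x + h))" by blast
    have "((\<lambda>n. c n * of_real (\<Prod>b\<in>Basis. ((y - x) \<bullet> b) ^ n b)) has_sum \<phi> y) (Basis \<rightarrow>\<^sub>E UNIV)"
      if "y \<in> ball x \<rho>" for y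
    proof -
      have "y - x \<in> box_at_0 \<rho>"
        using that by (intro ball_subset_box) (auto simp: dist_norm norm_minus_commute)
      with \<rho>(2) show ?thesis
        by (force simp: has_pseries_def mpow_def multi_indices_def of_real_prod)
    qed
    with \<rho>(1) show "\<exists>c. \<exists>r>0. \<forall>y\<in>ball x r.
        ((\<lambda>n. c n * of_real (\<Prod>b\<in>Basis. ((y - x) \<bullet> b) ^ n b)) has_sum \<phi> y) (Basis \<rightarrow>\<^sub>E UNIV)"
      by blast
  qed
qed

section \<open>Regrouping, products and affine substitution of weighted power series\<close>

text \<open>Terms with the same exponent are collected along the fibres of \<open>e\<close>.
  Absolute convergence allows the regrouping, and the triangle inequality on each fibre keeps the
  weighted norm at most S. The index set is arbitrary so that constants, linear forms, shifted
  series and double series all become instances.\<close>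

lemma pseries_bound_reindex:
  assumes \<rho>: "\<rho> > 0" and e: "\<And>j. j \<in> J \<Longrightarrow> e j \<in> multi_indices"
    and S: "((\<lambda>j. norm (a j) * \<rho> ^ mdeg (e j)) has_sum S) J"
    and g: "\<And>h. h \<in> box_at_0 \<rho> \<Longrightarrow> ((\<lambda>j. a j * mpow (e j) h) has_sum g h) J"
  shows "pseries_bound \<rho> g S"
proof -
  define fib where "fib n = {j\<in>J. e j = n}" for n
  define c where "c n = infsum a (fib n)" for n
  have S': "((\<lambda>(n, j). norm (a j) * \<rho> ^ mdeg n) has_sum S) (Sigma multi_indices fib)"
    using S by (subst has_sum_reindex_bij_witness[where i="\<lambda>j. (e j, j)" and j=snd and T=J
          and h="\<lambda>j. norm (a j) * \<rho> ^ mdeg (e j)" and s'=S])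
      (auto simp: fib_def e)
  have fibs: "(\<lambda>j. norm (a j) * \<rho> ^ mdeg n) summable_on fib n" if "n \<in> multi_indices" for n
    using summable_on_SigmaD1[OF has_sum_imp_summable[OF S'] that] .
  have "(\<lambda>j. norm (a j)) summable_on fib n" if "n \<in> multi_indices" for n
    using summable_on_cmult_left[OF fibs[OF that], of "inverse (\<rho> ^ mdeg n)"] \<rho>
    by (simp add: field_simps)
  then have a: "a summable_on fib n" if "n \<in> multi_indices" for n
    using that abs_summable_summable by blast
  have outer: "((\<lambda>n. infsum (\<lambda>j. norm (a j) * \<rho> ^ mdeg n) (fib n)) has_sum S) multi_indices"
    using S' by (rule has_sum_SigmaD) (use fibs in auto)
  have le: "norm (c n) * \<rho> ^ mdeg n \<le> infsum (\<lambda>j. norm (a j) * \<rho> ^ mdeg n) (fib n)"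
    if n: "n \<in> multi_indices" for n
  proof -
    have "((\<lambda>j. a j * of_real (\<rho> ^ mdeg n)) has_sum (c n * of_real (\<rho> ^ mdeg n))) (fib n)"
      unfolding c_def by (intro has_sum_cmult_left has_sum_infsum a n)
    from norm_infsum_le[OF this has_sum_infsum[OF fibs[OF n]]]
    show ?thesis using \<rho> by (simp add: norm_mult norm_power)
  qed
  have sm: "(\<lambda>n. norm (c n) * \<rho> ^ mdeg n) summable_on multi_indices"
    using Infinite_Sum.abs_summable_on_comparison_test'[OF has_sum_imp_summable[OF outer],
        of "\<lambda>n. c n * of_real (\<rho> ^ mdeg n)"] le \<rho>
    by (simp add: norm_mult norm_power)
  have "(\<Sum>\<^sub>\<infinity>n\<in>multi_indices. norm (c n) * \<rho> ^ mdeg n) \<le> S"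
    using has_sum_mono[OF has_sum_infsum[OF sm] outer] le by blast
  moreover have "((\<lambda>n. c n * mpow n h) has_sum g h) multi_indices" if h: "h \<in> box_at_0 \<rho>" for h
  proof -
    have "((\<lambda>(n, j). a j * mpow n h) has_sum g h) (Sigma multi_indices fib)"
      using g[OF h] by (subst has_sum_reindex_bij_witness[where i="\<lambda>j. (e j, j)" and j=snd and T=J
          and h="\<lambda>j. a j * mpow (e j) h" and s'="g h"]) (auto simp: fib_def e)
    then show ?thesis
      by (rule has_sum_SigmaD) (auto simp: c_def intro!: has_sum_cmult_left has_sum_infsum a)
  qed
  ultimately show ?thesis unfolding pseries_bound_def has_pseries_def using sm by blast
qed

text \<open>The bounds C j give absolute convergence over the pairs (j, n), and the double series is
  regrouped along the exponent n. This is what makes substitution into a power series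
  legitimate.\<close>

lemma pseries_bound_infsum:
  fixes g :: "'j \<Rightarrow> 'v::euclidean_space \<Rightarrow> complex"
  assumes \<rho>: "\<rho> > 0" and g: "\<And>j. j \<in> J \<Longrightarrow> pseries_bound \<rho> (g j) (C j)"
    and C: "(C has_sum S) J"
    and G: "\<And>h. h \<in> box_at_0 \<rho> \<Longrightarrow> ((\<lambda>j. g j h) has_sum G h) J"
  shows "pseries_bound \<rho> G S"
proof -
  from g obtain c where c: "\<And>j. j \<in> J \<Longrightarrow> has_pseries \<rho> (c j) (g j)"
    "\<And>j. j \<in> J \<Longrightarrow> (\<Sum>\<^sub>\<infinity>n\<in>multi_indices. norm (c j n) * \<rho> ^ mdeg n) \<le> C j"
    unfolding pseries_bound_def by metis
  define D where "D j = (\<Sum>\<^sub>\<infinity>n\<in>multi_indices. norm (c j n) * \<rho> ^ mdeg n)" for j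
  define f where "f = (\<lambda>(j, n :: 'v \<Rightarrow> nat). norm (c j n) * \<rho> ^ mdeg n)"
  have D: "((\<lambda>n. f (j, n)) has_sum D j) multi_indices" if "j \<in> J" for j
    using c(1)[OF that] by (auto simp: has_pseries_def D_def f_def)
  have D0: "D j \<ge> 0" for j
    unfolding D_def using \<rho> by (intro infsum_nonneg) auto
  have DC: "D j \<le> C j" if "j \<in> J" for j using c(2)[OF that] by (simp add: D_def)
  have Ds: "D summable_on J"
    using Infinite_Sum.abs_summable_on_comparison_test'[OF has_sum_imp_summable[OF C], of D] D0 DC by simp
  have f: "f summable_on J \<times> multi_indices"
    by (rule summable_on_SigmaI[OF D Ds]) (use \<rho> in \<open>auto simp: f_def\<close>)
  define S' where "S' = infsum f (J \<times> multi_indices)"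
  have fS: "(f has_sum S') (J \<times> multi_indices)" unfolding S'_def using f by simp
  have "(D has_sum S') J" by (rule has_sum_SigmaD[OF fS D])
  then have "S' \<le> S" using C DC by (rule has_sum_mono)
  have "pseries_bound \<rho> G S'"
  proof (rule pseries_bound_reindex[where e=snd and a="\<lambda>(j, n). c j n" and J="J \<times> multi_indices"])
    show "((\<lambda>j. norm (case j of (j, n) \<Rightarrow> c j n) * \<rho> ^ mdeg (snd j)) has_sum S') (J \<times> multi_indices)"
      using fS by (simp add: f_def case_prod_unfold)
    fix h :: 'v assume h: "h \<in> box_at_0 \<rho>"
    show "((\<lambda>j. (case j of (j, n) \<Rightarrow> c j n) * mpow (snd j) h) has_sum G h) (J \<times> multi_indices)"
    proof (rule has_sum_SigmaI[where g="\<lambda>j. g j h"])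
      show "((\<lambda>y. (case (j, y) of (j, n) \<Rightarrow> c j n) * mpow (snd (j, y)) h) has_sum g j h)
          multi_indices" if "j \<in> J" for j
        using c(1)[OF that] h by (simp add: has_pseries_def)
      have "norm ((case j of (j, n) \<Rightarrow> c j n) * mpow (snd j) h) \<le> f j" for j
        using norm_mpow_le[OF h, of "snd j"]
        by (auto simp: f_def norm_mult case_prod_unfold intro!: mult_left_mono)
      from Infinite_Sum.abs_summable_on_comparison_test'[OF f this]
      show "(\<lambda>j. (case j of (j, n) \<Rightarrow> c j n) * mpow (snd j) h) summable_on J \<times> multi_indices"
        by (rule abs_summable_summable)
    qed (rule G[OF h])
  qed (use \<rho> in auto)
  then show ?thesis using \<open>S' \<le> S\<close> unfolding pseries_bound_def by force
qed

lemma pseries_bound_cmult: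
  assumes "\<rho> > 0" "pseries_bound \<rho> g C"
  shows "pseries_bound \<rho> (\<lambda>h. z * g h) (norm z * C)"
proof -
  from assms(2) obtain c where c: "has_pseries \<rho> c g"
    "(\<Sum>\<^sub>\<infinity>n\<in>multi_indices. norm (c n) * \<rho> ^ mdeg n) \<le> C"
    unfolding pseries_bound_def by blast
  have "has_pseries \<rho> (\<lambda>n. z * c n) (\<lambda>h. z * g h)"
    using c(1) unfolding has_pseries_def
    by (auto simp: norm_mult mult.assoc intro!: summable_on_cmult_right has_sum_cmult_right)
  moreover have "(\<Sum>\<^sub>\<infinity>n\<in>multi_indices. norm (z * c n) * \<rho> ^ mdeg n)
      = norm z * (\<Sum>\<^sub>\<infinity>n\<in>multi_indices. norm (c n) * \<rho> ^ mdeg n)"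
    using infsum_cmult_right'[of "norm z" "\<lambda>n. norm (c n) * \<rho> ^ mdeg n" multi_indices]
    by (simp add: norm_mult mult.assoc)
  ultimately show ?thesis using c(2) unfolding pseries_bound_def
    by (intro exI[of _ "\<lambda>n. z * c n"]) (auto intro: mult_left_mono)
qed

lemma mpow_add: "n \<in> multi_indices \<Longrightarrow> m \<in> multi_indices \<Longrightarrow>
   mpow (restrict (\<lambda>b. n b + m b) Basis) h = mpow n h * mpow m h"
  by (simp add: mpow_def power_add prod.distrib)

lemma mdeg_add: "mdeg (restrict (\<lambda>b. n b + m b) Basis) = mdeg n + mdeg m"
  by (simp add: mdeg_def sum.distrib)

text \<open>A monomial factor only shifts exponents and multiplies the norm by a power of \<rho>;
  the product is the absolutely convergent combination of such shifted series, weighted by the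
  coefficients of the first factor.\<close>

lemma pseries_bound_mult:
  fixes g g' :: "'v::euclidean_space \<Rightarrow> complex"
  assumes \<rho>: "\<rho> > 0" and g: "pseries_bound \<rho> g C" and g': "pseries_bound \<rho> g' C'"
  shows "pseries_bound \<rho> (\<lambda>h. g h * g' h) (C * C')"
proof -
  from g obtain c where c: "has_pseries \<rho> c g"
    "(\<Sum>\<^sub>\<infinity>n\<in>multi_indices. norm (c n) * \<rho> ^ mdeg n) \<le> C"
    unfolding pseries_bound_def by blast
  let ?s = "\<lambda>n. norm (c n) * \<rho> ^ mdeg n"
  let ?S = "infsum ?s multi_indices"
  have s: "(?s has_sum ?S) multi_indices" using c(1) by (simp add: has_pseries_def)
  have C': "0 \<le> C'"
  proof -
    from g' obtain c' :: "('v \<Rightarrow> nat) \<Rightarrow> complex"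
      where "(\<Sum>\<^sub>\<infinity>n\<in>multi_indices. norm (c' n) * \<rho> ^ mdeg n) \<le> C'"
      unfolding pseries_bound_def by blast
    then show ?thesis using \<rho> infsum_nonneg[of multi_indices "\<lambda>n. norm (c' n) * \<rho> ^ mdeg n"]
      by force
  qed
  have mono: "pseries_bound \<rho> (\<lambda>h. mpow n h * g' h) (\<rho> ^ mdeg n * C')"
    if n: "n \<in> multi_indices" for n
  proof -
    from g' obtain c' where c': "has_pseries \<rho> c' g'"
      "(\<Sum>\<^sub>\<infinity>n\<in>multi_indices. norm (c' n) * \<rho> ^ mdeg n) \<le> C'"
      unfolding pseries_bound_def by blast
    let ?S' = "\<Sum>\<^sub>\<infinity>n\<in>multi_indices. norm (c' n) * \<rho> ^ mdeg n"
    have "((\<lambda>m. \<rho> ^ mdeg n * (norm (c' m) * \<rho> ^ mdeg m)) has_sum (\<rho> ^ mdeg n * ?S')) multi_indices"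
      using c'(1) by (intro has_sum_cmult_right) (simp add: has_pseries_def)
    then have sm: "((\<lambda>m. norm (c' m) * \<rho> ^ mdeg (restrict (\<lambda>b. n b + m b) Basis))
        has_sum (\<rho> ^ mdeg n * ?S')) multi_indices"
      by (simp add: mdeg_add power_add mult_ac)
    have hs: "((\<lambda>m. c' m * mpow (restrict (\<lambda>b. n b + m b) Basis) h) has_sum mpow n h * g' h)
        multi_indices" if h: "h \<in> box_at_0 \<rho>" for h
    proof -
      have "((\<lambda>m. c' m * mpow m h) has_sum g' h) multi_indices"
        using c'(1) h by (simp add: has_pseries_def)
      from has_sum_cmult_right[OF this, of "mpow n h"] show ?thesis
        using n by (simp add: mpow_add mult_ac cong: has_sum_cong)
    qed
    have "pseries_bound \<rho> (\<lambda>h. mpow n h * g' h) (\<rho> ^ mdeg n * ?S')"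
      by (rule pseries_bound_reindex[OF \<rho> _ sm hs]) (auto simp: multi_indices_def)
    moreover have "\<rho> ^ mdeg n * ?S' \<le> \<rho> ^ mdeg n * C'"
      using c'(2) \<rho> by (intro mult_left_mono) auto
    ultimately show ?thesis unfolding pseries_bound_def by force
  qed
  have "pseries_bound \<rho> (\<lambda>h. g h * g' h) (?S * C')"
  proof (rule pseries_bound_infsum[OF \<rho>, where J=multi_indices
        and g="\<lambda>n h. c n * (mpow n h * g' h)" and C="\<lambda>n. norm (c n) * (\<rho> ^ mdeg n * C')"])
    show "pseries_bound \<rho> (\<lambda>h. c n * (mpow n h * g' h)) (norm (c n) * (\<rho> ^ mdeg n * C'))"
      if "n \<in> multi_indices" for n by (rule pseries_bound_cmult[OF \<rho> mono[OF that]])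
    show "((\<lambda>n. norm (c n) * (\<rho> ^ mdeg n * C')) has_sum ?S * C') multi_indices"
      using has_sum_cmult_left[OF s, of C'] by (simp add: mult_ac)
    fix h :: 'v assume "h \<in> box_at_0 \<rho>"
    then have "((\<lambda>n. c n * mpow n h) has_sum g h) multi_indices"
      using c(1) by (simp add: has_pseries_def)
    from has_sum_cmult_left[OF this, of "g' h"]
    show "((\<lambda>n. c n * (mpow n h * g' h)) has_sum g h * g' h) multi_indices"
      by (simp add: mult_ac)
  qed
  moreover have "?S * C' \<le> C * C'" using c(2) C' by (rule mult_right_mono)
  ultimately show ?thesis unfolding pseries_bound_def by force
qed

lemma pseries_bound_const: 
  assumes "\<rho> > 0" shows "pseries_bound \<rho> (\<lambda>h::'v::euclidean_space. z) (norm z)"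
proof -
  define e :: "unit \<Rightarrow> 'v \<Rightarrow> nat" where "e j = restrict (\<lambda>_. 0) Basis" for j
  have e: "mdeg (e j) = 0" "mpow (e j) h = 1" "e j \<in> multi_indices" for j h
    by (simp_all add: e_def mdeg_def mpow_def multi_indices_def)
  show ?thesis
    by (rule pseries_bound_reindex[OF assms, where J="{()}" and a="\<lambda>_. z" and e=e])
       (simp_all add: e has_sum_finite_iff)
qed

lemma pseries_bound_power:
  assumes "\<rho> > 0" "pseries_bound \<rho> g C"
  shows "pseries_bound \<rho> (\<lambda>h. g h ^ m) (C ^ m)"
proof (induction m)
  case 0
  show ?case using pseries_bound_const[OF assms(1), of 1] by simp
next
  case (Suc m)
  show ?case using pseries_bound_mult[OF assms Suc] by simp
qed

lemma pseries_bound_prod: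
  assumes "\<rho> > 0" "finite A" "\<And>i. i \<in> A \<Longrightarrow> pseries_bound \<rho> (g i) (C i)"
  shows "pseries_bound \<rho> (\<lambda>h. \<Prod>i\<in>A. g i h) (\<Prod>i\<in>A. C i)"
  using assms(2,3)
proof (induction A)
  case empty
  show ?case using pseries_bound_const[OF assms(1), of 1] by simp
next
  case (insert x A)
  have "pseries_bound \<rho> (\<lambda>h. \<Prod>i\<in>A. g i h) (\<Prod>i\<in>A. C i)" using insert by blast
  moreover have "pseries_bound \<rho> (g x) (C x)" using insert by blast
  ultimately show ?case using insert.hyps by (simp add: pseries_bound_mult[OF assms(1)])
qed

lemma pseries_bound_linear:
  fixes l :: "'v::euclidean_space \<Rightarrow> real" and \<rho> K :: real
  assumes \<rho>: "\<rho> > 0" and l: "linear l" and le: "\<And>b. b \<in> Basis \<Longrightarrow> \<bar>l b\<bar> \<le> K"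
  shows "pseries_bound \<rho> (\<lambda>h. of_real (l h)) (DIM('v) * K * \<rho>)"
proof -
  define e :: "'v \<Rightarrow> 'v \<Rightarrow> nat" where "e b = restrict (\<lambda>b'. if b' = b then 1 else 0) Basis" for b
  have m: "mpow (e b) h = of_real (h \<bullet> b)" "mdeg (e b) = 1" if "b \<in> Basis" for b h
  proof -
    have "mpow (e b) h = (\<Prod>b'\<in>Basis. if b' = b then of_real (h \<bullet> b) else 1)"
      unfolding mpow_def e_def by (intro prod.cong) auto
    then show "mpow (e b) h = of_real (h \<bullet> b)" using that by simp
    show "mdeg (e b) = 1" using that by (simp add: mdeg_def e_def)
  qed
  have l_eq: "l h = (\<Sum>b\<in>Basis. l b * (h \<bullet> b))" for h
    by (subst euclidean_representation[of h, symmetric])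
       (simp add: linear_sum[OF l] linear_scale[OF l] mult.commute del: euclidean_representation)
  have lh: "complex_of_real (l h) = (\<Sum>b\<in>Basis. of_real (l b) * mpow (e b) h)" for h
    by (subst l_eq) (simp add: m(1))
  have "pseries_bound \<rho> (\<lambda>h. of_real (l h)) (\<Sum>b\<in>Basis. \<bar>l b\<bar> * \<rho>)"
  proof (rule pseries_bound_reindex[OF \<rho>, where J=Basis and a="\<lambda>b. of_real (l b)" and e=e])
    show "e b \<in> multi_indices" for b by (simp add: multi_indices_def e_def)
    show "((\<lambda>b. of_real (l b) * mpow (e b) h) has_sum complex_of_real (l h)) Basis" for h
      using lh[of h] by (intro has_sum_finiteI finite_Basis)
  qed (simp_all add: \<rho> has_sum_finite_iff m(2))
  moreover have "(\<Sum>b\<in>Basis. \<bar>l b\<bar> * \<rho>) \<le> (\<Sum>b\<in>(Basis::'v set). K * \<rho>)"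
    using le \<rho> by (intro sum_mono mult_right_mono) auto
  ultimately show ?thesis unfolding pseries_bound_def by force
qed

lemma pseries_mono:
  assumes "has_pseries \<rho> c g" "0 \<le> \<rho>'" "\<rho>' \<le> \<rho>"
  shows "has_pseries \<rho>' c g"
proof -
  have "(\<lambda>n. norm (c n) * \<rho>' ^ mdeg n) summable_on multi_indices"
  proof (rule summable_on_comparison_test)
    show "(\<lambda>n. norm (c n) * \<rho> ^ mdeg n) summable_on multi_indices"
      using assms(1) by (simp add: has_pseries_def)
  qed (use assms(2,3) in \<open>auto intro!: mult_left_mono power_mono\<close>)
  with assms(1) box_mono[OF assms(3)] show ?thesis by (auto simp: has_pseries_def)
qed

text \<open>On a small box each coordinate of L h is a linear form of weighted norm at most \<rho>.
  The substituted monomials are then bounded like the original ones, and the substituted series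
  converges in the weighted norm; no estimate of coefficients from values is involved.\<close>

lemma real_analytic_affine:
  fixes L :: "'v::euclidean_space \<Rightarrow> 'w::euclidean_space"
  assumes \<phi>: "real_analytic \<phi>" and L: "linear L" and A: "\<And>x h. A (x + h) = A x + L h"
  shows "real_analytic (\<lambda>x. \<phi> (A x))"
  unfolding real_analytic_iff
proof
  fix x
  from \<phi> obtain \<rho> c where \<rho>: "\<rho> > 0" and c: "has_pseries \<rho> c (\<lambda>h. \<phi> (A x + h))"
    unfolding real_analytic_iff by blast
  from linear_bounded_pos[OF L] obtain K where K: "K > 0" "\<And>h. norm (L h) \<le> K * norm h" by blast
  \<comment> \<open>Chosen so that DIM K \<delta> = \<rho>: this is the bound of
    \<open>pseries_bound_linear\<close> for a coordinate of L, and it also sends the box of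
    half-width \<delta> into the one of half-width \<rho>.\<close>
  define \<delta> where "\<delta> = \<rho> / (DIM('v) * K)"
  have \<delta>: "\<delta> > 0" "DIM('v) * K * \<delta> = \<rho>" using \<rho> K by (auto simp: \<delta>_def)
  have mp: "pseries_bound \<delta> (\<lambda>h. mpow n (L h)) (\<rho> ^ mdeg n)" for n
  proof -
    have "pseries_bound \<delta> (\<lambda>h. of_real (L h \<bullet> b)) \<rho>" if "b \<in> Basis" for b
      unfolding \<delta>(2)[symmetric]
    proof (rule pseries_bound_linear[OF \<delta>(1)])
      show "linear (\<lambda>h. L h \<bullet> b)"
        using L by (simp add: linear_iff inner_add_left)
      show "\<bar>L b' \<bullet> b\<bar> \<le> K" if "b' \<in> Basis" for b'
        using Basis_le_norm[OF \<open>b \<in> Basis\<close>, of "L b'"] K(2)[of b'] that by simp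
    qed
    then have "pseries_bound \<delta> (\<lambda>h. \<Prod>b\<in>Basis. of_real (L h \<bullet> b) ^ n b) (\<Prod>b\<in>(Basis::'w set). \<rho> ^ n b)"
      by (intro pseries_bound_prod pseries_bound_power \<delta>) auto
    then show ?thesis by (simp add: mpow_def mdeg_def power_sum)
  qed
  have "pseries_bound \<delta> (\<lambda>h. \<phi> (A (x + h))) (\<Sum>\<^sub>\<infinity>n\<in>multi_indices. norm (c n) * \<rho> ^ mdeg n)"
  proof (rule pseries_bound_infsum[OF \<delta>(1), where J=multi_indices])
    show "pseries_bound \<delta> (\<lambda>h. c n * mpow n (L h)) (norm (c n) * \<rho> ^ mdeg n)" for n
      by (rule pseries_bound_cmult[OF \<delta>(1) mp])
    show "((\<lambda>n. norm (c n) * \<rho> ^ mdeg n) has_sum (\<Sum>\<^sub>\<infinity>n\<in>multi_indices. norm (c n) * \<rho> ^ mdeg n))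
      multi_indices" using c by (simp add: has_pseries_def)
    fix h :: 'v assume h: "h \<in> box_at_0 \<delta>"
    have "norm (L h) \<le> K * (DIM('v) * \<delta>)"
      using K(2)[of h] norm_le_box[OF _ h] \<delta>(1) K(1)
        mult_left_mono[of "norm h" "DIM('v) * \<delta>" K] by linarith
    also have "\<dots> = \<rho>" using \<delta>(2) by (simp add: mult_ac)
    finally have "L h \<in> box_at_0 \<rho>" by (rule ball_subset_box)
    with c show "((\<lambda>n. c n * mpow n (L h)) has_sum \<phi> (A (x + h))) multi_indices"
      by (simp add: has_pseries_def A)
  qed
  with \<delta>(1) show "\<exists>\<rho>>0. \<exists>c. has_pseries \<rho> c (\<lambda>h. \<phi> (A (x + h)))"
    unfolding pseries_bound_def by blast
qed

section \<open>Derivatives of real analytic functions\<close>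

definition pseries_pderiv ::
  "'v::euclidean_space \<Rightarrow> (('v \<Rightarrow> nat) \<Rightarrow> complex) \<Rightarrow> ('v \<Rightarrow> nat) \<Rightarrow> complex" where
  "pseries_pderiv b c n = of_nat (Suc (n b)) * c (n(b := Suc (n b)))"

definition pseries_deriv ::
  "'v::euclidean_space \<Rightarrow> (('v \<Rightarrow> nat) \<Rightarrow> complex) \<Rightarrow> ('v \<Rightarrow> nat) \<Rightarrow> complex" where
  "pseries_deriv v c n = (\<Sum>b\<in>Basis. of_real (v \<bullet> b) * pseries_pderiv b c n)"

lemma has_sum_sum:
  fixes f :: "'i \<Rightarrow> 'j \<Rightarrow> 'c::{topological_comm_monoid_add,t2_space}"
  assumes "finite A" "\<And>i. i \<in> A \<Longrightarrow> (f i has_sum S i) J"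
  shows "((\<lambda>j. \<Sum>i\<in>A. f i j) has_sum (\<Sum>i\<in>A. S i)) J"
  using assms by (induction A) (auto intro: has_sum_add)

lemma mdeg_Suc: "b \<in> Basis \<Longrightarrow> mdeg (n(b := Suc (n b))) = Suc (mdeg n)"
  by (simp add: mdeg_def sum.remove[of _ b])

lemma multi_indices_upd: "b \<in> Basis \<Longrightarrow> n \<in> multi_indices \<Longrightarrow> n(b := k) \<in> multi_indices"
  by (auto simp: multi_indices_def PiE_def extensional_def)

text \<open>Differentiation multiplies a coefficient by at most its degree, and a strictly smaller
  radius absorbs this factor.\<close>

lemma real_nat_power_bounded:
  fixes \<rho> \<rho>' :: real
  assumes "0 < \<rho>'" "\<rho>' < \<rho>"
  obtains K where "K > 0" "\<And>N. real (Suc N) * \<rho>' ^ N \<le> K * \<rho> ^ Suc N"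
proof -
  have "(\<lambda>n. real n * (\<rho>' / \<rho>) ^ n) \<longlonglongrightarrow> 0"
    using assms by (intro powser_times_n_limit_0) auto
  then have "Bseq (\<lambda>n. real n * (\<rho>' / \<rho>) ^ n)"
    by (intro convergent_imp_Bseq convergentI)
  then obtain K where "K > 0" and "\<forall>n. norm (real n * (\<rho>' / \<rho>) ^ n) \<le> K"
    by (rule BseqE)
  then have K: "K > 0" "real n * (\<rho>' / \<rho>) ^ n \<le> K" for n
    using abs_le_D1 unfolding real_norm_def by blast+
  show thesis
  \<comment> \<open>The bound is obtained for the exponent \<open>Suc N\<close>; dividing by \<rho>'
    removes the surplus power.\<close>
  proof (rule that[of "K / \<rho>'"])
    show "K / \<rho>' > 0" using K assms by simp
    fix N
    have "real (Suc N) * \<rho>' ^ Suc N \<le> K * \<rho> ^ Suc N"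
      using K(2)[of "Suc N"] assms by (simp add: power_divide pos_divide_le_eq field_simps)
    then show "real (Suc N) * \<rho>' ^ N \<le> K / \<rho>' * \<rho> ^ Suc N"
      using assms by (simp add: field_simps)
  qed
qed

text \<open>Raising one exponent is injective on multi-indices, so the shifted coefficients form a
  subfamily of a summable family; the factor \<open>Suc (n b)\<close> is at most the degree plus
  one.\<close>

lemma pseries_pderiv_summable:
  assumes c: "(\<lambda>n. norm (c n) * \<rho> ^ mdeg n) summable_on multi_indices"
    and \<rho>: "0 < \<rho>'" "\<rho>' < \<rho>" and b: "b \<in> Basis"
  shows "(\<lambda>n. norm (pseries_pderiv b c n) * \<rho>' ^ mdeg n) summable_on multi_indices"
proof -
  obtain K where K: "K > 0" "\<And>N. real (Suc N) * \<rho>' ^ N \<le> K * \<rho> ^ Suc N"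
    using real_nat_power_bounded[OF \<rho>] by blast
  have inj: "inj_on (\<lambda>n. n(b := Suc (n b))) multi_indices"
  proof (rule inj_onI)
    fix n m :: "'a \<Rightarrow> nat" assume eq: "n(b := Suc (n b)) = m(b := Suc (m b))"
    show "n = m"
    proof
      fix x show "n x = m x" using fun_cong[OF eq, of x] by (cases "x = b") auto
    qed
  qed
  have "(\<lambda>n. norm (c n) * \<rho> ^ mdeg n) summable_on (\<lambda>n. n(b := Suc (n b))) ` multi_indices"
    by (rule summable_on_subset_banach[OF c]) (use b multi_indices_upd in auto)
  then have "(\<lambda>n. norm (c (n(b := Suc (n b)))) * \<rho> ^ Suc (mdeg n)) summable_on multi_indices"
    by (subst (asm) summable_on_reindex[OF inj]) (simp add: o_def mdeg_Suc[OF b])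
  then have "(\<lambda>n. K * (norm (c (n(b := Suc (n b)))) * \<rho> ^ Suc (mdeg n))) summable_on multi_indices"
    by (rule summable_on_cmult_right)
  then show ?thesis
  proof (rule summable_on_comparison_test)
    fix n
    have "n b \<le> mdeg n" unfolding mdeg_def using b by (intro member_le_sum) auto
    then have "real (Suc (n b)) * \<rho>' ^ mdeg n \<le> real (Suc (mdeg n)) * \<rho>' ^ mdeg n"
      using \<rho> by (intro mult_right_mono) auto
    also have "\<dots> \<le> K * \<rho> ^ Suc (mdeg n)" by (rule K)
    finally have "norm (c (n(b := Suc (n b)))) * (real (Suc (n b)) * \<rho>' ^ mdeg n)
      \<le> norm (c (n(b := Suc (n b)))) * (K * \<rho> ^ Suc (mdeg n))"
      by (rule mult_left_mono) simp
    then show "norm (pseries_pderiv b c n) * \<rho>' ^ mdeg n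
      \<le> K * (norm (c (n(b := Suc (n b)))) * \<rho> ^ Suc (mdeg n))"
      unfolding pseries_pderiv_def norm_mult norm_of_nat by (simp add: mult_ac)
  qed (use \<rho> in auto)
qed

text \<open>Links the formal derivative to termwise differentiation through the bijection that
  raises the exponent of b. Terms with exponent 0 carry the factor 0, which also makes the truncated
  \<open>n b - 1\<close> harmless.\<close>

lemma pseries_pderiv_has_sum:
  fixes h :: "'v::euclidean_space"
  assumes s: "(\<lambda>n. norm (pseries_pderiv b c n) * \<rho> ^ mdeg n) summable_on multi_indices"
    and h: "h \<in> box_at_0 \<rho>" and b: "b \<in> Basis"
  shows "\<exists>S. ((\<lambda>n. pseries_pderiv b c n * mpow n h) has_sum S) multi_indices \<and>
    ((\<lambda>n. c n * (of_nat (n b) * mpow (n(b := n b - 1)) h)) has_sum S) multi_indices"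
proof -
  define S where "S = infsum (\<lambda>n. pseries_pderiv b c n * mpow n h) multi_indices"
  have "(\<lambda>n. norm (pseries_pderiv b c n * mpow n h)) summable_on multi_indices"
    by (rule summable_on_comparison_test[OF s])
       (auto simp: norm_mult intro!: mult_left_mono norm_mpow_le[OF h])
  then have S: "((\<lambda>n. pseries_pderiv b c n * mpow n h) has_sum S) multi_indices"
    unfolding S_def by (intro has_sum_infsum) (rule abs_summable_summable)
  also have "?this \<longleftrightarrow> ((\<lambda>n. c n * (of_nat (n b) * mpow (n(b := n b - 1)) h)) has_sum S)
      {n \<in> multi_indices. n b > 0}"
    by (rule has_sum_reindex_bij_witness[where j="\<lambda>n. n(b := Suc (n b))" and i="\<lambda>n. n(b := n b - 1)"])
       (auto simp: multi_indices_upd b pseries_pderiv_def mult_ac)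
  also have "\<dots> \<longleftrightarrow> ((\<lambda>n. c n * (of_nat (n b) * mpow (n(b := n b - 1)) h)) has_sum S) multi_indices"
    by (rule has_sum_cong_neutral) auto
  finally show ?thesis using S by blast
qed

text \<open>Along a line through h the series depends on one parameter and is dominated by the
  weighted coefficients while the line stays in the margin between \<rho>' and \<rho>. The product
  rule at parameter 0 reproduces the formal derivative.\<close>

lemma has_pseries_deriv:
  fixes g :: "'v::euclidean_space \<Rightarrow> complex"
  assumes c: "has_pseries \<rho> c g" and \<rho>: "0 < \<rho>'" "\<rho>' < \<rho>"
  shows "has_pseries \<rho>' (pseries_deriv v c) (dir_deriv v g)"
    and "h \<in> box_at_0 \<rho>' \<Longrightarrow>
      ((\<lambda>t. g (h + t *\<^sub>R v)) has_vector_derivative dir_deriv v g h) (at 0)"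
proof -
  have cs: "(\<lambda>n. norm (c n) * \<rho> ^ mdeg n) summable_on multi_indices"
    using c by (simp add: has_pseries_def)
  have sb: "(\<lambda>n. norm (pseries_pderiv b c n) * \<rho>' ^ mdeg n) summable_on multi_indices"
    if "b \<in> Basis" for b by (rule pseries_pderiv_summable[OF cs \<rho> that])
  have "(\<lambda>n. \<Sum>b\<in>Basis. \<bar>v \<bullet> b\<bar> * (norm (pseries_pderiv b c n) * \<rho>' ^ mdeg n))
      summable_on multi_indices"
    by (rule has_sum_imp_summable, rule has_sum_sum[OF finite_Basis],
        rule has_sum_cmult_right[OF has_sum_infsum[OF sb]])
  then have s: "(\<lambda>n. norm (pseries_deriv v c n) * \<rho>' ^ mdeg n) summable_on multi_indices"
  proof (rule summable_on_comparison_test)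
    fix n
    have "norm (pseries_deriv v c n) \<le> (\<Sum>b\<in>Basis. \<bar>v \<bullet> b\<bar> * norm (pseries_pderiv b c n))"
      unfolding pseries_deriv_def by (rule order.trans[OF norm_sum]) (simp add: norm_mult)
    then show "norm (pseries_deriv v c n) * \<rho>' ^ mdeg n
        \<le> (\<Sum>b\<in>Basis. \<bar>v \<bullet> b\<bar> * (norm (pseries_pderiv b c n) * \<rho>' ^ mdeg n))"
      using \<rho>(1) by (simp add: mult.assoc[symmetric] sum_distrib_right[symmetric] mult_right_mono)
  qed (use \<rho> in auto)
  have main: "((\<lambda>n. pseries_deriv v c n * mpow n h) has_sum dir_deriv v g h) multi_indices \<and>
      ((\<lambda>t. g (h + t *\<^sub>R v)) has_vector_derivative dir_deriv v g h) (at 0)"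
    if h: "h \<in> box_at_0 \<rho>'" for h
  proof -
    have "\<forall>b\<in>Basis. \<exists>S. ((\<lambda>n. pseries_pderiv b c n * mpow n h) has_sum S) multi_indices \<and>
        ((\<lambda>n. c n * (of_nat (n b) * mpow (n(b := n b - 1)) h)) has_sum S) multi_indices"
      by (intro ballI pseries_pderiv_has_sum[OF sb h])
    from bchoice[OF this] obtain S where
      S: "\<And>b. b \<in> Basis \<Longrightarrow> ((\<lambda>n. pseries_pderiv b c n * mpow n h) has_sum S b) multi_indices"
         "\<And>b. b \<in> Basis \<Longrightarrow> ((\<lambda>n. c n * (of_nat (n b) * mpow (n(b := n b - 1)) h)) has_sum S b) multi_indices"
      by blast
    define T where "T = (\<Sum>b\<in>Basis. of_real (v \<bullet> b) * S b)"
    have T1: "((\<lambda>n. pseries_deriv v c n * mpow n h) has_sum T) multi_indices"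
      unfolding pseries_deriv_def T_def sum_distrib_right mult.assoc
      by (intro has_sum_sum[OF finite_Basis] has_sum_cmult_right S(1))
    have T2: "((\<lambda>n. \<Sum>b\<in>Basis. of_real (v \<bullet> b) * (c n * (of_nat (n b) * mpow (n(b := n b - 1)) h)))
        has_sum T) multi_indices"
      unfolding T_def by (intro has_sum_sum[OF finite_Basis] has_sum_cmult_right S(2))
    \<comment> \<open>With a complex parameter t the partial sums are holomorphic, so their uniform convergence
      already allows termwise differentiation.\<close>
    define f where "f n t = c n * (\<Prod>b\<in>Basis. (of_real (h \<bullet> b) + t * of_real (v \<bullet> b)) ^ n b)"
      for n :: "'v \<Rightarrow> nat" and t :: complex
    define f' where "f' n t = c n * (\<Sum>b\<in>Basis. (of_nat (n b) * (of_real (h \<bullet> b) + t * of_real (v \<bullet> b)) ^ (n b - 1)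
        * of_real (v \<bullet> b)) * (\<Prod>b'\<in>Basis - {b}. (of_real (h \<bullet> b') + t * of_real (v \<bullet> b')) ^ n b'))"
      for n :: "'v \<Rightarrow> nat" and t :: complex
    have der: "(f n has_field_derivative f' n t) (at t)" for n t
      unfolding f_def[abs_def] f'_def
      by (intro DERIV_cmult has_field_derivative_prod)
         (auto intro!: derivative_eq_intros)
    have f'0: "f' n 0 = (\<Sum>b\<in>Basis. of_real (v \<bullet> b) * (c n * (of_nat (n b) * mpow (n(b := n b - 1)) h)))" for n
    proof -
      have "mpow (n(b := n b - 1)) h = of_real (h \<bullet> b) ^ (n b - 1) * (\<Prod>b'\<in>Basis - {b}. of_real (h \<bullet> b') ^ n b')"
        if "b \<in> Basis" for b
        using that by (simp add: mpow_def prod.remove[of _ b])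
      then show ?thesis by (simp add: f'_def sum_distrib_left mult_ac)
    qed
    \<comment> \<open>Up to this parameter each coordinate moves by at most \<rho> - \<rho>'; the
      summand 1 covers v = 0.\<close>
    define r where "r = (\<rho> - \<rho>') / (norm v + 1)"
    have r: "r > 0" and rv: "r * norm v \<le> \<rho> - \<rho>'"
    proof -
      show "r > 0" unfolding r_def using \<rho> by (intro divide_pos_pos) (auto intro: add_nonneg_pos)
      have "norm v / (norm v + 1) \<le> 1" by (subst pos_divide_le_eq) (auto intro: add_nonneg_pos)
      then have "(\<rho> - \<rho>') * (norm v / (norm v + 1)) \<le> (\<rho> - \<rho>') * 1"
        using \<rho> by (intro mult_left_mono) auto
      then show "r * norm v \<le> \<rho> - \<rho>'" by (simp add: r_def)
    qed
    have bnd: "norm (f n t) \<le> norm (c n) * \<rho> ^ mdeg n" if t: "t \<in> cball 0 r" for n t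
    proof -
      have "norm (of_real (h \<bullet> b) + t * of_real (v \<bullet> b)) \<le> \<rho>" if b: "b \<in> Basis" for b
      proof -
        have "norm (t * complex_of_real (v \<bullet> b)) \<le> r * norm v"
          using t Basis_le_norm[OF b, of v] r by (auto simp: norm_mult intro!: mult_mono)
        moreover have "\<bar>h \<bullet> b\<bar> \<le> \<rho>'" using h b by (auto simp: box_at_0_def)
        ultimately show ?thesis using rv
          norm_triangle_ineq[of "complex_of_real (h \<bullet> b)" "t * of_real (v \<bullet> b)"] by simp
      qed
      then have "(\<Prod>b\<in>Basis. norm ((of_real (h \<bullet> b) + t * of_real (v \<bullet> b)) ^ n b)) \<le> (\<Prod>b\<in>(Basis::'v set). \<rho> ^ n b)"
        unfolding norm_power by (intro prod_mono) (auto intro: power_mono)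
      then show ?thesis
        by (auto simp: f_def norm_mult prod_norm mdeg_def power_sum intro!: mult_left_mono)
    qed
    define G where "G t = infsum (\<lambda>n. f n t) multi_indices" for t
    have ulim: "uniform_limit (cball 0 r) (\<lambda>X t. \<Sum>n\<in>X. f n t) G (finite_subsets_at_top multi_indices)"
      unfolding G_def using bnd cs by (rule Weierstrass_m_test_general)
    have Gg: "G (of_real t) = g (h + t *\<^sub>R v)" if "\<bar>t\<bar> \<le> r" for t
    proof -
      have "h + t *\<^sub>R v \<in> box_at_0 \<rho>"
        unfolding box_at_0_def
      proof safe
        fix b :: 'v assume b: "b \<in> Basis"
        have "\<bar>t * (v \<bullet> b)\<bar> \<le> r * norm v"
          using that Basis_le_norm[OF b, of v] r by (auto simp: abs_mult intro!: mult_mono)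
        moreover have "\<bar>h \<bullet> b\<bar> \<le> \<rho>'" using h b by (auto simp: box_at_0_def)
        ultimately show "\<bar>(h + t *\<^sub>R v) \<bullet> b\<bar> \<le> \<rho>" using rv by (simp add: inner_add_left)
      qed
      then have "((\<lambda>n. c n * mpow n (h + t *\<^sub>R v)) has_sum g (h + t *\<^sub>R v)) multi_indices"
        using c by (simp add: has_pseries_def)
      moreover have "c n * mpow n (h + t *\<^sub>R v) = f n (of_real t)" for n
        by (simp add: f_def mpow_def inner_add_left)
      ultimately show ?thesis by (simp add: G_def infsumI)
    qed
    obtain G' where G': "\<And>w. w \<in> ball 0 r \<Longrightarrow> (G has_field_derivative G' w) (at w) \<and>
        ((\<lambda>X. \<Sum>n\<in>X. f' n w) \<longlongrightarrow> G' w) (finite_subsets_at_top multi_indices)"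
    proof (rule has_complex_derivative_uniform_limit[where f'="\<lambda>X w. \<Sum>n\<in>X. f' n w", OF _ ulim _ r])
      have "continuous_on (cball 0 r) (\<lambda>t. \<Sum>n\<in>X. f n t)" for X
        by (intro continuous_on_sum continuous_at_imp_continuous_on ballI DERIV_isCont[OF der])
      moreover have "((\<lambda>t. \<Sum>n\<in>X. f n t) has_field_derivative (\<Sum>n\<in>X. f' n w)) (at w)" for X w
        by (intro DERIV_sum der)
      ultimately show "\<forall>\<^sub>F X in finite_subsets_at_top multi_indices.
          continuous_on (cball 0 r) (\<lambda>t. \<Sum>n\<in>X. f n t) \<and>
          (\<forall>w\<in>ball 0 r. ((\<lambda>t. \<Sum>n\<in>X. f n t) has_field_derivative (\<Sum>n\<in>X. f' n w)) (at w))"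
        by simp
    qed auto
    have "((\<lambda>n. f' n 0) has_sum G' 0) multi_indices"
      using G'[of 0] r by (simp add: has_sum_def)
    then have "G' 0 = T" using T2 unfolding f'0 by (rule has_sum_unique)
    then have "(G has_field_derivative T) (at (of_real 0))" using G'[of 0] r by simp
    then have "((\<lambda>t. G (of_real t)) has_vector_derivative T) (at 0)"
      by (rule has_vector_derivative_real_field)
    then have vd: "((\<lambda>t. g (h + t *\<^sub>R v)) has_vector_derivative T) (at 0)"
      by (rule has_vector_derivative_transform_within[OF _ r]) (auto simp: Gg)
    then have "dir_deriv v g h = T" by (simp add: dir_deriv_def vector_derivative_at)
    then show ?thesis using T1 vd by simp
  qed
  then show "has_pseries \<rho>' (pseries_deriv v c) (dir_deriv v g)"
    using s by (simp add: has_pseries_def)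
  show "h \<in> box_at_0 \<rho>' \<Longrightarrow>
      ((\<lambda>t. g (h + t *\<^sub>R v)) has_vector_derivative dir_deriv v g h) (at 0)"
    using main by blast
qed

text \<open>Identities between directional derivatives are proved for the formal coefficients;
  reading off the constant coefficient at an arbitrary centre turns them into identities of
  functions.\<close>

lemma has_pseries_at_0: 
  assumes "has_pseries \<rho> c g" "0 < \<rho>" shows "g 0 = c (restrict (\<lambda>_. 0) Basis)"
proof -
  let ?z = "restrict (\<lambda>_. 0) Basis :: 'a \<Rightarrow> nat"
  have "((\<lambda>n. c n * mpow n 0) has_sum g 0) multi_indices"
    using assms by (simp add: has_pseries_def box_at_0_def)
  moreover have "mpow n 0 = (if n = ?z then 1 else 0)" if n: "n \<in> multi_indices" for n :: "'a \<Rightarrow> nat"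
  proof (cases "n = ?z")
    case False
    then obtain b where "n b \<noteq> ?z b" by blast
    then have "b \<in> Basis" "n b \<noteq> 0" using n
      by (auto simp: multi_indices_def PiE_def extensional_def split: if_splits)
    then show ?thesis using False by (auto simp: mpow_def)
  qed (simp add: mpow_def)
  ultimately have "((\<lambda>n. c n * (if n = ?z then 1 else 0)) has_sum g 0) multi_indices"
    by (simp cong: has_sum_cong)
  also have "?this \<longleftrightarrow> ((\<lambda>n. c n) has_sum g 0) {?z}"
    by (rule has_sum_cong_neutral) (auto simp: multi_indices_def)
  finally show ?thesis by (simp add: has_sum_finite_iff)
qed

lemma dir_deriv_shift: "dir_deriv v (\<lambda>h. \<phi> (x + h)) h = dir_deriv v \<phi> (x + h)"
  by (simp add: dir_deriv_def add.assoc)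

lemma real_analytic_pseries_deriv:
  assumes "real_analytic \<phi>"
  obtains \<rho> c where "\<rho> > 0" "has_pseries \<rho> c (\<lambda>h. \<phi> (x + h))"
    "\<And>v. has_pseries \<rho> (pseries_deriv v c) (\<lambda>h. dir_deriv v \<phi> (x + h))"
    "\<And>v w. has_pseries \<rho> (pseries_deriv v (pseries_deriv w c)) (\<lambda>h. dir_deriv v (dir_deriv w \<phi>) (x + h))"
    "\<And>v. ((\<lambda>t. \<phi> (x + t *\<^sub>R v)) has_vector_derivative dir_deriv v \<phi> x) (at 0)"
proof -
  from assms obtain \<rho> c where \<rho>: "\<rho> > 0" and c: "has_pseries \<rho> c (\<lambda>h. \<phi> (x + h))"
    unfolding real_analytic_iff by blast
  have c1: "has_pseries (\<rho> / 2) (pseries_deriv v c) (\<lambda>h. dir_deriv v \<phi> (x + h))" for v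
    using has_pseries_deriv(1)[OF c, of "\<rho> / 2" v] \<rho> unfolding dir_deriv_shift by simp
  have c2: "has_pseries (\<rho> / 4) (pseries_deriv v (pseries_deriv w c)) (\<lambda>h. dir_deriv v (dir_deriv w \<phi>) (x + h))"
    for v w using has_pseries_deriv(1)[OF c1, of "\<rho> / 4" v] \<rho>
    unfolding dir_deriv_shift by simp
  show thesis
  \<comment> \<open>Each differentiation halves the radius, and \<rho> / 4 serves all the expansions
    at once.\<close>
  proof (rule that[of "\<rho> / 4" c])
    show "((\<lambda>t. \<phi> (x + t *\<^sub>R v)) has_vector_derivative dir_deriv v \<phi> x) (at 0)" for v
      using has_pseries_deriv(2)[OF c, of "\<rho> / 2" 0 v] \<rho>
      by (simp add: box_at_0_def dir_deriv_shift)
  qed (use \<rho> c1 c2 pseries_mono[OF c] pseries_mono[OF c1] in auto)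
qed

lemma real_analytic_has_dir_deriv:
  assumes "real_analytic \<phi>"
  shows "((\<lambda>t. \<phi> (x + t *\<^sub>R v)) has_vector_derivative dir_deriv v \<phi> x) (at 0)"
  using real_analytic_pseries_deriv[OF assms, of x] by metis

lemma real_analytic_dir_deriv:
  assumes "real_analytic \<phi>"
  shows "real_analytic (dir_deriv v \<phi>)"
  unfolding real_analytic_iff using real_analytic_pseries_deriv[OF assms] by metis

lemma pseries_deriv_linear:
  "pseries_deriv (r *\<^sub>R v + w) c n = of_real r * pseries_deriv v c n + pseries_deriv w c n"
  by (simp add: pseries_deriv_def inner_add_left sum.distrib algebra_simps sum_distrib_left)

lemma dir_deriv_linear:
  assumes "real_analytic \<phi>"
  shows "dir_deriv (r *\<^sub>R v + w) \<phi> x = of_real r * dir_deriv v \<phi> x + dir_deriv w \<phi> x"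
proof -
  from real_analytic_pseries_deriv[OF assms, of x] obtain \<rho> c where
    "\<rho> > 0" "\<And>v. has_pseries \<rho> (pseries_deriv v c) (\<lambda>h. dir_deriv v \<phi> (x + h))" by metis
  then have "dir_deriv v \<phi> x = pseries_deriv v c (restrict (\<lambda>_. 0) Basis)" for v
    using has_pseries_at_0[of \<rho> "pseries_deriv v c" "\<lambda>h. dir_deriv v \<phi> (x + h)"] by simp
  then show ?thesis by (simp only: pseries_deriv_linear)
qed

lemma pseries_deriv_commute:
  "pseries_deriv v (pseries_deriv w c) n = pseries_deriv w (pseries_deriv v c) n"
proof -
  have p: "pseries_pderiv b (pseries_pderiv b' c) n = pseries_pderiv b' (pseries_pderiv b c) n" for b b'
    by (cases "b = b'") (auto simp: pseries_pderiv_def fun_upd_twist)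
  have e: "pseries_deriv v (pseries_deriv w c) n = (\<Sum>b\<in>Basis. \<Sum>b'\<in>Basis.
     of_real (v \<bullet> b) * of_real (w \<bullet> b') * pseries_pderiv b (pseries_pderiv b' c) n)" for v w
    by (simp add: pseries_deriv_def pseries_pderiv_def[of _ "pseries_deriv w c"] 
      pseries_pderiv_def[of _ "pseries_pderiv _ c"] sum_distrib_left mult_ac)
  show ?thesis unfolding e by (subst sum.swap) (simp add: p mult_ac)
qed

lemma dir_deriv_commute:
  assumes "real_analytic \<phi>"
  shows "dir_deriv v (dir_deriv w \<phi>) x = dir_deriv w (dir_deriv v \<phi>) x"
proof -
  from real_analytic_pseries_deriv[OF assms, of x] obtain \<rho> c where
    "\<rho> > 0" "\<And>v w. has_pseries \<rho> (pseries_deriv v (pseries_deriv w c)) (\<lambda>h. dir_deriv v (dir_deriv w \<phi>) (x + h))"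
    by metis
  then have "dir_deriv v (dir_deriv w \<phi>) x = pseries_deriv v (pseries_deriv w c) (restrict (\<lambda>_. 0) Basis)" for v w
    using has_pseries_at_0[of \<rho> "pseries_deriv v (pseries_deriv w c)" "\<lambda>h. dir_deriv v (dir_deriv w \<phi>) (x + h)"]
    by simp
  then show ?thesis by (simp only: pseries_deriv_commute)
qed

section \<open>Affine Weyl group and affine roots\<close>

definition riesz :: "'v::euclidean_space dual \<Rightarrow> 'v" where
  "riesz \<xi> = (\<Sum>b\<in>Basis. blinfun_apply \<xi> b *\<^sub>R b)"

lemma riesz_inner: "riesz \<xi> \<bullet> v = blinfun_apply \<xi> v"
proof -
  have "blinfun_apply \<xi> v = blinfun_apply \<xi> (\<Sum>b\<in>Basis. (v \<bullet> b) *\<^sub>R b)"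
    by (simp add: euclidean_representation)
  also have "\<dots> = (\<Sum>b\<in>Basis. blinfun_apply \<xi> b *\<^sub>R b) \<bullet> v"
    unfolding blinfun.sum_right blinfun.scaleR_right inner_sum_left
    by (intro sum.cong refl) (simp add: inner_commute)
  finally show ?thesis by (simp add: riesz_def)
qed

lemma dual_inner_riesz: "dual_inner \<xi> \<eta> = riesz \<xi> \<bullet> riesz \<eta>"
proof -
  have "riesz \<xi> \<bullet> riesz \<eta> = (\<Sum>b\<in>Basis. blinfun_apply \<eta> b * blinfun_apply \<xi> b)"
    unfolding riesz_inner by (simp add: riesz_def blinfun.sum_right blinfun.scaleR_right)
  then show ?thesis by (simp add: dual_inner_def mult.commute)
qed

lemma covec_riesz: "covec \<xi> = (2 / (riesz \<xi> \<bullet> riesz \<xi>)) *\<^sub>R riesz \<xi>"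
  unfolding covec_def dual_inner_riesz[symmetric] by (simp add: riesz_def scaleR_sum_right)

lemma riesz_eq_0_iff: "riesz \<xi> = 0 \<longleftrightarrow> \<xi> = 0"
proof
  assume z: "riesz \<xi> = 0"
  show "\<xi> = 0"
  proof (rule blinfun_eqI)
    fix v show "blinfun_apply \<xi> v = blinfun_apply 0 v" using riesz_inner[of \<xi> v] by (simp add: z)
  qed
qed (simp add: riesz_def)

lemma covec_self: "\<alpha> \<noteq> 0 \<Longrightarrow> blinfun_apply \<alpha> (covec \<alpha>) = 2"
  by (simp add: covec_eval dual_inner_riesz riesz_eq_0_iff)

lemma covec_uminus: "covec (- \<alpha>) = - covec \<alpha>"
proof -
  have "riesz (- \<alpha>) = - riesz \<alpha>" by (simp add: riesz_def blinfun.minus_left sum_negf)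
  then show ?thesis by (simp add: covec_riesz)
qed

lemma root_refl_inner:
  assumes "\<alpha> \<noteq> 0" shows "root_refl \<alpha> u \<bullet> root_refl \<alpha> v = u \<bullet> v"
proof -
  define r k where "r = riesz \<alpha>" and "k = 2 / (r \<bullet> r)"
  have k: "k * (r \<bullet> r) = 2" using assms riesz_eq_0_iff[of \<alpha>] by (simp add: k_def r_def)
  have e: "root_refl \<alpha> v = v - ((r \<bullet> v) * k) *\<^sub>R r" for v
    by (simp add: root_refl_def covec_riesz riesz_inner r_def k_def)
  have "root_refl \<alpha> u \<bullet> root_refl \<alpha> v
      = u \<bullet> v - 2 * ((r \<bullet> u) * (r \<bullet> v) * k) + (r \<bullet> u) * (r \<bullet> v) * k * (k * (r \<bullet> r))"
    unfolding e by (simp add: inner_diff_left inner_diff_right inner_commute algebra_simps)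
  then show ?thesis unfolding k by simp
qed

text \<open>Orthogonality carries the representing vector of \<xi> to that of \<eta>, and
  \<open>covec\<close> depends only on this vector and its length. Applied to linear parts of group
  elements, this transports coroots.\<close>

lemma covec_orthogonal:
  assumes U: "linear U" "bij U" "\<And>u v. U u \<bullet> U v = u \<bullet> v"
    and \<eta>: "\<And>v. blinfun_apply \<eta> (U v) = blinfun_apply \<xi> v"
  shows "covec \<eta> = U (covec \<xi>)"
proof -
  have "riesz \<eta> = U (riesz \<xi>)"
  proof -
    have "(riesz \<eta> - U (riesz \<xi>)) \<bullet> U v = 0" for v
      by (simp add: inner_diff_left riesz_inner \<eta> U(3))
    moreover obtain v where "riesz \<eta> - U (riesz \<xi>) = U v"
      using U(2) by (metis bij_pointE)
    ultimately show ?thesis by (metis inner_eq_zero_iff right_minus_eq)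
  qed
  then show ?thesis by (simp add: covec_riesz U(3) linear_scale[OF U(1)])
qed

lemma nonneg_comb_add: "nonneg_comb F \<beta> \<Longrightarrow> nonneg_comb F \<gamma> \<Longrightarrow> nonneg_comb F (\<beta> + \<gamma>)"
  unfolding nonneg_comb_def
proof (elim exE)
  fix n m assume "\<beta> = (\<Sum>\<alpha>\<in>F. of_nat (n \<alpha>) *\<^sub>R \<alpha>)" "\<gamma> = (\<Sum>\<alpha>\<in>F. of_nat (m \<alpha>) *\<^sub>R \<alpha>)"
  then have "\<beta> + \<gamma> = (\<Sum>\<alpha>\<in>F. of_nat (n \<alpha> + m \<alpha>) *\<^sub>R \<alpha>)"
    by (simp add: sum.distrib scaleR_left_distrib)
  then show "\<exists>n. \<beta> + \<gamma> = (\<Sum>\<alpha>\<in>F. of_nat (n \<alpha>) *\<^sub>R \<alpha>)"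
    by (intro exI[of _ "\<lambda>\<alpha>. n \<alpha> + m \<alpha>"])
qed

lemma nonneg_comb_scale: "nonneg_comb F \<beta> \<Longrightarrow> nonneg_comb F (of_nat k *\<^sub>R \<beta>)"
proof (induction k)
  case 0
  have "(0 :: 'a dual) = (\<Sum>\<alpha>\<in>F. of_nat 0 *\<^sub>R \<alpha>)" by simp
  then have "nonneg_comb F 0" unfolding nonneg_comb_def by (intro exI[of _ "\<lambda>_. 0"])
  then show ?case by simp
next
  case (Suc k)
  then show ?case using nonneg_comb_add[of F \<beta> "of_nat k *\<^sub>R \<beta>"] by (simp add: scaleR_left_distrib)
qed

lemma nonneg_comb_nonneg:
  assumes "nonneg_comb F \<beta>" "\<And>\<gamma>. \<gamma> \<in> F \<Longrightarrow> blinfun_apply \<gamma> x \<ge> 0"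
  shows "blinfun_apply \<beta> x \<ge> 0"
  using assms by (auto simp: nonneg_comb_def blinfun.sum_left blinfun.scaleR_left intro!: sum_nonneg)

lemma dual_root_refl:
  "blinfun_apply (\<beta> - blinfun_apply \<beta> (covec \<alpha>) *\<^sub>R \<alpha>) v = blinfun_apply \<beta> (root_refl \<alpha> v)"
  by (simp add: root_refl_def blinfun.diff_left blinfun.diff_right blinfun.scaleR_left blinfun.scaleR_right mult.commute)

lemma aff_fun_uminus: "(\<lambda>v. - aff_fun \<alpha> m v) = aff_fun (- \<alpha>) (- m)"
  by (simp add: aff_fun_def fun_eq_iff blinfun.minus_left)

lemma aff_fun_eq_iff: "aff_fun \<alpha> m = aff_fun \<beta> n \<longleftrightarrow> \<alpha> = \<beta> \<and> m = n"
proof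
  assume eq: "aff_fun \<alpha> m = aff_fun \<beta> n"
  from arg_cong[OF this, of grad] have "\<alpha> = \<beta>" by (simp add: grad_aff_fun)
  with fun_cong[OF eq, of 0] show "\<alpha> = \<beta> \<and> m = n" by (simp add: aff_fun_def)
qed simp

section \<open>The extended affine Weyl group and its action on affine roots\<close>

context affine_root_datum
begin

abbreviation Y where "Y \<equiv> dual_lattice X"
abbreviation P where "P \<equiv> aff_pos_roots R F"
abbreviation Fa where "Fa \<equiv> aff_simple_roots F \<theta>"
abbreviation Vreg where "Vreg \<equiv> regular_set R F"
abbreviation Wa where "Wa \<equiv> aff_weyl R X"

lemma R_axioms:
  "finite R \<and> 0 \<notin> R \<and>
    (\<forall>\<alpha>\<in>R. \<forall>\<beta>\<in>R. \<beta> - blinfun_apply \<beta> (covec \<alpha>) *\<^sub>R \<alpha> \<in> R) \<and>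
    (\<forall>\<alpha>\<in>R. \<forall>\<beta>\<in>R. blinfun_apply \<beta> (covec \<alpha>) \<in> \<int>) \<and>
    (\<forall>\<alpha>\<in>R. \<forall>c. c *\<^sub>R \<alpha> \<in> R \<longrightarrow> c = 1 \<or> c = -1)"
  using root_system unfolding irreducible_root_system_def by (elim conjE) (intro conjI; assumption)

lemma finite_R: "finite R"
  and zero_notin_R: "0 \<notin> R"
  and R_refl: "\<alpha> \<in> R \<Longrightarrow> \<beta> \<in> R \<Longrightarrow> \<beta> - blinfun_apply \<beta> (covec \<alpha>) *\<^sub>R \<alpha> \<in> R"
  and R_int: "\<alpha> \<in> R \<Longrightarrow> \<beta> \<in> R \<Longrightarrow> blinfun_apply \<beta> (covec \<alpha>) \<in> \<int>"
  and R_reduced: "\<alpha> \<in> R \<Longrightarrow> c *\<^sub>R \<alpha> \<in> R \<Longrightarrow> c = 1 \<or> c = -1"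
  using R_axioms by blast+

lemma R_nonzero: "\<alpha> \<in> R \<Longrightarrow> \<alpha> \<noteq> 0" using zero_notin_R by blast

lemma F_sub: "F \<subseteq> R" and F_indep: "independent F"
  and R_pos_neg: "\<beta> \<in> R \<Longrightarrow> nonneg_comb F \<beta> \<or> nonneg_comb F (- \<beta>)"
  using basis unfolding root_basis_def by blast+

lemma finite_F: "finite F" using finite_subset[OF F_sub finite_R] .

lemma \<theta>_R: "\<theta> \<in> R" and \<theta>_highest: "\<beta> \<in> R \<Longrightarrow> nonneg_comb F (\<theta> - \<beta>)"
  using highest unfolding highest_root_def by blast+

lemma R_uminus: "\<alpha> \<in> R \<Longrightarrow> - \<alpha> \<in> R"
  using R_refl[of \<alpha> \<alpha>] covec_self[OF R_nonzero, of \<alpha>] by (simp add: scaleR_2)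

lemma root_lattice_int: 
  assumes "\<alpha> \<in> R" "y \<in> Y" shows "blinfun_apply \<alpha> y \<in> \<int>"
proof -
  have "\<alpha> \<in> int_span R" unfolding int_span_def
    using assms(1) by (intro CollectI exI[of _ "{\<alpha>}"] exI[of _ "\<lambda>_. 1"]) simp
  then show ?thesis using root_lattice assms(2) unfolding dual_lattice_def by blast
qed

lemma covec_Y: assumes "\<alpha> \<in> R" shows "covec \<alpha> \<in> Y"
proof -
  have "covec \<alpha> \<in> int_span (covec ` R)" unfolding int_span_def
    using assms(1) by (intro CollectI exI[of _ "{covec \<alpha>}"] exI[of _ "\<lambda>_. 1"]) simp
  then show ?thesis using coroot_lattice by blast
qed

lemma Y_add: "y \<in> Y \<Longrightarrow> z \<in> Y \<Longrightarrow> y + z \<in> Y"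
  by (auto simp: dual_lattice_def blinfun.add_right)

lemma Y_scale: "y \<in> Y \<Longrightarrow> c \<in> \<int> \<Longrightarrow> c *\<^sub>R y \<in> Y"
  by (auto simp: dual_lattice_def blinfun.scaleR_right)

lemma Y_uminus: "y \<in> Y \<Longrightarrow> - y \<in> Y"
  by (auto simp: dual_lattice_def blinfun.minus_right)

lemma Y_0: "0 \<in> Y" by (simp add: dual_lattice_def)

lemma Y_refl: "\<alpha> \<in> R \<Longrightarrow> y \<in> Y \<Longrightarrow> root_refl \<alpha> y \<in> Y"
  unfolding root_refl_def using Y_add[of y "- blinfun_apply \<alpha> y *\<^sub>R covec \<alpha>"]
    Y_scale[OF covec_Y, of \<alpha> "- blinfun_apply \<alpha> y"] root_lattice_int by auto

lemma inv_root_refl: "\<alpha> \<in> R \<Longrightarrow> inv (root_refl \<alpha>) = root_refl \<alpha>"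
  by (intro inv_unique_comp) (auto simp: fun_eq_iff root_refl_root_refl R_nonzero)

text \<open>The closure properties go through one induction, because the generation rule for
  inverses asks for each statement about U together with its counterpart for the inverse.\<close>

lemma weyl_props:
  assumes "U \<in> weyl R"
  shows "linear U" "bij U" "U u \<bullet> U v = u \<bullet> v"
    "\<alpha> \<in> R \<Longrightarrow> \<exists>\<beta>\<in>R. \<forall>v. blinfun_apply \<beta> v = blinfun_apply \<alpha> (U v)"
    "\<alpha> \<in> R \<Longrightarrow> \<exists>\<beta>\<in>R. \<forall>v. blinfun_apply \<beta> v = blinfun_apply \<alpha> (inv U v)"
    "y \<in> Y \<Longrightarrow> U y \<in> Y" "y \<in> Y \<Longrightarrow> inv U y \<in> Y"
proof -
  show lb: "linear U" "bij U" using weyl_linear_bij[OF zero_notin_R assms] by auto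
  have "(\<forall>u v. U u \<bullet> U v = u \<bullet> v) \<and>
    (\<forall>\<alpha>\<in>R. \<exists>\<beta>\<in>R. \<forall>v. blinfun_apply \<beta> v = blinfun_apply \<alpha> (U v)) \<and>
    (\<forall>\<alpha>\<in>R. \<exists>\<beta>\<in>R. \<forall>v. blinfun_apply \<beta> v = blinfun_apply \<alpha> (inv U v)) \<and>
    (\<forall>y\<in>Y. U y \<in> Y) \<and> (\<forall>y\<in>Y. inv U y \<in> Y)"
    using assms unfolding weyl_def
  proof induction
    case one
    then show ?case by (auto simp: inv_id)
  next
    case (gen g)
    then obtain \<alpha> where \<alpha>: "\<alpha> \<in> R" "g = root_refl \<alpha>" by blast
    have "\<forall>\<beta>\<in>R. \<exists>\<gamma>\<in>R. \<forall>v. blinfun_apply \<gamma> v = blinfun_apply \<beta> (root_refl \<alpha> v)"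
      using R_refl[OF \<alpha>(1)] dual_root_refl by blast
    then show ?case
      using \<alpha> root_refl_inner[OF R_nonzero] Y_refl by (simp add: inv_root_refl)
  next
    case (mult g h)
    have b: "bij g" "bij h" using mult weyl_linear_bij[OF zero_notin_R] unfolding weyl_def by auto
    note i = o_inv_distrib[OF b]
    have "\<exists>\<gamma>\<in>R. \<forall>v. blinfun_apply \<gamma> v = blinfun_apply \<alpha> (g (h v))" if "\<alpha> \<in> R" for \<alpha>
      using mult.IH that by metis
    moreover have "\<exists>\<gamma>\<in>R. \<forall>v. blinfun_apply \<gamma> v = blinfun_apply \<alpha> (inv h (inv g v))" if "\<alpha> \<in> R" for \<alpha>
      using mult.IH that by metis
    ultimately show ?case using mult.IH unfolding i by simp
  next
    case (inv g)
    have b: "bij g" using inv weyl_linear_bij[OF zero_notin_R] unfolding weyl_def by auto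
    have "inv g u \<bullet> inv g v = u \<bullet> v" for u v
      using inv.IH b by (metis bij_is_surj surj_f_inv_f)
    then show ?case using inv.IH by (simp add: inv_inv_eq[OF b])
  qed
  then show "U u \<bullet> U v = u \<bullet> v"
    "\<alpha> \<in> R \<Longrightarrow> \<exists>\<beta>\<in>R. \<forall>v. blinfun_apply \<beta> v = blinfun_apply \<alpha> (U v)"
    "\<alpha> \<in> R \<Longrightarrow> \<exists>\<beta>\<in>R. \<forall>v. blinfun_apply \<beta> v = blinfun_apply \<alpha> (inv U v)"
    "y \<in> Y \<Longrightarrow> U y \<in> Y" "y \<in> Y \<Longrightarrow> inv U y \<in> Y" by blast+
qed

lemma weyl_inv: "U \<in> weyl R \<Longrightarrow> inv U \<in> weyl R"
  and weyl_comp: "U \<in> weyl R \<Longrightarrow> U' \<in> weyl R \<Longrightarrow> U \<circ> U' \<in> weyl R"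
  and weyl_id: "id \<in> weyl R"
  and weyl_refl: "\<alpha> \<in> R \<Longrightarrow> root_refl \<alpha> \<in> weyl R"
  unfolding weyl_def by (auto intro: gen_group.intros)

lemma inv_weyl: "U \<in> weyl R \<Longrightarrow> inv U (U v) = v" "U \<in> weyl R \<Longrightarrow> U (inv U v) = v"
  using weyl_props(2)[of U] by (auto simp: bij_is_inj bij_is_surj surj_f_inv_f)

lemma bij_transl: "bij (transl y)" and inv_transl: "inv (transl y) = transl (- y)"
proof -
  have "transl y \<circ> transl (- y) = id" "transl (- y) \<circ> transl y = id" by (auto simp: transl_def)
  then show "bij (transl y)" "inv (transl y) = transl (- y)"
    by (auto intro: o_bij inv_unique_comp)
qed

lemma WaI: "U \<in> weyl R \<Longrightarrow> y \<in> Y \<Longrightarrow> U \<circ> transl y \<in> Wa"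
  unfolding aff_weyl_def by blast

lemma WaE:
  assumes "w \<in> Wa"
  obtains U y where "U \<in> weyl R" "y \<in> Y" "w = U \<circ> transl y" "lin_part R X w = U"
  using assms lin_part_eq[OF zero_notin_R, of _ _ X] unfolding aff_weyl_def by blast

lemma Wa_bij: "w \<in> Wa \<Longrightarrow> bij w"
  by (elim WaE) (simp add: bij_comp[OF bij_transl] weyl_props(2))

lemma inv_Wa: "w \<in> Wa \<Longrightarrow> inv w (w v) = v" "w \<in> Wa \<Longrightarrow> w (inv w v) = v"
  using Wa_bij[of w] by (auto simp: bij_is_inj bij_is_surj surj_f_inv_f)

lemma Wa_id: "id \<in> Wa"
proof -
  have "(id :: 'v \<Rightarrow> 'v) = id \<circ> transl 0" by (auto simp: transl_def)
  then show ?thesis using WaI[OF weyl_id Y_0] by simp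
qed

lemma Wa_comp: assumes "w \<in> Wa" "w' \<in> Wa" shows "w \<circ> w' \<in> Wa"
proof -
  obtain U y where w: "U \<in> weyl R" "y \<in> Y" "w = U \<circ> transl y" using assms(1) by (rule WaE)
  obtain U' y' where w': "U' \<in> weyl R" "y' \<in> Y" "w' = U' \<circ> transl y'" using assms(2) by (rule WaE)
  \<comment> \<open>A translation by y moves past the linear part U' when y is replaced by its
    preimage under U', which again lies in Y.\<close>
  have "w (w' v) = U (U' (v + (y' + inv U' y)))" for v
    by (simp add: w w' transl_def linear_add[OF weyl_props(1)[OF w'(1)]] inv_weyl(2)[OF w'(1)] ac_simps)
  then have "w \<circ> w' = (U \<circ> U') \<circ> transl (y' + inv U' y)" by (simp add: transl_def fun_eq_iff)
  then show ?thesis using WaI[OF weyl_comp[OF w(1) w'(1)] Y_add[OF w'(2) weyl_props(7)[OF w'(1) w(2)]]] by simp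
qed

lemma Wa_inv: assumes "w \<in> Wa" shows "inv w \<in> Wa"
proof -
  obtain U y where w: "U \<in> weyl R" "y \<in> Y" "w = U \<circ> transl y" using assms(1) by (rule WaE)
  have l: "linear (inv U)" using weyl_props(1)[OF weyl_inv[OF w(1)]] .
  have "inv w = transl (- y) \<circ> inv U"
    unfolding w by (simp add: o_inv_distrib[OF weyl_props(2)[OF w(1)] bij_transl] inv_transl)
  also have "\<dots> = inv U \<circ> transl (- U y)"
    by (rule ext) (simp add: transl_def linear_diff[OF l] linear_neg[OF l] inv_weyl w(1))
  finally show ?thesis using WaI[OF weyl_inv[OF w(1)] Y_uminus[OF weyl_props(6)[OF w(1,2)]]] by simp
qed

lemma Wa_affine: assumes "w \<in> Wa" shows "linear (lin_part R X w)" "w (x + h) = w x + lin_part R X w h"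
proof -
  obtain U y where w: "U \<in> weyl R" "y \<in> Y" "w = U \<circ> transl y" "lin_part R X w = U"
    using assms(1) by (rule WaE)
  show "linear (lin_part R X w)" using w weyl_props(1) by simp
  show "w (x + h) = w x + lin_part R X w h"
    using linear_add[OF weyl_props(1)[OF w(1)], of "x + y" h]
    unfolding w(4) unfolding w(3) by (simp add: transl_def ac_simps)
qed

lemma lin_part_Wa: "w \<in> Wa \<Longrightarrow> lin_part R X w \<in> weyl R"
  by (elim WaE) simp

lemma aff_rootsE:
  assumes "a \<in> aff_roots R" obtains \<alpha> m where "\<alpha> \<in> R" "a = aff_fun \<alpha> m" "grad a = \<alpha>"
  using assms unfolding aff_roots_def by (auto simp: grad_aff_fun)

lemma grad_R: "a \<in> aff_roots R \<Longrightarrow> grad a \<in> R" by (elim aff_rootsE) simp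

text \<open>With w = U t_y and \<beta> the composite of \<alpha> with U, the constant of a changes
  by \<beta>(y), an integer because roots lie in X and y in its dual lattice.\<close>

lemma aff_roots_comp:
  assumes "a \<in> aff_roots R" "w \<in> Wa"
  shows "a \<circ> w \<in> aff_roots R" "blinfun_apply (grad (a \<circ> w)) v = blinfun_apply (grad a) (lin_part R X w v)"
proof -
  obtain \<alpha> m where a: "\<alpha> \<in> R" "a = aff_fun \<alpha> m" "grad a = \<alpha>" using assms(1) by (rule aff_rootsE)
  obtain U y where w: "U \<in> weyl R" "y \<in> Y" "w = U \<circ> transl y" "lin_part R X w = U"
    using assms(2) by (rule WaE)
  obtain \<beta> where \<beta>: "\<beta> \<in> R" "\<And>v. blinfun_apply \<beta> v = blinfun_apply \<alpha> (U v)"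
    using weyl_props(4)[OF w(1) a(1)] by blast
  obtain j where j: "blinfun_apply \<beta> y = of_int j" using root_lattice_int[OF \<beta>(1) w(2)] by (auto elim: Ints_cases)
  have eq: "a \<circ> w = aff_fun \<beta> (m + j)"
    using j by (auto simp: a w transl_def aff_fun_def \<beta>(2)[symmetric] blinfun.add_right)
  then show "a \<circ> w \<in> aff_roots R" using \<beta>(1) unfolding aff_roots_def by blast
  show "blinfun_apply (grad (a \<circ> w)) v = blinfun_apply (grad a) (lin_part R X w v)"
    by (simp add: eq grad_aff_fun \<beta>(2) w(4) a(3))
qed

text \<open>The reflection in \<alpha> + m is the linear reflection in \<alpha> after the
  translation by m times the coroot, and coroots lie in Y.\<close>

lemma aff_refl_Wa:
  assumes "a \<in> aff_roots R" shows "aff_refl a \<in> Wa" "lin_part R X (aff_refl a) = root_refl (grad a)"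
proof -
  obtain \<alpha> m where a: "\<alpha> \<in> R" "a = aff_fun \<alpha> m" "grad a = \<alpha>" using assms(1) by (rule aff_rootsE)
  have "(real_of_int m * 2) *\<^sub>R covec \<alpha> = real_of_int m *\<^sub>R covec \<alpha> + real_of_int m *\<^sub>R covec \<alpha>"
    by (simp add: scaleR_left_distrib[symmetric])
  then have "aff_refl a v = root_refl \<alpha> (v + of_int m *\<^sub>R covec \<alpha>)" for v
    using covec_self[OF R_nonzero[OF a(1)]]
    by (simp add: aff_refl_def a(3)) (simp add: a(2) aff_fun_def root_refl_def blinfun.add_right
        blinfun.scaleR_right algebra_simps scaleR_2)
  then have eq: "aff_refl a = root_refl \<alpha> \<circ> transl (of_int m *\<^sub>R covec \<alpha>)"
    by (auto simp: transl_def)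
  have y: "of_int m *\<^sub>R covec \<alpha> \<in> Y" using covec_Y[OF a(1)] by (intro Y_scale) auto
  show "aff_refl a \<in> Wa" unfolding eq by (rule WaI[OF weyl_refl[OF a(1)] y])
  show "lin_part R X (aff_refl a) = root_refl (grad a)"
    unfolding eq a(3) by (rule lin_part_eq[OF zero_notin_R weyl_refl[OF a(1)] y])
qed

lemma aff_refl_self: 
  assumes "a \<in> aff_roots R" shows "a (aff_refl a v) = - a v"
proof -
  obtain \<alpha> m where a: "\<alpha> \<in> R" "a = aff_fun \<alpha> m" "grad a = \<alpha>" using assms(1) by (rule aff_rootsE)
  show ?thesis using covec_self[OF R_nonzero[OF a(1)]]
    by (simp add: aff_refl_def a(3)) (simp add: a(2) aff_fun_def blinfun.diff_right blinfun.scaleR_right)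
qed

lemma aff_refl_aff_refl: 
  assumes "a \<in> aff_roots R" shows "aff_refl a (aff_refl a v) = v"
  using aff_refl_self[OF assms, of v] by (simp add: aff_refl_def[of a "aff_refl a v"]) (simp add: aff_refl_def)

lemma inv_aff_refl: assumes "a \<in> aff_roots R" shows "inv (aff_refl a) = aff_refl a"
  using aff_refl_aff_refl[OF assms] by (intro inv_unique_comp) (auto simp: fun_eq_iff)

text \<open>The linear part of w is orthogonal and takes the coroot of a to that of
  \<open>a \<circ> inv w\<close>. Conjugation by w thus permutes the reflections occurring in the
  Dunkl operators.\<close>

lemma aff_refl_conj:
  assumes a: "a \<in> aff_roots R" and w: "w \<in> Wa"
  shows "aff_refl (a \<circ> inv w) (w v) = w (aff_refl a v)"
proof -
  let ?U = "lin_part R X w"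
  have U: "?U \<in> weyl R" by (rule lin_part_Wa[OF w])
  have aw: "a \<circ> inv w \<in> aff_roots R" by (rule aff_roots_comp(1)[OF a Wa_inv[OF w]])
  have "(a \<circ> inv w) \<circ> w = a" using inv_Wa(1)[OF w] by auto
  then have "blinfun_apply (grad a) v = blinfun_apply (grad (a \<circ> inv w)) (?U v)" for v
    using aff_roots_comp(2)[OF aw w] by simp
  then have c: "covec (grad (a \<circ> inv w)) = ?U (covec (grad a))"
    by (intro covec_orthogonal weyl_props[OF U]) simp
  have "w (v + (- a v *\<^sub>R covec (grad a))) = w v + ?U (- a v *\<^sub>R covec (grad a))"
    by (rule Wa_affine(2)[OF w])
  also have "\<dots> = w v - a v *\<^sub>R ?U (covec (grad a))"
    by (simp add: linear_scale[OF Wa_affine(1)[OF w]] linear_neg[OF Wa_affine(1)[OF w]])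
  finally show ?thesis by (simp add: aff_refl_def c inv_Wa(1)[OF w])
qed

section \<open>Positive affine roots and simple reflections\<close>

lemma nonneg_comb_antisym:
  assumes "nonneg_comb F \<beta>" "nonneg_comb F (- \<beta>)" shows "\<beta> = 0"
proof -
  from assms obtain n m where n: "\<beta> = (\<Sum>\<alpha>\<in>F. real (n \<alpha>) *\<^sub>R \<alpha>)" "- \<beta> = (\<Sum>\<alpha>\<in>F. real (m \<alpha>) *\<^sub>R \<alpha>)"
    unfolding nonneg_comb_def by blast
  then have "(\<Sum>\<alpha>\<in>F. real (n \<alpha> + m \<alpha>) *\<^sub>R \<alpha>) = \<beta> + - \<beta>"
    by (simp add: sum.distrib scaleR_left_distrib del: add_uminus_conv_diff)
  then have "(\<Sum>\<alpha>\<in>F. real (n \<alpha> + m \<alpha>) *\<^sub>R \<alpha>) = 0" by simp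
  then have "real (n \<alpha> + m \<alpha>) = 0" if "\<alpha> \<in> F" for \<alpha>
    using independentD[OF F_indep finite_F subset_refl _ that, of "\<lambda>\<alpha>. real (n \<alpha> + m \<alpha>)"] by blast
  then have "n \<alpha> = 0" if "\<alpha> \<in> F" for \<alpha> using that by force
  then show ?thesis using n(1) by simp
qed

lemma simple_in_aff_roots: "a \<in> Fa \<Longrightarrow> a \<in> aff_roots R"
  unfolding aff_simple_roots_def aff_roots_def using F_sub R_uminus[OF \<theta>_R] by blast

lemma aff_pos_in_aff_roots: "a \<in> P \<Longrightarrow> a \<in> aff_roots R"
  unfolding aff_pos_roots_def aff_roots_def pos_roots_def by blast

lemma aff_pos_iff: "aff_fun \<alpha> m \<in> P \<longleftrightarrow> \<alpha> \<in> R \<and> (m > 0 \<or> m = 0 \<and> nonneg_comb F \<alpha>)"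
  unfolding aff_pos_roots_def pos_roots_def by (auto simp: aff_fun_eq_iff)

lemma nonneg_comb_F: 
  assumes "\<gamma> \<in> F" shows "nonneg_comb F \<gamma>"
proof -
  have "(\<Sum>\<alpha>\<in>F. real (if \<alpha> = \<gamma> then 1 else 0) *\<^sub>R \<alpha>) = (\<Sum>\<alpha>\<in>F. if \<alpha> = \<gamma> then \<gamma> else 0)"
    by (intro sum.cong) auto
  then have "\<gamma> = (\<Sum>\<alpha>\<in>F. real (if \<alpha> = \<gamma> then 1 else 0) *\<^sub>R \<alpha>)" using assms finite_F by simp
  then show ?thesis unfolding nonneg_comb_def by (intro exI[of _ "\<lambda>\<alpha>. if \<alpha> = \<gamma> then 1 else 0"])
qed

lemma simple_pos: "a \<in> Fa \<Longrightarrow> a \<in> P"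
  unfolding aff_simple_roots_def using F_sub nonneg_comb_F R_uminus[OF \<theta>_R] by (auto simp: aff_pos_iff)

lemma pos_or_neg:
  assumes "a \<in> aff_roots R" shows "(a \<in> P) \<noteq> ((\<lambda>v. - a v) \<in> P)"
proof -
  obtain \<alpha> m where a: "\<alpha> \<in> R" "a = aff_fun \<alpha> m" using assms(1) by (rule aff_rootsE)
  then show ?thesis
    using R_pos_neg[OF a(1)] nonneg_comb_antisym[of \<alpha>] R_nonzero R_uminus
    by (auto simp: aff_fun_uminus aff_pos_iff)
qed

lemma nonneg_\<theta>: "nonneg_comb F \<theta>"
proof (rule ccontr)
  assume "\<not> nonneg_comb F \<theta>"
  then have n: "nonneg_comb F (- \<theta>)" using R_pos_neg[OF \<theta>_R] by blast
  have "nonneg_comb F (\<theta> - - \<theta>)" by (rule \<theta>_highest[OF R_uminus[OF \<theta>_R]])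
  from nonneg_comb_add[OF this n] have "nonneg_comb F \<theta>" by simp
  with nonneg_comb_antisym[OF _ n] R_nonzero[OF \<theta>_R] show False by blast
qed

text \<open>Both bounds come from maximality applied to the reflected root \<gamma> = \<beta> -
  c\<theta> and its negative: for c < 0 the combination \<theta> - \<gamma> would force -\<beta> to
  be nonnegative, and for c \<ge> 2 the combination \<theta> + \<gamma> forces \<beta> - \<theta> to
  be nonnegative. Root lengths do not enter.\<close>

lemma covec_\<theta>_pos:
  assumes \<beta>: "\<beta> \<in> R" "nonneg_comb F \<beta>" and c: "blinfun_apply \<beta> (covec \<theta>) = of_int c"
  shows "c \<ge> 0" "c \<ge> 2 \<Longrightarrow> \<beta> = \<theta>"
proof -
  have r: "\<beta> - of_int c *\<^sub>R \<theta> \<in> R" using R_refl[OF \<theta>_R \<beta>(1)] c by simp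
  show "c \<ge> 0"
  proof (rule ccontr)
    assume "\<not> c \<ge> 0"
    define k where "k = nat (- c - 1)"
    have k: "c = - 1 - int k" using \<open>\<not> c \<ge> 0\<close> by (simp add: k_def)
    have "nonneg_comb F (\<theta> - (\<beta> - of_int c *\<^sub>R \<theta>))" by (rule \<theta>_highest[OF r])
    also have "\<theta> - (\<beta> - of_int c *\<^sub>R \<theta>) = - \<beta> - of_nat k *\<^sub>R \<theta>" by (simp add: k algebra_simps)
    finally have "nonneg_comb F (- \<beta>)"
      using nonneg_comb_add[OF _ nonneg_comb_scale[OF nonneg_\<theta>, of k], of "- \<beta> - of_nat k *\<^sub>R \<theta>"] by simp
    with nonneg_comb_antisym[OF \<beta>(2)] R_nonzero[OF \<beta>(1)] show False by blast
  qed
  assume "c \<ge> 2"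
  define k where "k = nat (c - 2)"
  have k: "c = 2 + int k" using \<open>c \<ge> 2\<close> by (simp add: k_def)
  have "nonneg_comb F (\<theta> - - (\<beta> - of_int c *\<^sub>R \<theta>))" by (rule \<theta>_highest[OF R_uminus[OF r]])
  also have "\<theta> - - (\<beta> - of_int c *\<^sub>R \<theta>) = (\<beta> - \<theta>) - of_nat k *\<^sub>R \<theta>"
    by (simp add: k algebra_simps scaleR_2)
  finally have "nonneg_comb F (- (\<theta> - \<beta>))"
    using nonneg_comb_add[OF _ nonneg_comb_scale[OF nonneg_\<theta>, of k], of "(\<beta> - \<theta>) - of_nat k *\<^sub>R \<theta>"] by simp
  from nonneg_comb_antisym[OF \<theta>_highest[OF \<beta>(1)] this] show "\<beta> = \<theta>" by simp
qed

text \<open>The reflection changes only the \<alpha>-coefficient of \<beta>. Were the image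
  negative, all other coefficients of \<beta> would vanish, leaving a multiple of \<alpha>, which
  reducedness makes \<alpha> itself.\<close>

lemma F_refl_pos:
  assumes \<alpha>: "\<alpha> \<in> F" and \<beta>: "\<beta> \<in> R" "nonneg_comb F \<beta>" "\<beta> \<noteq> \<alpha>"
  shows "nonneg_comb F (\<beta> - blinfun_apply \<beta> (covec \<alpha>) *\<^sub>R \<alpha>)"
proof (rule ccontr)
  let ?c = "blinfun_apply \<beta> (covec \<alpha>)"
  assume n: "\<not> nonneg_comb F (\<beta> - ?c *\<^sub>R \<alpha>)"
  have "\<beta> - ?c *\<^sub>R \<alpha> \<in> R" using R_refl F_sub \<alpha> \<beta>(1) by blast
  from R_pos_neg[OF this] n have "nonneg_comb F (- (\<beta> - ?c *\<^sub>R \<alpha>))" by blast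
  with \<beta>(2) obtain n m where n: "\<beta> = (\<Sum>\<gamma>\<in>F. real (n \<gamma>) *\<^sub>R \<gamma>)" 
    and m: "- (\<beta> - ?c *\<^sub>R \<alpha>) = (\<Sum>\<gamma>\<in>F. real (m \<gamma>) *\<^sub>R \<gamma>)"
    unfolding nonneg_comb_def by blast
  have "(\<Sum>\<gamma>\<in>F. (real (n \<gamma>) + real (m \<gamma>) - (if \<gamma> = \<alpha> then ?c else 0)) *\<^sub>R \<gamma>)
     = (\<Sum>\<gamma>\<in>F. real (n \<gamma>) *\<^sub>R \<gamma>) + (\<Sum>\<gamma>\<in>F. real (m \<gamma>) *\<^sub>R \<gamma>) - (\<Sum>\<gamma>\<in>F. if \<gamma> = \<alpha> then ?c *\<^sub>R \<gamma> else 0)"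
    by (simp add: scaleR_left_distrib scaleR_left_diff_distrib sum.distrib sum_subtractf if_distrib[of "\<lambda>x. x *\<^sub>R _"] cong: if_cong)
  also have "\<dots> = 0" using \<alpha> finite_F by (simp add: n[symmetric] m[symmetric])
  finally have z: "real (n \<gamma>) + real (m \<gamma>) - (if \<gamma> = \<alpha> then ?c else 0) = 0" if "\<gamma> \<in> F" for \<gamma>
    using independentD[OF F_indep finite_F subset_refl _ that,
        of "\<lambda>\<gamma>. real (n \<gamma>) + real (m \<gamma>) - (if \<gamma> = \<alpha> then ?c else 0)"] by blast
  have "n \<gamma> = 0" if "\<gamma> \<in> F" "\<gamma> \<noteq> \<alpha>" for \<gamma> using z[OF that(1)] that(2) by simp
  then have "\<beta> = (\<Sum>\<gamma>\<in>{\<alpha>}. real (n \<gamma>) *\<^sub>R \<gamma>)"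
    unfolding n using \<alpha> finite_F by (intro sum.mono_neutral_right) auto
  then have "\<beta> = real (n \<alpha>) *\<^sub>R \<alpha>" by simp
  moreover from this have "real (n \<alpha>) = 1" using R_reduced[of \<alpha> "real (n \<alpha>)"] \<alpha> F_sub \<beta>(1) by auto
  ultimately show False using \<beta>(3) by simp
qed

lemma aff_fun_refl:
  assumes "\<alpha> \<in> R" "\<beta> \<in> R" "blinfun_apply \<beta> (covec \<alpha>) = of_int c"
  shows "aff_fun \<beta> m \<circ> aff_refl (aff_fun \<alpha> n) = aff_fun (\<beta> - of_int c *\<^sub>R \<alpha>) (m - c * n)"
proof
  fix v
  have "(aff_fun \<beta> m \<circ> aff_refl (aff_fun \<alpha> n)) v = aff_fun \<beta> m (v - aff_fun \<alpha> n v *\<^sub>R covec \<alpha>)"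
    by (simp add: aff_refl_def grad_aff_fun)
  also have "\<dots> = aff_fun (\<beta> - of_int c *\<^sub>R \<alpha>) (m - c * n) v"
    using assms(3) by (simp add: aff_fun_def blinfun.diff_right blinfun.diff_left blinfun.add_right
        blinfun.scaleR_right blinfun.scaleR_left algebra_simps)
  finally show "(aff_fun \<beta> m \<circ> aff_refl (aff_fun \<alpha> n)) v = aff_fun (\<beta> - of_int c *\<^sub>R \<alpha>) (m - c * n) v" .
qed

text \<open>For a in F the constant m is kept, so only m = 0 needs the finite statement. For the
  affine simple root the constant becomes m + c, with c the pairing of \<beta> with the coroot of
  \<theta>; the bounds on c keep it nonnegative, and when it reaches 0 the new gradient is seen to
  be a positive root.\<close>

lemma simple_refl_pos:
  assumes a: "a \<in> Fa" and b: "b \<in> P" "b \<noteq> a"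
  shows "b \<circ> aff_refl a \<in> P"
proof -
  obtain \<beta> m where \<beta>: "\<beta> \<in> R" "b = aff_fun \<beta> m" using aff_pos_in_aff_roots[OF b(1)] by (rule aff_rootsE)
  have m: "m > 0 \<or> m = 0 \<and> nonneg_comb F \<beta>" using b(1) unfolding \<beta>(2) aff_pos_iff by blast
  from a consider \<alpha> where "\<alpha> \<in> F" "a = aff_fun \<alpha> 0" | "a = aff_fun (- \<theta>) 1"
    unfolding aff_simple_roots_def by blast
  then show ?thesis
  proof cases
    case 1
    obtain c where c: "blinfun_apply \<beta> (covec \<alpha>) = of_int c"
      using R_int[OF _ \<beta>(1), of \<alpha>] 1 F_sub by (auto elim: Ints_cases)
    have r: "\<beta> - of_int c *\<^sub>R \<alpha> \<in> R" using R_refl[OF _ \<beta>(1), of \<alpha>] c 1 F_sub by auto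
    have "b \<circ> aff_refl a = aff_fun (\<beta> - of_int c *\<^sub>R \<alpha>) m"
      using aff_fun_refl[OF _ \<beta>(1) c, of m 0] 1 F_sub unfolding \<beta>(2) 1(2) by auto
    moreover have "m = 0 \<Longrightarrow> nonneg_comb F (\<beta> - of_int c *\<^sub>R \<alpha>)"
      using F_refl_pos[OF 1(1) \<beta>(1)] m b(2) unfolding \<beta>(2) 1(2) c by auto
    ultimately show ?thesis using m r by (auto simp: aff_pos_iff)
  next
    case 2
    obtain c where c: "blinfun_apply \<beta> (covec \<theta>) = of_int c"
      using R_int[OF \<theta>_R \<beta>(1)] by (auto elim: Ints_cases)
    have r: "\<beta> - of_int c *\<^sub>R \<theta> \<in> R" using R_refl[OF \<theta>_R \<beta>(1)] c by simp
    have "blinfun_apply \<beta> (covec (- \<theta>)) = of_int (- c)" by (simp add: covec_uminus blinfun.minus_right c)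
    from aff_fun_refl[OF R_uminus[OF \<theta>_R] \<beta>(1) this, of m 1]
    have eq: "b \<circ> aff_refl a = aff_fun (\<beta> - of_int c *\<^sub>R \<theta>) (m + c)" by (simp add: \<beta>(2) 2)
    show ?thesis
    proof (cases "nonneg_comb F \<beta>")
      case True
      then have "c \<ge> 0" using covec_\<theta>_pos(1)[OF \<beta>(1) _ c] by blast
      then show ?thesis using m True r unfolding eq aff_pos_iff by auto
    next
      case False
      then have n: "nonneg_comb F (- \<beta>)" and m0: "m > 0" using R_pos_neg[OF \<beta>(1)] m by auto
      have c': "blinfun_apply (- \<beta>) (covec \<theta>) = of_int (- c)" by (simp add: blinfun.minus_left c)
      note th = covec_\<theta>_pos[OF R_uminus[OF \<beta>(1)] n c']
      show ?thesis
      proof (cases "c \<le> -2")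
        case True
        with th(2) have t: "\<beta> = - \<theta>" by (metis minus_minus neg_le_iff_le)
        then have "c = -2" using c covec_self[OF R_nonzero[OF \<theta>_R]] by (simp add: blinfun.minus_left)
        \<comment> \<open>Here b is -\<theta> + m and a is -\<theta> + 1, so b \<noteq> a is exactly
          what excludes m + c = -1.\<close>
        moreover have "m \<noteq> 1" using b(2) t unfolding \<beta>(2) 2 by auto
        ultimately have "\<beta> - of_int c *\<^sub>R \<theta> = \<theta>" "m + c \<ge> 0" using t m0 by (auto simp: scaleR_2)
        then show ?thesis using nonneg_\<theta> \<theta>_R unfolding eq by (auto simp: aff_pos_iff)
      next
        case False
        then have "c = 0 \<or> c = -1" using th(1) by auto
        \<comment> \<open>For m = 1 and c = -1 the constant drops to 0, and positivity rests on the
          gradient \<beta> + \<theta>.\<close>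
        moreover have "nonneg_comb F (\<beta> + \<theta>)" using \<theta>_highest[OF R_uminus[OF \<beta>(1)]] by (simp add: add.commute)
        ultimately show ?thesis using m0 r unfolding eq by (auto simp: aff_pos_iff)
      qed
    qed
  qed
qed

section \<open>Descent into the fundamental alcove\<close>

text \<open>At a regular point these roots define the hyperplanes separating x from the fundamental
  alcove. They index the terms of the Dunkl sum that survive at x.\<close>

definition neg_at :: "'v \<Rightarrow> ('v \<Rightarrow> real) set" where
  "neg_at x = {a \<in> P. a x < 0}"

lemma finite_neg_at: "finite (neg_at x)"
proof -
  obtain M :: int where M: "\<And>\<alpha>. \<alpha> \<in> R \<Longrightarrow> \<bar>blinfun_apply \<alpha> x\<bar> \<le> of_int M"
  proof -
    have "\<bar>blinfun_apply \<alpha> x\<bar> \<le> of_int \<lceil>\<Sum>\<alpha>\<in>R. \<bar>blinfun_apply \<alpha> x\<bar>\<rceil>" if "\<alpha> \<in> R" for \<alpha>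
      using member_le_sum[OF that _ finite_R, of "\<lambda>\<alpha>. \<bar>blinfun_apply \<alpha> x\<bar>"]
      by (meson abs_ge_zero le_of_int_ceiling order_trans)
    then show thesis using that by blast
  qed
  have "neg_at x \<subseteq> (\<lambda>(\<alpha>, m). aff_fun \<alpha> m) ` (R \<times> {0..M})"
  proof
    fix a assume a: "a \<in> neg_at x"
    then obtain \<alpha> m where \<alpha>: "\<alpha> \<in> R" "a = aff_fun \<alpha> m" using aff_pos_in_aff_roots aff_rootsE
      unfolding neg_at_def by (metis (mono_tags, lifting) mem_Collect_eq)
    have "m \<ge> 0" using a unfolding neg_at_def \<alpha>(2) by (auto simp: aff_pos_iff)
    moreover have "real_of_int m \<le> of_int M" using a M[OF \<alpha>(1)] unfolding neg_at_def \<alpha>(2)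
      by (auto simp: aff_fun_def)
    ultimately show "a \<in> (\<lambda>(\<alpha>, m). aff_fun \<alpha> m) ` (R \<times> {0..M})" using \<alpha> by force
  qed
  then show ?thesis by (rule finite_subset) (simp add: finite_R)
qed

lemma Vreg_iff: "x \<in> Vreg \<longleftrightarrow> (\<forall>a\<in>aff_roots R. a x \<noteq> 0)"
proof
  assume x: "x \<in> Vreg"
  show "\<forall>a\<in>aff_roots R. a x \<noteq> 0"
  proof
    fix a assume "a \<in> aff_roots R"
    then have "a \<in> P \<or> (\<lambda>v. - a v) \<in> P" using pos_or_neg by blast
    then show "a x \<noteq> 0" using x unfolding regular_set_def by force
  qed
qed (use aff_pos_in_aff_roots in \<open>auto simp: regular_set_def\<close>)

lemma Wa_Vreg: "w \<in> Wa \<Longrightarrow> x \<in> Vreg \<Longrightarrow> w x \<in> Vreg"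
  unfolding Vreg_iff using aff_roots_comp(1) by (metis comp_apply)

text \<open>The reflection permutes the positive affine roots other than a and sends a to -a. The
  moved set therefore loses a when a is negative at x, and otherwise gains -a, which is not
  positive. This single discrepancy is the source of the scalar in the cross relation.\<close>

lemma neg_at_refl:
  assumes a: "a \<in> Fa" and x: "x \<in> Vreg"
  shows "(\<lambda>b. b \<circ> aff_refl a) ` neg_at (aff_refl a x)
    = (if a x < 0 then neg_at x - {a} else insert (\<lambda>v. - a v) (neg_at x))"
proof -
  let ?s = "aff_refl a"
  have ar: "a \<in> aff_roots R" by (rule simple_in_aff_roots[OF a])
  have na: "(\<lambda>v. - a v) \<notin> P" using pos_or_neg[OF ar] simple_pos[OF a] by blast
  have as: "a \<circ> ?s = (\<lambda>v. - a v)" using aff_refl_self[OF ar] by auto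
  have ss: "b \<circ> ?s \<circ> ?s = b" for b :: "'v \<Rightarrow> real" using aff_refl_aff_refl[OF ar] by auto
  have ax: "a x \<noteq> 0" using x ar Vreg_iff by blast
  have in_other: "b \<circ> ?s \<in> neg_at x - {a}" if "b \<in> neg_at (?s x)" "b \<noteq> a" for b
  proof -
    have "b \<circ> ?s \<in> P" using simple_refl_pos[OF a] that unfolding neg_at_def by blast
    moreover have "b \<circ> ?s \<noteq> a" using ss[of b] as na that unfolding neg_at_def by force
    ultimately show ?thesis using that by (simp add: neg_at_def)
  qed
  have out_other: "b \<in> (\<lambda>b. b \<circ> ?s) ` neg_at (?s x)" if "b \<in> neg_at x" "b \<noteq> a" for b
  proof (rule image_eqI)
    show "b = (b \<circ> ?s) \<circ> ?s" by (simp only: ss)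
    show "b \<circ> ?s \<in> neg_at (?s x)"
      using simple_refl_pos[OF a] that aff_refl_aff_refl[OF ar] unfolding neg_at_def by simp
  qed
  show ?thesis
  proof (cases "a x < 0")
    case True
    then have "a \<notin> neg_at (?s x)" using aff_refl_self[OF ar] by (simp add: neg_at_def)
    then have "(\<lambda>b. b \<circ> ?s) ` neg_at (?s x) \<subseteq> neg_at x - {a}"
      by (intro image_subsetI in_other) auto
    moreover have "neg_at x - {a} \<subseteq> (\<lambda>b. b \<circ> ?s) ` neg_at (?s x)"
      by (intro subsetI out_other) auto
    ultimately show ?thesis using True by simp
  next
    case False
    then have "a \<in> neg_at (?s x)" using aff_refl_self[OF ar] simple_pos[OF a] ax by (simp add: neg_at_def)
    then have "(\<lambda>v. - a v) \<in> (\<lambda>b. b \<circ> ?s) ` neg_at (?s x)"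
      by (intro image_eqI[where x=a]) (simp_all only: as)
    moreover have "a \<notin> neg_at x" using False by (simp add: neg_at_def)
    moreover have "b \<circ> ?s \<in> insert (\<lambda>v. - a v) (neg_at x)" if "b \<in> neg_at (?s x)" for b
      using in_other[OF that] as by (cases "b = a") auto
    moreover have "b \<in> (\<lambda>b. b \<circ> ?s) ` neg_at (?s x)" if "b \<in> neg_at x" for b
      using out_other[OF that] that \<open>a \<notin> neg_at x\<close> by metis
    ultimately have "(\<lambda>b. b \<circ> ?s) ` neg_at (?s x) = insert (\<lambda>v. - a v) (neg_at x)" by blast
    then show ?thesis using False by simp
  qed
qed

text \<open>If all affine simple roots are nonnegative at x, then \<theta>(x) \<le> 1. As \<theta> +
  \<beta> is a nonnegative combination of F, every root satisfies \<beta>(x) \<ge> -1, which settles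
  m > 0; for m = 0 the gradient itself is such a combination.\<close>

lemma exists_simple_neg:
  assumes "neg_at x \<noteq> {}" shows "\<exists>a\<in>Fa. a x < 0"
proof (rule ccontr)
  assume "\<not> (\<exists>a\<in>Fa. a x < 0)"
  then have f: "\<And>\<gamma>. \<gamma> \<in> F \<Longrightarrow> blinfun_apply \<gamma> x \<ge> 0" and t: "blinfun_apply \<theta> x \<le> 1"
    unfolding aff_simple_roots_def by (force simp: aff_fun_def blinfun.minus_left)+
  from assms obtain b where b: "b \<in> P" "b x < 0" unfolding neg_at_def by blast
  obtain \<beta> m where \<beta>: "\<beta> \<in> R" "b = aff_fun \<beta> m" using aff_pos_in_aff_roots[OF b(1)] by (rule aff_rootsE)
  have "blinfun_apply (\<theta> - - \<beta>) x \<ge> 0"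
    by (rule nonneg_comb_nonneg[OF \<theta>_highest[OF R_uminus[OF \<beta>(1)]] f])
  then have "blinfun_apply \<beta> x \<ge> - 1" using t by (simp add: blinfun.add_left)
  moreover have "nonneg_comb F \<beta> \<Longrightarrow> blinfun_apply \<beta> x \<ge> 0" using nonneg_comb_nonneg f by blast
  ultimately show False using b unfolding \<beta>(2) aff_pos_iff by (auto simp: aff_fun_def)
qed

text \<open>The count falls by one at a simple root negative at x. The rule asks for the reflection
  step at every simple root, since the properties it is meant for are transported whatever the sign
  of a at x.\<close>

lemma Vreg_induct [consumes 1, case_names dominant refl]:
  assumes "x \<in> Vreg"
    and "\<And>x. x \<in> Vreg \<Longrightarrow> neg_at x = {} \<Longrightarrow> Q x"
    and "\<And>a x. a \<in> Fa \<Longrightarrow> x \<in> Vreg \<Longrightarrow> Q (aff_refl a x) \<Longrightarrow> Q x"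
  shows "Q x"
  using assms(1)
proof (induction "card (neg_at x)" arbitrary: x rule: less_induct)
  case less
  show ?case
  proof (cases "neg_at x = {}")
    case False
    then obtain a where a: "a \<in> Fa" "a x < 0" using exists_simple_neg by blast
    have ar: "a \<in> aff_roots R" by (rule simple_in_aff_roots[OF a(1)])
    have inj: "inj_on (\<lambda>b. b \<circ> aff_refl a) (neg_at (aff_refl a x))"
    proof (rule inj_onI)
      fix b c :: "'v \<Rightarrow> real" assume eq: "b \<circ> aff_refl a = c \<circ> aff_refl a"
      show "b = c"
      proof
        fix v show "b v = c v" using fun_cong[OF eq, of "aff_refl a v"] by (simp add: aff_refl_aff_refl[OF ar])
      qed
    qed
    have "card (neg_at (aff_refl a x)) = card (neg_at x - {a})"
      using card_image[OF inj] neg_at_refl[OF a(1) less.prems] a(2) by simp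
    also have "\<dots> < card (neg_at x)"
      using a simple_pos by (intro card_Diff1_less finite_neg_at) (auto simp: neg_at_def)
    finally have "Q (aff_refl a x)"
      using less.hyps Wa_Vreg[OF aff_refl_Wa(1)[OF ar] less.prems] by blast
    then show ?thesis using assms(3)[OF a(1) less.prems] by blast
  qed (use assms(2) less.prems in blast)
qed

section \<open>Generation of the group by alcove symmetries and simple reflections\<close>

lemma exists_dominant: "\<exists>x. \<forall>b\<in>P. b x > 0"
proof -
  obtain g :: "'v dual \<Rightarrow> real" where g: "linear g" "\<And>\<gamma>. \<gamma> \<in> F \<Longrightarrow> g \<gamma> = 1"
    using linear_independent_extend[OF F_indep, of "\<lambda>_. 1 :: real"] by blast
  \<comment> \<open>The vector representing the functional g on the dual, so that every element of F
    takes the value 1 at x.\<close>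
  define x where "x = (\<Sum>b\<in>Basis. g (blinfun_inner_left b) *\<^sub>R b)"
  have gx: "blinfun_apply \<xi> x = g \<xi>" for \<xi>
  proof -
    have "\<xi> = (\<Sum>b\<in>Basis. blinfun_apply \<xi> b *\<^sub>R blinfun_inner_left b)"
      by (rule blinfun_euclidean_eqI) (simp add: blinfun.sum_left blinfun.scaleR_left inner_Basis if_distrib cong: if_cong)
    then have "g \<xi> = g (\<Sum>b\<in>Basis. blinfun_apply \<xi> b *\<^sub>R blinfun_inner_left b)" by simp
    then show ?thesis by (simp add: x_def blinfun.sum_right blinfun.scaleR_right linear_sum[OF g(1)] linear_scale[OF g(1)] mult.commute)
  qed
  \<comment> \<open>Scaling keeps F positive and brings \<theta> below 1; the summand 1 makes this
    inequality strict.\<close>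
  define \<epsilon> where "\<epsilon> = 1 / (\<bar>blinfun_apply \<theta> x\<bar> + 1)"
  have \<epsilon>: "\<epsilon> > 0" unfolding \<epsilon>_def by (simp add: add_nonneg_pos)
  have t: "blinfun_apply \<theta> (\<epsilon> *\<^sub>R x) < 1"
    unfolding \<epsilon>_def blinfun.scaleR_right by (simp add: add_nonneg_pos divide_less_eq)
  have f: "blinfun_apply \<gamma> (\<epsilon> *\<^sub>R x) = \<epsilon>" if "\<gamma> \<in> F" for \<gamma>
    using g(2)[OF that] by (simp add: blinfun.scaleR_right gx)
  have "b (\<epsilon> *\<^sub>R x) > 0" if b: "b \<in> P" for b
  proof -
    obtain \<beta> m where \<beta>: "\<beta> \<in> R" "b = aff_fun \<beta> m" using aff_pos_in_aff_roots[OF b(1)] by (rule aff_rootsE)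
    have "blinfun_apply (\<theta> - - \<beta>) (\<epsilon> *\<^sub>R x) \<ge> 0"
      by (rule nonneg_comb_nonneg[OF \<theta>_highest[OF R_uminus[OF \<beta>(1)]]]) (use f \<epsilon> in auto)
    then have 1: "blinfun_apply \<beta> (\<epsilon> *\<^sub>R x) > - 1" using t by (simp add: blinfun.add_left)
    have 2: "blinfun_apply \<beta> (\<epsilon> *\<^sub>R x) > 0" if n: "nonneg_comb F \<beta>"
    proof -
      from n obtain n where n: "\<beta> = (\<Sum>\<gamma>\<in>F. real (n \<gamma>) *\<^sub>R \<gamma>)" unfolding nonneg_comb_def by blast
      have "\<exists>\<gamma>\<in>F. n \<gamma> \<noteq> 0" using n R_nonzero[OF \<beta>(1)] by (metis (no_types, lifting) of_nat_0 scaleR_zero_left sum.neutral)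
      then obtain \<gamma> where "\<gamma> \<in> F" "n \<gamma> > 0" by auto
      moreover have "blinfun_apply \<beta> (\<epsilon> *\<^sub>R x) = (\<Sum>\<gamma>\<in>F. real (n \<gamma>) * \<epsilon>)"
        unfolding n blinfun.sum_left by (intro sum.cong) (auto simp only: blinfun.scaleR_left f real_scaleR_def)
      ultimately show ?thesis using \<epsilon> finite_F
        by (simp only:) (rule sum_pos2[of _ \<gamma>], auto)
    qed
    show ?thesis using b 1 2 unfolding \<beta>(2) aff_pos_iff by (auto simp: aff_fun_def)
  qed
  then show ?thesis by blast
qed

text \<open>This is \<Omega> described by its action on the positive affine roots, which is what the
  operators use; \<open>aff_length\<close> counts by \<open>card\<close> and would call for
  finiteness first. Preservation under the inverse is included to make the action on P
  bijective.\<close>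

definition alcove_stab :: "('v \<Rightarrow> 'v) set" where
  "alcove_stab = {w \<in> Wa. \<forall>b\<in>P. b \<circ> w \<in> P \<and> b \<circ> inv w \<in> P}"

text \<open>This inclusion makes the length-zero relation of A(k) available for these
  generators.\<close>

lemma alcove_stab_length_zero: "alcove_stab \<subseteq> length_zero R X F"
proof
  fix w assume w: "w \<in> alcove_stab"
  have "P \<inter> (\<lambda>a. a \<circ> w) ` aff_neg_roots R F = {}"
  proof (rule ccontr)
    assume "\<not> ?thesis"
    then obtain b where b: "b \<in> P" "(\<lambda>v. - b v) \<circ> w \<in> P" unfolding aff_neg_roots_def by blast
    have "b \<circ> w \<in> P" using w b(1) unfolding alcove_stab_def by blast
    with pos_or_neg[OF aff_pos_in_aff_roots[OF this]] b(2) show False by (simp add: o_def)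
  qed
  then show "w \<in> length_zero R X F" using w unfolding length_zero_def aff_length_def alcove_stab_def by simp
qed

text \<open>A group element is followed through the image of a point x0 of the alcove. Simple
  reflections bring w x0 back, and an element keeping x0 in the alcove preserves the positive affine
  roots, since the sign at an alcove point decides positivity.\<close>

lemma Wa_induct [consumes 1, case_names stab refl]:
  assumes w: "w \<in> Wa"
    and stab: "\<And>w. w \<in> alcove_stab \<Longrightarrow> Q w"
    and refl: "\<And>a w. a \<in> Fa \<Longrightarrow> w \<in> Wa \<Longrightarrow> Q w \<Longrightarrow> Q (aff_refl a \<circ> w)"
  shows "Q w"
proof -
  obtain x0 where x0: "\<And>b. b \<in> P \<Longrightarrow> b x0 > 0" using exists_dominant by blast
  have x0r: "x0 \<in> Vreg" using x0 unfolding regular_set_def by force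
  \<comment> \<open>Quantifying over the image point turns the descent on points into an induction
    on group elements.\<close>
  have "\<forall>w\<in>Wa. w x0 = x \<longrightarrow> Q w" if "x \<in> Vreg" for x
    using that
  proof (induction rule: Vreg_induct)
    case (dominant x)
    show ?case
    proof (intro ballI impI)
      fix w assume w: "w \<in> Wa" "w x0 = x"
      have "b \<circ> w \<in> P \<and> b \<circ> inv w \<in> P" if b: "b \<in> P" for b
      proof
        have br: "b \<in> aff_roots R" by (rule aff_pos_in_aff_roots[OF b])
        show "b \<circ> w \<in> P"
        proof (rule ccontr)
          assume "b \<circ> w \<notin> P"
          then have "(\<lambda>v. - (b \<circ> w) v) \<in> P" using pos_or_neg[OF aff_roots_comp(1)[OF br w(1)]] by blast
          from x0[OF this] have "b x < 0" using w(2) by simp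
          then show False using dominant b unfolding neg_at_def by blast
        qed
        show "b \<circ> inv w \<in> P"
        proof (rule ccontr)
          assume "b \<circ> inv w \<notin> P"
          then have n: "(\<lambda>v. - (b \<circ> inv w) v) \<in> P"
            using pos_or_neg[OF aff_roots_comp(1)[OF br Wa_inv[OF w(1)]]] by blast
          have "inv w x = x0" using w inv_Wa(1) by blast
          then have "- (b \<circ> inv w) x < 0" using x0[OF b] by simp
          with n dominant(2) show False unfolding neg_at_def by blast
        qed
      qed
      then show "Q w" using w(1) by (intro stab) (auto simp: alcove_stab_def)
    qed
  next
    case (refl a x)
    have ar: "a \<in> aff_roots R" by (rule simple_in_aff_roots[OF refl(1)])
    show ?case
    proof (intro ballI impI)
      fix w assume w: "w \<in> Wa" "w x0 = x"
      have sw: "aff_refl a \<circ> w \<in> Wa" by (rule Wa_comp[OF aff_refl_Wa(1)[OF ar] w(1)])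
      then have "Q (aff_refl a \<circ> w)" using refl.IH w(2) by simp
      from assms(3)[OF refl(1) sw this] show "Q w"
        by (simp add: o_def aff_refl_aff_refl[OF ar])
    qed
  qed
  from this[OF Wa_Vreg[OF w x0r]] w show ?thesis by blast
qed

lemma neg_at_stab:
  assumes "w \<in> alcove_stab" shows "(\<lambda>b. b \<circ> inv w) ` neg_at (inv w x) = neg_at x"
proof -
  have w: "w \<in> Wa" and pp: "\<And>b. b \<in> P \<Longrightarrow> b \<circ> w \<in> P \<and> b \<circ> inv w \<in> P"
    using assms unfolding alcove_stab_def by auto
  have "b \<in> (\<lambda>b. b \<circ> inv w) ` neg_at (inv w x)" if "b \<in> neg_at x" for b
  proof (rule image_eqI)
    show "b = (b \<circ> w) \<circ> inv w" using inv_Wa(2)[OF w] by auto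
    show "b \<circ> w \<in> neg_at (inv w x)" using that pp inv_Wa(2)[OF w] by (simp add: neg_at_def)
  qed
  then show ?thesis using pp by (auto simp: neg_at_def)
qed

end

section \<open>The Dunkl type operators\<close>

lemma sum_lessThan_add:
  fixes f g :: "nat \<Rightarrow> 'm::comm_monoid_add"
  shows "(\<Sum>i<n + k. if i < n then f i else g (i - n)) = (\<Sum>i<n. f i) + (\<Sum>i<k. g i)"
  by (induction k) (auto simp: add.assoc)

text \<open>The coordinate along x in a basis extending {x}. It reduces equality in the module to
  equality of complex numbers, where derivatives make sense.\<close>

lemma (in vector_space) exists_separating_functional:
  assumes "x \<noteq> 0"
  obtains l where "Vector_Spaces.linear scale (*) l" "l x \<noteq> 0"
proof
  let ?B = "extend_basis {x}"
  have i: "independent {x}" using assms by simp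
  have B: "independent ?B" "span ?B = UNIV" "x \<in> ?B"
    using independent_extend_basis[OF i] span_extend_basis[OF i] extend_basis_superset[OF i] by auto
  show "Vector_Spaces.linear scale (*) (\<lambda>v. representation ?B v x)"
    by (rule linear_representation[OF B(1,2)])
  show "representation ?B x x \<noteq> 0"
    using representation_basis[OF B(1,3)] by simp
qed

locale dunkl_datum =
  affine_root_datum R X F \<theta> + M: aff_weyl_module R X scaleM act
  for R X F :: "'v::euclidean_space dual set"
    and \<theta> :: "'v dual"
    and scaleM :: "complex \<Rightarrow> 'm::ab_group_add \<Rightarrow> 'm"
    and act :: "('v \<Rightarrow> 'v) \<Rightarrow> 'm \<Rightarrow> 'm" +
  fixes k :: "('v \<Rightarrow> real) \<Rightarrow> complex"
  assumes k_invariant: "multiplicity_function R X k"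
begin

abbreviation Bsp where "Bsp \<equiv> B_space R F scaleM"
abbreviation chamber where "chamber x \<equiv> connected_component_set Vreg x"
abbreviation tensor where "tensor \<equiv> tensor_fun scaleM"
abbreviation BD where "BD \<equiv> B_deriv R F scaleM"
abbreviation Du where "Du \<equiv> dunkl R F k scaleM act"
abbreviation wact where "wact \<equiv> fun_act act"

lemma act_add: "w \<in> Wa \<Longrightarrow> act w (m + m') = act w m + act w m'"
  and act_scale: "w \<in> Wa \<Longrightarrow> act w (scaleM c m) = scaleM c (act w m)"
  using M.act_linear[of w] by (simp_all add: Vector_Spaces.linear_iff)

lemma act_0: "w \<in> Wa \<Longrightarrow> act w 0 = 0"
  using act_scale[of w 0 0] by simp

lemma act_sum: "w \<in> Wa \<Longrightarrow> act w (\<Sum>i\<in>I. g i) = (\<Sum>i\<in>I. act w (g i))"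
  by (induction I rule: infinite_finite_induct) (auto simp: act_0 act_add)

lemma act_uminus: "w \<in> Wa \<Longrightarrow> act w (- m) = - act w m"
  using act_scale[of w "-1" m] by simp

lemma k_inv: "w \<in> Wa \<Longrightarrow> a \<in> aff_roots R \<Longrightarrow> k (a \<circ> inv w) = k a"
  using k_invariant unfolding multiplicity_function_def by blast

section \<open>Chambers as components of an open set\<close>

lemma aff_root_continuous: "a \<in> aff_roots R \<Longrightarrow> continuous_on S a"
  unfolding aff_roots_def aff_fun_def[abs_def] by (auto intro!: continuous_intros)

text \<open>There are infinitely many hyperplanes, but a point is regular iff none of the finitely
  many roots takes an integer value there, and the integers are closed.\<close>

lemma open_Vreg: "open Vreg"
proof -
  have "x \<in> Vreg \<longleftrightarrow> (\<forall>\<alpha>\<in>R. blinfun_apply \<alpha> x \<notin> \<int>)" for x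
  proof
    assume x: "x \<in> Vreg"
    show "\<forall>\<alpha>\<in>R. blinfun_apply \<alpha> x \<notin> \<int>"
    proof (intro ballI notI)
      fix \<alpha> assume \<alpha>: "\<alpha> \<in> R" "blinfun_apply \<alpha> x \<in> \<int>"
      then obtain j where "blinfun_apply \<alpha> x = of_int j" by (auto elim: Ints_cases)
      then have "aff_fun \<alpha> (- j) x = 0" by (simp add: aff_fun_def)
      moreover have "aff_fun \<alpha> (- j) \<in> aff_roots R" using \<alpha>(1) unfolding aff_roots_def by blast
      ultimately show False using x Vreg_iff by blast
    qed
  next
    assume *: "\<forall>\<alpha>\<in>R. blinfun_apply \<alpha> x \<notin> \<int>"
    show "x \<in> Vreg"
      unfolding Vreg_iff
    proof
      fix a assume "a \<in> aff_roots R"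
      then obtain \<alpha> m where a: "\<alpha> \<in> R" "a = aff_fun \<alpha> m" by (rule aff_rootsE)
      show "a x \<noteq> 0"
      proof
        assume "a x = 0"
        then have "blinfun_apply \<alpha> x = of_int (- m)" by (simp add: a(2) aff_fun_def)
        then show False using * a(1) by (metis Ints_of_int)
      qed
    qed
  qed
  then have "Vreg = (\<Inter>\<alpha>\<in>R. blinfun_apply \<alpha> -` (- \<int>))" by auto
  moreover have "open (blinfun_apply \<alpha> -` (- \<int>))" for \<alpha> :: "'v dual"
    by (intro open_vimage continuous_intros) (simp add: open_Compl)
  ultimately show ?thesis using finite_R by (simp add: open_INT)
qed

lemma chamber_open: "open (chamber x)"
  by (rule open_connected_component[OF open_Vreg])

lemma chamber_sub: "chamber x \<subseteq> Vreg"
  by (rule connected_component_subset)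

lemma in_chamber: "x \<in> Vreg \<Longrightarrow> x \<in> chamber x"
  by (simp add: connected_component_refl)

lemma chamber_eq: "y \<in> chamber x \<Longrightarrow> chamber y = chamber x"
  using connected_component_eq by blast

lemma chamber_unique: "C \<in> components Vreg \<Longrightarrow> x \<in> C \<Longrightarrow> C = chamber x"
  unfolding components_def using connected_component_eq by blast

lemma chamber_component: "x \<in> Vreg \<Longrightarrow> chamber x \<in> components Vreg"
  unfolding components_def by blast

text \<open>An affine root changing sign within a chamber would vanish there by connectedness. Hence
  the index set of the Dunkl sum is fixed on a chamber.\<close>

lemma neg_at_chamber:
  assumes y: "y \<in> chamber x" shows "neg_at y = neg_at x"
proof -
  have neg: "b x' < 0 \<Longrightarrow> b y' < 0" if b: "b \<in> aff_roots R" and xy: "x' \<in> chamber x" "y' \<in> chamber x" for b x' y'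
  proof (rule ccontr)
    assume lt: "b x' < 0" "\<not> b y' < 0"
    have "connected (b ` chamber x)"
      by (intro connected_continuous_image aff_root_continuous b connected_connected_component)
    from connected_contains_Icc[OF this, of "b x'" "b y'"] have "{b x'..b y'} \<subseteq> b ` chamber x"
      using xy by blast
    then have "0 \<in> b ` chamber x" using lt by (auto simp: not_less)
    then show False using b chamber_sub Vreg_iff by fastforce
  qed
  have x: "x \<in> chamber x" using y in_chamber
    by (metis connected_component_in mem_Collect_eq)
  show ?thesis unfolding neg_at_def using neg[OF _ x y] neg[OF _ y x] aff_pos_in_aff_roots by blast
qed

section \<open>Local tensors and the function space\<close>

text \<open>The tensor data stay visible because the directional derivative acts on them rather than
  on the values of f.\<close>

definition tensor_rep ::
  "'v set \<Rightarrow> ('v \<Rightarrow> 'm) \<Rightarrow> nat \<Rightarrow> (nat \<Rightarrow> 'v \<Rightarrow> complex) \<Rightarrow> (nat \<Rightarrow> 'm) \<Rightarrow> bool" where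
  "tensor_rep C f n \<phi> m \<longleftrightarrow> (\<forall>i<n. real_analytic (\<phi> i)) \<and> (\<forall>y\<in>C. f y = tensor n \<phi> m y)"

definition locally_tensor :: "'v set \<Rightarrow> ('v \<Rightarrow> 'm) \<Rightarrow> bool" where
  "locally_tensor C f \<longleftrightarrow> (\<exists>n \<phi> m. tensor_rep C f n \<phi> m)"

lemma Bsp_iff:
  "f \<in> Bsp \<longleftrightarrow> (\<forall>v. v \<notin> Vreg \<longrightarrow> f v = 0) \<and> (\<forall>x\<in>Vreg. locally_tensor (chamber x) f)"
proof -
  have "(\<exists>g\<in>analytic_tensor scaleM. \<forall>v\<in>C. f v = g v) \<longleftrightarrow> locally_tensor C f" for C
    unfolding analytic_tensor_def locally_tensor_def tensor_rep_def by blast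
  moreover have "(\<forall>C\<in>components Vreg. locally_tensor C f) \<longleftrightarrow> (\<forall>x\<in>Vreg. locally_tensor (chamber x) f)"
    unfolding components_def by blast
  ultimately show ?thesis unfolding B_space_def by simp
qed

lemma locally_tensor_0: "locally_tensor C (\<lambda>x. 0)"
  unfolding locally_tensor_def tensor_rep_def tensor_fun_def by (intro exI[of _ 0]) simp

lemma locally_tensor_add:
  assumes "locally_tensor C f" "locally_tensor C g" shows "locally_tensor C (\<lambda>x. f x + g x)"
proof -
  from assms obtain n \<phi> m n' \<phi>' m' where r: "tensor_rep C f n \<phi> m" "tensor_rep C g n' \<phi>' m'"
    unfolding locally_tensor_def by blast
  have "tensor_rep C (\<lambda>x. f x + g x) (n + n') (\<lambda>i. if i < n then \<phi> i else \<phi>' (i - n))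
      (\<lambda>i. if i < n then m i else m' (i - n))"
    unfolding tensor_rep_def
  proof (intro conjI allI ballI impI)
    fix i assume "i < n + n'"
    then show "real_analytic (if i < n then \<phi> i else \<phi>' (i - n))"
      using r unfolding tensor_rep_def by auto
  next
    fix y assume y: "y \<in> C"
    have "tensor (n + n') (\<lambda>i. if i < n then \<phi> i else \<phi>' (i - n)) (\<lambda>i. if i < n then m i else m' (i - n)) y
      = (\<Sum>i<n + n'. if i < n then scaleM (\<phi> i y) (m i) else scaleM (\<phi>' (i - n) y) (m' (i - n)))"
      unfolding tensor_fun_def by (intro sum.cong) auto
    also have "\<dots> = f y + g y"
      using r y sum_lessThan_add[where n=n and k=n' and f="\<lambda>i. scaleM (\<phi> i y) (m i)"
          and g="\<lambda>i. scaleM (\<phi>' i y) (m' i)"]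
      by (simp add: tensor_rep_def tensor_fun_def)
    finally show "f y + g y = tensor (n + n') (\<lambda>i. if i < n then \<phi> i else \<phi>' (i - n))
        (\<lambda>i. if i < n then m i else m' (i - n)) y" by simp
  qed
  then show ?thesis unfolding locally_tensor_def by blast
qed

lemma tensor_rep_scale: "tensor_rep C f n \<phi> m \<Longrightarrow> tensor_rep C (\<lambda>x. scaleM c (f x)) n \<phi> (\<lambda>i. scaleM c (m i))"
  unfolding tensor_rep_def tensor_fun_def by (simp add: M.scale_sum_right mult.commute)

lemma locally_tensor_scale: "locally_tensor C f \<Longrightarrow> locally_tensor C (\<lambda>x. scaleM c (f x))"
  unfolding locally_tensor_def using tensor_rep_scale by blast

lemma locally_tensor_sum:
  "(\<And>i. i \<in> I \<Longrightarrow> locally_tensor C (f i)) \<Longrightarrow> locally_tensor C (\<lambda>x. \<Sum>i\<in>I. f i x)"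
  by (induction I rule: infinite_finite_induct) (auto simp: locally_tensor_0 locally_tensor_add)

lemma locally_tensor_cong: "(\<And>y. y \<in> C \<Longrightarrow> f y = g y) \<Longrightarrow> locally_tensor C g \<Longrightarrow> locally_tensor C f"
  unfolding locally_tensor_def tensor_rep_def by (metis (full_types))

lemma Bsp_add: "f \<in> Bsp \<Longrightarrow> g \<in> Bsp \<Longrightarrow> (\<lambda>x. f x + g x) \<in> Bsp"
  unfolding Bsp_iff by (simp add: locally_tensor_add)

lemma Bsp_scale: "f \<in> Bsp \<Longrightarrow> (\<lambda>x. scaleM c (f x)) \<in> Bsp"
  unfolding Bsp_iff by (simp add: locally_tensor_scale)

lemma Bsp_0: "(\<lambda>x. 0) \<in> Bsp"
  unfolding Bsp_iff by (simp add: locally_tensor_0)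

lemma Bsp_rep:
  assumes "f \<in> Bsp" "x \<in> Vreg" obtains n \<phi> m where "tensor_rep (chamber x) f n \<phi> m"
  using assms unfolding Bsp_iff locally_tensor_def by blast

section \<open>The directional derivative of piecewise analytic functions\<close>

lemma functional_tensor:
  assumes "Vector_Spaces.linear scaleM (*) l"
  shows "l (tensor n \<phi> m x) = (\<Sum>i<n. \<phi> i x * l (m i))"
proof -
  interpret l: Vector_Spaces.linear scaleM "(*)" l by (rule assms)
  show ?thesis by (simp add: tensor_fun_def l.sum l.scale)
qed

text \<open>Well-definedness of the description operator in \<open>B_deriv\<close>. Openness of C
  supplies a short segment through x on which both tensors represent f.\<close>

lemma deriv_tensor_unique:
  assumes C: "open C" "x \<in> C" and r: "tensor_rep C f n \<phi> m" "tensor_rep C f n' \<phi>' m'"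
  shows "tensor n (\<lambda>i. dir_deriv v (\<phi> i)) m x = tensor n' (\<lambda>i. dir_deriv v (\<phi>' i)) m' x"
proof (rule ccontr)
  assume "\<not> ?thesis"
  \<comment> \<open>M carries no topology, so the derivatives are compared after applying a linear functional.\<close>
  then obtain l where l: "Vector_Spaces.linear scaleM (*) l"
    "l (tensor n (\<lambda>i. dir_deriv v (\<phi> i)) m x - tensor n' (\<lambda>i. dir_deriv v (\<phi>' i)) m' x) \<noteq> 0"
    using M.exists_separating_functional by (metis right_minus_eq)
  interpret l: Vector_Spaces.linear scaleM "(*)" l by (rule l(1))
  have der: "((\<lambda>t. l (tensor n \<phi> m (x + t *\<^sub>R v))) has_vector_derivative
      l (tensor n (\<lambda>i. dir_deriv v (\<phi> i)) m x)) (at 0)" if r: "tensor_rep C f n \<phi> m" for n \<phi> m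
  proof -
    have "((\<lambda>t. \<Sum>i<n. \<phi> i (x + t *\<^sub>R v) * l (m i)) has_vector_derivative
        (\<Sum>i<n. dir_deriv v (\<phi> i) x * l (m i))) (at 0)"
      by (intro has_vector_derivative_sum has_vector_derivative_mult_left real_analytic_has_dir_deriv)
         (use r in \<open>auto simp: tensor_rep_def\<close>)
    then show ?thesis by (simp add: functional_tensor[OF l(1)])
  qed
  obtain e where e: "e > 0" "ball x e \<subseteq> C" using C open_contains_ball by blast
  define d where "d = e / (norm v + 1)"
  have d: "d > 0" using e by (simp add: d_def add_nonneg_pos)
  have "l (tensor n \<phi> m (x + t *\<^sub>R v)) = l (tensor n' \<phi>' m' (x + t *\<^sub>R v))" if "dist t 0 < d" for t
  proof -
    have "norm (t *\<^sub>R v) \<le> \<bar>t\<bar> * (norm v + 1)" by (simp add: mult_left_mono)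
    also have "\<dots> < d * (norm v + 1)" using that by (intro mult_strict_right_mono) (auto intro: add_nonneg_pos)
    also have "\<dots> = e" by (simp add: d_def add_nonneg_pos pos_add_strict) (metis add_nonneg_pos less_numeral_extra(1) less_numeral_extra(3) norm_ge_zero)
    finally have "x + t *\<^sub>R v \<in> C" using e(2) by (auto simp: dist_norm)
    then show ?thesis using r unfolding tensor_rep_def by metis
  qed
  then have "((\<lambda>t. l (tensor n' \<phi>' m' (x + t *\<^sub>R v))) has_vector_derivative
      l (tensor n (\<lambda>i. dir_deriv v (\<phi> i)) m x)) (at 0)"
    using has_vector_derivative_transform_within[OF der[OF r(1)] d] by simp
  from vector_derivative_unique_at[OF this der[OF r(2)]] l(2) show False by (simp add: l.diff)
qed

text \<open>Any tensor for f on the chamber computes the derivative, so rules for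
  \<open>B_deriv\<close> reduce to rules for scalar analytic functions.\<close>

lemma B_deriv_eq:
  assumes x: "x \<in> Vreg" and r: "tensor_rep (chamber x) f n \<phi> m"
  shows "BD v f x = tensor n (\<lambda>i. dir_deriv v (\<phi> i)) m x"
proof -
  have "(THE d. \<exists>C\<in>components Vreg. \<exists>n \<phi> m. x \<in> C \<and> (\<forall>i<n. real_analytic (\<phi> i)) \<and>
           (\<forall>y\<in>C. f y = tensor n \<phi> m y) \<and> d = tensor n (\<lambda>i. dir_deriv v (\<phi> i)) m x)
      = tensor n (\<lambda>i. dir_deriv v (\<phi> i)) m x"
  proof (rule the_equality)
    show "\<exists>C\<in>components Vreg. \<exists>n' \<phi>' m'. x \<in> C \<and> (\<forall>i<n'. real_analytic (\<phi>' i)) \<and>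
           (\<forall>y\<in>C. f y = tensor n' \<phi>' m' y) \<and>
           tensor n (\<lambda>i. dir_deriv v (\<phi> i)) m x = tensor n' (\<lambda>i. dir_deriv v (\<phi>' i)) m' x"
      using r unfolding tensor_rep_def
      by (intro bexI[OF _ chamber_component[OF x]] exI[of _ n] exI[of _ \<phi>] exI[of _ m])
         (simp add: in_chamber[OF x, simplified])
  next
    fix d assume "\<exists>C\<in>components Vreg. \<exists>n \<phi> m. x \<in> C \<and> (\<forall>i<n. real_analytic (\<phi> i)) \<and>
           (\<forall>y\<in>C. f y = tensor n \<phi> m y) \<and> d = tensor n (\<lambda>i. dir_deriv v (\<phi> i)) m x"
    then obtain C n' \<phi>' m' where C: "C \<in> components Vreg" "x \<in> C" and r': "tensor_rep C f n' \<phi>' m'"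
      and d: "d = tensor n' (\<lambda>i. dir_deriv v (\<phi>' i)) m' x"
      unfolding tensor_rep_def by blast
    have "C = chamber x" using chamber_unique C by blast
    with r' show "d = tensor n (\<lambda>i. dir_deriv v (\<phi> i)) m x"
      unfolding d using deriv_tensor_unique[OF chamber_open in_chamber[OF x] _ r] by blast
  qed
  then show ?thesis unfolding B_deriv_def using x by simp
qed

lemma B_deriv_rep:
  assumes x: "x \<in> Vreg" and r: "tensor_rep (chamber x) f n \<phi> m"
  shows "tensor_rep (chamber x) (BD v f) n (\<lambda>i. dir_deriv v (\<phi> i)) m"
proof -
  have "BD v f y = tensor n (\<lambda>i. dir_deriv v (\<phi> i)) m y" if y: "y \<in> chamber x" for y
  proof (rule B_deriv_eq)
    show "y \<in> Vreg" using y chamber_sub by blast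
    show "tensor_rep (chamber y) f n \<phi> m" using r chamber_eq[OF y] by simp
  qed
  then show ?thesis using r real_analytic_dir_deriv unfolding tensor_rep_def by blast
qed

lemma B_deriv_Bsp: "f \<in> Bsp \<Longrightarrow> BD v f \<in> Bsp"
  unfolding Bsp_iff locally_tensor_def using B_deriv_rep by (auto simp: B_deriv_def) (metis B_deriv_rep)

text \<open>The image of a chamber under \<open>inv w\<close> is connected and regular, hence
  contained in a single chamber. The scalar factors are pulled back along an affine map while w acts
  on the factors in M.\<close>

lemma tensor_rep_act:
  assumes w: "w \<in> Wa" and r: "tensor_rep (chamber (inv w x)) f n \<phi> m" and x: "x \<in> Vreg"
  shows "tensor_rep (chamber x) (wact w f) n (\<lambda>i y. \<phi> i (inv w y)) (\<lambda>i. act w (m i))"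
proof -
  have iw: "inv w \<in> Wa" by (rule Wa_inv[OF w])
  have "continuous_on S (inv w)" for S
  proof -
    have "inv w v = inv w 0 + lin_part R X (inv w) v" for v
      using Wa_affine(2)[OF iw, of 0 v] by (simp only: add_0)
    then have eq: "inv w = (\<lambda>v. inv w 0 + lin_part R X (inv w) v)" by (rule ext)
    have "bounded_linear (lin_part R X (inv w))"
      using Wa_affine(1)[OF iw] by (simp only: linear_conv_bounded_linear)
    then show ?thesis
      by (subst eq) (intro continuous_on_add continuous_on_const linear_continuous_on)
  qed
  then have "connected (inv w ` chamber x)" by (intro connected_continuous_image connected_connected_component)
  then have sub: "inv w ` chamber x \<subseteq> chamber (inv w x)"
    using x Wa_Vreg[OF iw] chamber_sub in_chamber[OF x] by (intro connected_component_maximal) auto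
  have "wact w f y = tensor n (\<lambda>i y. \<phi> i (inv w y)) (\<lambda>i. act w (m i)) y" if "y \<in> chamber x" for y
  proof -
    have "inv w y \<in> chamber (inv w x)" using sub that by blast
    then have "f (inv w y) = tensor n \<phi> m (inv w y)" using r unfolding tensor_rep_def by blast
    then show ?thesis by (simp add: fun_act_def tensor_fun_def act_sum[OF w] act_scale[OF w])
  qed
  moreover have "real_analytic (\<lambda>y. \<phi> i (inv w y))" if "i < n" for i
    using r that unfolding tensor_rep_def
    by (intro real_analytic_affine[OF _ Wa_affine(1)[OF iw] Wa_affine(2)[OF iw]]) auto
  ultimately show ?thesis unfolding tensor_rep_def by blast
qed

lemma wact_Bsp:
  assumes "w \<in> Wa" "f \<in> Bsp" shows "wact w f \<in> Bsp"
  unfolding Bsp_iff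
proof (intro conjI allI impI ballI)
  fix v assume v: "v \<notin> Vreg"
  have "inv w v \<notin> Vreg" using v Wa_Vreg[OF assms(1), of "inv w v"] inv_Wa(2)[OF assms(1)] by auto
  then show "wact w f v = 0" using assms unfolding Bsp_iff by (simp add: fun_act_def act_0)
next
  fix x assume x: "x \<in> Vreg"
  obtain n \<phi> m where "tensor_rep (chamber (inv w x)) f n \<phi> m"
    by (rule Bsp_rep[OF assms(2) Wa_Vreg[OF Wa_inv[OF assms(1)] x]])
  from tensor_rep_act[OF assms(1) this x] show "locally_tensor (chamber x) (wact w f)"
    unfolding locally_tensor_def by blast
qed

lemma B_deriv_wact:
  assumes w: "w \<in> Wa" and f: "f \<in> Bsp" and x: "x \<in> Vreg"
  shows "BD (lin_part R X w v) (wact w f) x = act w (BD v f (inv w x))"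
proof -
  have ix: "inv w x \<in> Vreg" by (rule Wa_Vreg[OF Wa_inv[OF w] x])
  obtain n \<phi> m where r: "tensor_rep (chamber (inv w x)) f n \<phi> m" by (rule Bsp_rep[OF f ix])
  have "inv w (x + t *\<^sub>R lin_part R X w v) = inv w x + t *\<^sub>R v" for t
  proof -
    have "w (inv w x + t *\<^sub>R v) = x + t *\<^sub>R lin_part R X w v"
      by (simp add: Wa_affine(2)[OF w] inv_Wa(2)[OF w] linear_scale[OF Wa_affine(1)[OF w]])
    then show ?thesis by (metis inv_Wa(1)[OF w])
  qed
  then have "dir_deriv (lin_part R X w v) (\<lambda>y. \<phi> i (inv w y)) x = dir_deriv v (\<phi> i) (inv w x)" for i
    by (simp add: dir_deriv_def)
  then show ?thesis
    by (simp add: B_deriv_eq[OF x tensor_rep_act[OF w r x]] B_deriv_eq[OF ix r] tensor_fun_def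
        act_sum[OF w] act_scale[OF w])
qed

lemma B_deriv_add:
  assumes f: "f \<in> Bsp" and g: "g \<in> Bsp" and x: "x \<in> Vreg"
  shows "BD v (\<lambda>y. f y + g y) x = BD v f x + BD v g x"
proof -
  obtain n \<phi> m where r: "tensor_rep (chamber x) f n \<phi> m" by (rule Bsp_rep[OF f x])
  obtain n' \<phi>' m' where r': "tensor_rep (chamber x) g n' \<phi>' m'" by (rule Bsp_rep[OF g x])
  let ?\<phi> = "\<lambda>i. if i < n then \<phi> i else \<phi>' (i - n)" and ?m = "\<lambda>i. if i < n then m i else m' (i - n)"
  have t: "tensor (n + n') (\<lambda>i. if i < n then \<psi> i else \<psi>' (i - n)) ?m y = tensor n \<psi> m y + tensor n' \<psi>' m' y" for \<psi> \<psi>' y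
    unfolding tensor_fun_def sum_lessThan_add[symmetric] by (intro sum.cong) auto
  have "tensor_rep (chamber x) (\<lambda>y. f y + g y) (n + n') ?\<phi> ?m"
    using r r' unfolding tensor_rep_def by (auto simp: t)
  from B_deriv_eq[OF x this, of v]
  have "BD v (\<lambda>y. f y + g y) x = tensor (n + n') (\<lambda>i. if i < n then dir_deriv v (\<phi> i) else dir_deriv v (\<phi>' (i - n))) ?m x"
    by (simp add: if_distrib[of "dir_deriv v"])
  then show ?thesis
    using t[of "\<lambda>i. dir_deriv v (\<phi> i)" "\<lambda>i. dir_deriv v (\<phi>' i)" x] B_deriv_eq[OF x r] B_deriv_eq[OF x r'] by simp
qed

lemma B_deriv_scale:
  assumes f: "f \<in> Bsp" and x: "x \<in> Vreg"
  shows "BD v (\<lambda>y. scaleM c (f y)) x = scaleM c (BD v f x)"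
proof -
  obtain n \<phi> m where r: "tensor_rep (chamber x) f n \<phi> m" by (rule Bsp_rep[OF f x])
  show ?thesis
    by (simp add: B_deriv_eq[OF x r] B_deriv_eq[OF x tensor_rep_scale[OF r]] tensor_fun_def
       M.scale_sum_right mult.commute)
qed

lemma B_deriv_linear:
  assumes f: "f \<in> Bsp" and x: "x \<in> Vreg"
  shows "BD (r *\<^sub>R v + u) f x = scaleM (of_real r) (BD v f x) + BD u f x"
proof -
  obtain n \<phi> m where r: "tensor_rep (chamber x) f n \<phi> m" by (rule Bsp_rep[OF f x])
  then have "dir_deriv (r *\<^sub>R v + u) (\<phi> i) x = of_real r * dir_deriv v (\<phi> i) x + dir_deriv u (\<phi> i) x" if "i < n" for i
    using that dir_deriv_linear unfolding tensor_rep_def by blast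
  then show ?thesis
    by (simp add: B_deriv_eq[OF x r] tensor_fun_def M.scale_sum_right M.scale_left_distrib sum.distrib)
qed

lemma B_deriv_commute:
  assumes f: "f \<in> Bsp" and x: "x \<in> Vreg"
  shows "BD v (BD u f) x = BD u (BD v f) x"
proof -
  obtain n \<phi> m where r: "tensor_rep (chamber x) f n \<phi> m" by (rule Bsp_rep[OF f x])
  then have "dir_deriv v (dir_deriv u (\<phi> i)) x = dir_deriv u (dir_deriv v (\<phi> i)) x" if "i < n" for i
    using that dir_deriv_commute unfolding tensor_rep_def by blast
  then show ?thesis
    by (simp add: B_deriv_eq[OF x B_deriv_rep[OF x r]] tensor_fun_def)
qed

text \<open>Needed where a Dunkl operator agrees with a directional derivative on one chamber
  only.\<close>

lemma B_deriv_cong: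
  assumes x: "x \<in> Vreg" and g: "g \<in> Bsp" and eq: "\<And>y. y \<in> chamber x \<Longrightarrow> f y = g y"
  shows "BD v f x = BD v g x"
proof -
  obtain n \<phi> m where r: "tensor_rep (chamber x) g n \<phi> m" by (rule Bsp_rep[OF g x])
  then have "tensor_rep (chamber x) f n \<phi> m" using eq unfolding tensor_rep_def by simp
  with r show ?thesis using B_deriv_eq[OF x] by simp
qed

section \<open>Dunkl operators and their conjugation by the group\<close>

text \<open>A term of the Dunkl sum without its indicator, so that it also applies to the negative
  root -a produced by a reflection.\<close>

definition jump :: "'v \<Rightarrow> ('v \<Rightarrow> 'm) \<Rightarrow> 'v \<Rightarrow> ('v \<Rightarrow> real) \<Rightarrow> 'm" where
  "jump v f x a = scaleM (k a * of_real (blinfun_apply (grad a) v)) (wact (aff_refl a) f x)"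

lemma Du_eq: "x \<in> Vreg \<Longrightarrow> Du v f x = BD v f x - (\<Sum>a\<in>neg_at x. jump v f x a)"
proof -
  assume x: "x \<in> Vreg"
  have "{a \<in> P. neg_ind a x \<noteq> 0} = neg_at x" by (auto simp: neg_at_def neg_ind_def)
  moreover have "(\<Sum>a\<in>neg_at x. scaleM (k a * of_real (blinfun_apply (grad a) v) * neg_ind a x) (wact (aff_refl a) f x))
      = (\<Sum>a\<in>neg_at x. jump v f x a)"
    by (intro sum.cong) (auto simp: jump_def neg_at_def neg_ind_def)
  ultimately show ?thesis using x by (simp add: dunkl_def)
qed

lemma Du_outside: "x \<notin> Vreg \<Longrightarrow> Du v f x = 0"
  by (simp add: dunkl_def)

lemma neg_at_aff_roots: "a \<in> neg_at x \<Longrightarrow> a \<in> aff_roots R"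
  by (simp add: neg_at_def aff_pos_in_aff_roots)

lemma Du_Bsp:
  assumes f: "f \<in> Bsp" shows "Du v f \<in> Bsp"
  unfolding Bsp_iff
proof (intro conjI allI impI ballI Du_outside)
  fix x assume x: "x \<in> Vreg"
  have eq: "Du v f y = BD v f y + scaleM (-1) (\<Sum>a\<in>neg_at x. jump v f y a)" if "y \<in> chamber x" for y
    using Du_eq[of y v f] that chamber_sub neg_at_chamber[OF that] by auto
  show "locally_tensor (chamber x) (Du v f)"
  proof (rule locally_tensor_cong[OF eq])
    have "locally_tensor (chamber x) (\<lambda>y. jump v f y a)" if "a \<in> neg_at x" for a
      unfolding jump_def
      using wact_Bsp[OF aff_refl_Wa(1)[OF neg_at_aff_roots[OF that]] f] x
      by (intro locally_tensor_scale) (auto simp: Bsp_iff)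
    then show "locally_tensor (chamber x) (\<lambda>y. BD v f y + scaleM (-1) (\<Sum>a\<in>neg_at x. jump v f y a))"
      using B_deriv_Bsp[OF f, of v] x
      by (intro locally_tensor_add locally_tensor_scale locally_tensor_sum) (auto simp: Bsp_iff)
  qed
qed

lemma wact_add: "w \<in> Wa \<Longrightarrow> wact w (\<lambda>y. f y + g y) = (\<lambda>y. wact w f y + wact w g y)"
  by (simp add: fun_act_def act_add)

lemma wact_scale: "w \<in> Wa \<Longrightarrow> wact w (\<lambda>y. scaleM c (f y)) = (\<lambda>y. scaleM c (wact w f y))"
  by (simp add: fun_act_def act_scale)

lemma wact_comp: "w \<in> Wa \<Longrightarrow> w' \<in> Wa \<Longrightarrow> wact (w \<circ> w') f = wact w (wact w' f)"
  by (auto simp: fun_act_def M.act_comp o_inv_distrib[OF Wa_bij Wa_bij])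

lemma wact_id: "wact id f = f"
  using M.act_id by (simp add: fun_act_def inv_id)

lemma Du_add:
  assumes f: "f \<in> Bsp" and g: "g \<in> Bsp"
  shows "Du v (\<lambda>y. f y + g y) = (\<lambda>y. Du v f y + Du v g y)"
proof
  fix x show "Du v (\<lambda>y. f y + g y) x = Du v f x + Du v g x"
  proof (cases "x \<in> Vreg")
    case True
    have "jump v (\<lambda>y. f y + g y) x a = jump v f x a + jump v g x a" if "a \<in> neg_at x" for a
      unfolding jump_def wact_add[OF aff_refl_Wa(1)[OF neg_at_aff_roots[OF that]]]
      by (rule M.scale_right_distrib)
    then show ?thesis by (simp add: Du_eq[OF True] B_deriv_add[OF f g True] sum.distrib)
  qed (simp add: Du_outside)
qed

lemma Du_scale:
  assumes f: "f \<in> Bsp"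
  shows "Du v (\<lambda>y. scaleM c (f y)) = (\<lambda>y. scaleM c (Du v f y))"
proof
  fix x show "Du v (\<lambda>y. scaleM c (f y)) x = scaleM c (Du v f x)"
  proof (cases "x \<in> Vreg")
    case True
    have "jump v (\<lambda>y. scaleM c (f y)) x a = scaleM c (jump v f x a)" if "a \<in> neg_at x" for a
      unfolding jump_def wact_scale[OF aff_refl_Wa(1)[OF neg_at_aff_roots[OF that]]]
      by (rule M.scale_left_commute)
    then show ?thesis by (simp add: Du_eq[OF True] B_deriv_scale[OF f True] M.scale_right_diff_distrib M.scale_sum_right)
  qed (simp add: Du_outside)
qed

lemma Du_linear:
  assumes f: "f \<in> Bsp"
  shows "Du (r *\<^sub>R v + u) f = (\<lambda>y. scaleM (of_real r) (Du v f y) + Du u f y)"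
proof
  fix x show "Du (r *\<^sub>R v + u) f x = scaleM (of_real r) (Du v f x) + Du u f x"
  proof (cases "x \<in> Vreg")
    case True
    have "jump (r *\<^sub>R v + u) f x a = scaleM (of_real r) (jump v f x a) + jump u f x a" for a
      unfolding jump_def M.scale_scale M.scale_left_distrib[symmetric]
      by (simp add: blinfun.add_right blinfun.scaleR_right algebra_simps)
    then show ?thesis
      by (simp add: Du_eq[OF True] B_deriv_linear[OF f True] M.scale_right_diff_distrib M.scale_sum_right sum.distrib)
  qed (simp add: Du_outside)
qed

text \<open>Derivative, multiplicities, gradients and reflections are all equivariant; only the
  indicators are not. Conjugation therefore merely transports the index set, and each relation
  becomes a comparison of the transported set with \<open>neg_at x\<close>.\<close>

lemma wact_Du:
  assumes w: "w \<in> Wa" and f: "f \<in> Bsp" and x: "x \<in> Vreg"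
  shows "wact w (Du v f) x = BD (lin_part R X w v) (wact w f) x
    - (\<Sum>b\<in>(\<lambda>b. b \<circ> inv w) ` neg_at (inv w x). jump (lin_part R X w v) (wact w f) x b)"
proof -
  have ix: "inv w x \<in> Vreg" by (rule Wa_Vreg[OF Wa_inv[OF w] x])
  have iw: "inv w \<in> Wa" by (rule Wa_inv[OF w])
  have wb: "b \<circ> inv w \<circ> w = b" for b :: "'v \<Rightarrow> real" using inv_Wa(1)[OF w] by auto
  have inj: "inj_on (\<lambda>b. b \<circ> inv w) (neg_at (inv w x))"
    by (rule inj_onI) (metis wb)
  have j: "jump (lin_part R X w v) (wact w f) x (a \<circ> inv w) = act w (jump v f (inv w x) a)"
    if a: "a \<in> neg_at (inv w x)" for a
  proof -
    have ar: "a \<in> aff_roots R" by (rule neg_at_aff_roots[OF a])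
    have awr: "a \<circ> inv w \<in> aff_roots R" by (rule aff_roots_comp(1)[OF ar iw])
    have g: "blinfun_apply (grad (a \<circ> inv w)) (lin_part R X w v) = blinfun_apply (grad a) v"
      using aff_roots_comp(2)[OF awr w, of v] unfolding wb by simp
    have c: "aff_refl (a \<circ> inv w) \<circ> w = w \<circ> aff_refl a" using aff_refl_conj[OF ar w] by auto
    have "wact (aff_refl (a \<circ> inv w)) (wact w f) x = wact w (wact (aff_refl a) f) x"
      using wact_comp[OF aff_refl_Wa(1)[OF awr] w] wact_comp[OF w aff_refl_Wa(1)[OF ar]] unfolding c by metis
    then show ?thesis
      unfolding jump_def g k_inv[OF w ar] by (simp add: act_scale[OF w]) (simp add: fun_act_def)
  qed
  have "wact w (Du v f) x = act w (BD v f (inv w x)) - (\<Sum>a\<in>neg_at (inv w x). act w (jump v f (inv w x) a))"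
    unfolding fun_act_def Du_eq[OF ix] using act_add[OF w, of _ "- _"] 
    by (simp add: act_uminus[OF w] act_sum[OF w] diff_conv_add_uminus del: add_uminus_conv_diff)
  then show ?thesis
    by (simp add: sum.reindex[OF inj] j B_deriv_wact[OF w f x])
qed

lemma wact_outside: "w \<in> Wa \<Longrightarrow> f \<in> Bsp \<Longrightarrow> x \<notin> Vreg \<Longrightarrow> wact w f x = 0"
  using wact_Bsp Bsp_iff by blast

lemma stab_Du:
  assumes w: "w \<in> alcove_stab" and f: "f \<in> Bsp"
  shows "wact w (Du v f) = Du (lin_part R X w v) (wact w f)"
proof
  fix x
  have wW: "w \<in> Wa" using w unfolding alcove_stab_def by blast
  show "wact w (Du v f) x = Du (lin_part R X w v) (wact w f) x"
    by (cases "x \<in> Vreg")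
       (simp_all add: wact_Du[OF wW f] neg_at_stab[OF w] Du_eq Du_outside wact_outside[OF wW Du_Bsp[OF f]])
qed

text \<open>The index sets differ only in a or in -a, and the reflections cancel in the
  corresponding term, leaving a multiple of f. Removing the term of a and adding that of -a give the
  same scalar, because the gradient changes sign.\<close>

lemma refl_Du:
  assumes a: "a \<in> Fa" and f: "f \<in> Bsp"
  shows "wact (aff_refl a) (Du v f) = (\<lambda>x. Du (root_refl (grad a) v) (wact (aff_refl a) f) x
    + scaleM (- (k a * of_real (blinfun_apply (grad a) v))) (f x))"
proof
  fix x
  let ?s = "aff_refl a" and ?v = "root_refl (grad a) v"
  let ?c = "k a * of_real (blinfun_apply (grad a) v)"
  have ar: "a \<in> aff_roots R" by (rule simple_in_aff_roots[OF a])
  have sW: "?s \<in> Wa" by (rule aff_refl_Wa(1)[OF ar])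
  have ssf: "wact ?s (wact ?s f) = f"
  proof -
    have "?s \<circ> ?s = id" using aff_refl_aff_refl[OF ar] by auto
    then show ?thesis using wact_comp[OF sW sW, of f] wact_id by simp
  qed
  show "wact ?s (Du v f) x = Du ?v (wact ?s f) x + scaleM (- ?c) (f x)"
  proof (cases "x \<in> Vreg")
    case True
    have gself: "blinfun_apply (grad a) ?v = - blinfun_apply (grad a) v"
      using covec_self[OF R_nonzero[OF grad_R[OF ar]]]
      by (simp add: root_refl_def blinfun.diff_right blinfun.scaleR_right)
    have ja: "jump ?v (wact ?s f) x a = scaleM (- ?c) (f x)"
      by (simp add: jump_def gself ssf)
    have na: "a \<circ> inv ?s = (\<lambda>v. - a v)" using aff_refl_self[OF ar] by (auto simp: inv_aff_refl[OF ar])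
    have nar: "(\<lambda>v. - a v) \<in> aff_roots R" using aff_roots_comp(1)[OF ar sW] na inv_aff_refl[OF ar] by simp
    have gn: "grad (\<lambda>v. - a v) = - grad a"
      using ar by (elim aff_rootsE) (simp add: aff_fun_uminus grad_aff_fun)
    have sn: "aff_refl (\<lambda>v. - a v) = ?s" by (simp add: aff_refl_def[abs_def] gn covec_uminus)
    \<comment> \<open>The root -a is the image of a under its own reflection, so invariance gives
      equal multiplicities.\<close>
    have kn: "k (\<lambda>v. - a v) = k a" using k_inv[OF sW ar] na by simp
    have jn: "jump ?v (wact ?s f) x (\<lambda>v. - a v) = scaleM ?c (f x)"
      by (simp add: jump_def gself ssf sn kn gn blinfun.minus_left)
    have "wact ?s (Du v f) x = BD ?v (wact ?s f) x
      - (\<Sum>b\<in>(if a x < 0 then neg_at x - {a} else insert (\<lambda>v. - a v) (neg_at x)). jump ?v (wact ?s f) x b)"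
      using wact_Du[OF sW f True, of v] neg_at_refl[OF a True]
      by (simp only: inv_aff_refl[OF ar] aff_refl_Wa(2)[OF ar])
    also have "(\<Sum>b\<in>(if a x < 0 then neg_at x - {a} else insert (\<lambda>v. - a v) (neg_at x)). jump ?v (wact ?s f) x b)
      = (\<Sum>b\<in>neg_at x. jump ?v (wact ?s f) x b) + scaleM ?c (f x)"
    proof (cases "a x < 0")
      case True
      then have "a \<in> neg_at x" using simple_pos[OF a] by (simp add: neg_at_def)
      from sum.remove[OF finite_neg_at this, of "jump ?v (wact ?s f) x"] True show ?thesis by (simp add: ja)
    next
      case False
      have "(\<lambda>v. - a v) \<notin> neg_at x" using pos_or_neg[OF ar] simple_pos[OF a] by (simp add: neg_at_def)
      then show ?thesis using False by (simp add: finite_neg_at jn add.commute)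
    qed
    finally show ?thesis by (simp add: Du_eq[OF True])
  next
    case False
    then show ?thesis using f by (simp add: Du_outside wact_outside[OF sW Du_Bsp[OF f]] Bsp_iff)
  qed
qed

section \<open>Commutativity of the Dunkl operators\<close>

lemma Du_add_scale:
  assumes "f \<in> Bsp" "g \<in> Bsp"
  shows "Du v (\<lambda>y. f y + scaleM c (g y)) = (\<lambda>y. Du v f y + scaleM c (Du v g y))"
  using Du_add[OF assms(1) Bsp_scale[OF assms(2)]] Du_scale[OF assms(2)] by simp

text \<open>The cross relation applied to the outer and then to the inner operator leaves two
  first-order terms; whether they are symmetric in u and v decides how the commutator is
  transported.\<close>

lemma wact_refl_Du_Du:
  assumes a: "a \<in> Fa" and f: "f \<in> Bsp"
  shows "wact (aff_refl a) (Du v (Du u f)) x = Du (root_refl (grad a) v) (Du (root_refl (grad a) u) (wact (aff_refl a) f)) x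
    + scaleM (- (k a * of_real (blinfun_apply (grad a) u))) (Du (root_refl (grad a) v) f x)
    + scaleM (- (k a * of_real (blinfun_apply (grad a) v))) (Du u f x)"
proof -
  have sf: "wact (aff_refl a) f \<in> Bsp" by (rule wact_Bsp[OF aff_refl_Wa(1)[OF simple_in_aff_roots[OF a]] f])
  show ?thesis
    unfolding refl_Du[OF a Du_Bsp[OF f]] refl_Du[OF a f] Du_add_scale[OF Du_Bsp[OF sf] f] ..
qed

lemma Du_refl_vec:
  assumes "f \<in> Bsp"
  shows "Du (root_refl \<alpha> v) f x = scaleM (of_real (- blinfun_apply \<alpha> v)) (Du (covec \<alpha>) f x) + Du v f x"
proof -
  have "root_refl \<alpha> v = (- blinfun_apply \<alpha> v) *\<^sub>R covec \<alpha> + v" by (simp add: root_refl_def)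
  then show ?thesis by (simp only: Du_linear[OF assms])
qed

lemma Du_commute_at:
  assumes "x \<in> Vreg"
  shows "\<forall>v u. \<forall>f\<in>Bsp. Du v (Du u f) x = Du u (Du v f) x"
  using assms
proof (induction rule: Vreg_induct)
  case (dominant x)
  \<comment> \<open>The equality is needed on the whole chamber, not merely at x, because an outer
    derivative is applied to it.\<close>
  have d: "Du v g y = BD v g y" if "y \<in> chamber x" for v g y
    using Du_eq[of y] that chamber_sub neg_at_chamber[OF that] dominant(2) by auto
  have "Du v (Du u f) x = BD v (BD u f) x" if f: "f \<in> Bsp" for v u f
    using d[OF in_chamber[OF dominant(1)]] B_deriv_cong[OF dominant(1) B_deriv_Bsp[OF f] d] by simp
  then show ?case using B_deriv_commute dominant(1) by simp
next
  case (refl a x)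
  let ?s = "aff_refl a" and ?r = "root_refl (grad a)"
  have ar: "a \<in> aff_roots R" by (rule simple_in_aff_roots[OF refl(1)])
  have sW: "?s \<in> Wa" by (rule aff_refl_Wa(1)[OF ar])
  show ?case
  proof (intro allI ballI)
    fix v u f assume f: "f \<in> Bsp"
    \<comment> \<open>The induction hypothesis lives at the reflected point; it is applied to the
      reflected function and directions, so that reflecting back returns f, v and u.\<close>
    define g where "g = wact ?s f"
    have g: "g \<in> Bsp" unfolding g_def by (rule wact_Bsp[OF sW f])
    have sg: "wact ?s g = f"
    proof -
      have "?s \<circ> ?s = id" using aff_refl_aff_refl[OF ar] by auto
      then show ?thesis unfolding g_def using wact_comp[OF sW sW, of f] wact_id by simp
    qed
    have rr: "?r (?r z) = z" for z by (rule root_refl_root_refl[OF R_nonzero[OF grad_R[OF ar]]])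
    let ?e = "\<lambda>v u. scaleM (- (k a * of_real (blinfun_apply (grad a) (?r u)))) (Du v g x)
      + scaleM (- (k a * of_real (blinfun_apply (grad a) (?r v)))) (Du (?r u) g x)"
    have "Du (?r v) (Du (?r u) g) (?s x) = Du (?r u) (Du (?r v) g) (?s x)"
      using refl.IH g by blast
    then have "wact ?s (Du (?r v) (Du (?r u) g)) x = wact ?s (Du (?r u) (Du (?r v) g)) x"
      by (simp add: fun_act_def inv_aff_refl[OF ar])
    then have e: "Du v (Du u f) x + ?e v u = Du u (Du v f) x + ?e u v"
      unfolding wact_refl_Du_Du[OF refl(1) g] rr sg by (simp only: add.assoc)
    have "blinfun_apply (grad a) (?r z) = - blinfun_apply (grad a) z" for z
      using covec_self[OF R_nonzero[OF grad_R[OF ar]]]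
      by (simp add: root_refl_def blinfun.diff_right blinfun.scaleR_right)
    \<comment> \<open>Write \<alpha> for the gradient and E for D at its coroot. Substituting D(ru)
      = D(u) - \<alpha>(u) E turns the correction into k times \<alpha>(u) D(v) + \<alpha>(v) D(u) -
      \<alpha>(u) \<alpha>(v) E, applied to g, which is symmetric.\<close>
    then have "?e v u = ?e u v"
      by (simp add: Du_refl_vec[OF g] M.scale_right_distrib M.scale_right_diff_distrib algebra_simps)
    with e show "Du v (Du u f) x = Du u (Du v f) x" by (simp only: add_right_cancel)
  qed
qed

lemma Du_commute:
  assumes f: "f \<in> Bsp" shows "Du v (Du u f) = Du u (Du v f)"
proof
  fix x show "Du v (Du u f) x = Du u (Du v f) x"
    using Du_commute_at[of x] f by (cases "x \<in> Vreg") (auto simp: Du_outside)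
qed

end

section \<open>Representations of the algebra A(k)\<close>

lemma poly_mapping_sum_single:
  fixes p :: "'n \<Rightarrow>\<^sub>0 'c::comm_monoid_add"
  shows "p = (\<Sum>n\<in>Poly_Mapping.keys p. Poly_Mapping.single n (Poly_Mapping.lookup p n))"
  by (rule poly_mapping_eqI)
     (simp add: lookup_sum lookup_single when_def in_keys_iff)

lemma poly_mapping_additive_induct [case_names zero single add]:
  fixes p :: "'n \<Rightarrow>\<^sub>0 'c::comm_monoid_add"
  assumes "Q 0" "\<And>n c. Q (Poly_Mapping.single n c)" "\<And>p q. Q p \<Longrightarrow> Q q \<Longrightarrow> Q (p + q)"
  shows "Q p"
proof -
  have "Q (\<Sum>n\<in>A. Poly_Mapping.single n (Poly_Mapping.lookup p n))" if "finite A" for A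
    using that by (induction A) (auto intro: assms)
  from this[OF finite_keys[of p]] show ?thesis
    by (simp only: poly_mapping_sum_single[of p, symmetric])
qed

lemma sym_vec_Rep_coord: "sym_vec (Rep_coord b, 0) = Poly_Mapping.single (Poly_Mapping.single b 1) 1"
proof -
  have "Complex (Rep_coord b \<bullet> Rep_coord b') (0 \<bullet> Rep_coord b') = (if b' = b then 1 else 0)" for b'
    using Rep_coord[of b] Rep_coord[of b'] Rep_coord_inject[of b b']
    by (auto simp: inner_Basis complex_eq_iff)
  then have "sym_vec (Rep_coord b, 0)
      = (\<Sum>b'\<in>UNIV. if b' = b then Poly_Mapping.single (Poly_Mapping.single b 1) 1 else 0)"
    unfolding sym_vec_def by (intro sum.cong) auto
  then show ?thesis by simp
qed

text \<open>For a monomial the auxiliary claim is that multiplication by it preserves Q on all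
  polynomials; in this form it passes to products. Constants and sums then give every
  polynomial.\<close>

lemma sym_alg_induct [case_names const add vec]:
  fixes p :: "'v::euclidean_space sym_alg"
  assumes const: "\<And>c. Q (sym_const c)" and add: "\<And>p q. Q p \<Longrightarrow> Q q \<Longrightarrow> Q (p + q)"
    and vec: "\<And>z p. Q p \<Longrightarrow> Q (sym_vec z * p)"
  shows "Q p"
proof -
  have mono: "\<forall>p. Q p \<longrightarrow> Q (Poly_Mapping.single n 1 * p)" for n :: "'v coord \<Rightarrow>\<^sub>0 nat"
  proof (induction n rule: poly_mapping_additive_induct)
    case (single b j)
    show ?case
    proof (induction j)
      case (Suc j)
      have e: "Poly_Mapping.single (Poly_Mapping.single b (Suc j)) 1
          = sym_vec (Rep_coord b, 0) * Poly_Mapping.single (Poly_Mapping.single b j) (1 :: complex)"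
        unfolding sym_vec_Rep_coord mult_single single_add[symmetric] by simp
      show ?case using Suc vec unfolding e by (simp add: mult.assoc)
    qed simp
  next
    case (add n m)
    have "Poly_Mapping.single (n + m) 1 = Poly_Mapping.single n 1 * Poly_Mapping.single m (1 :: complex)"
      by (simp add: mult_single)
    then show ?case using add by (simp add: mult.assoc)
  qed simp
  have s: "Poly_Mapping.single n c = Poly_Mapping.single n 1 * sym_const c"
    for n :: "'v coord \<Rightarrow>\<^sub>0 nat" and c by (simp add: sym_const_def mult_single)
  show ?thesis
  proof (induction p rule: poly_mapping_additive_induct)
    case zero
    show ?case using const[of 0] by (simp add: sym_const_def)
  next
    case (single n c)
    have "Q (Poly_Mapping.single n 1 * sym_const c)" using mono const by blast
    then show ?case by (simp only: s[of n c])
  qed (rule add)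
qed

lemma sym_vec_complex: "sym_vec z = sym_vec (fst z, 0) + sym_const \<i> * sym_vec (snd z, 0)"
proof -
  have c: "Complex x y = Complex x 0 + \<i> * Complex y 0" for x y by (simp add: complex_eq_iff)
  have sc: "Poly_Mapping.single n (Complex x y)
      = Poly_Mapping.single n (Complex x 0) + sym_const \<i> * Poly_Mapping.single n (Complex y 0)"
    for n :: "'a coord \<Rightarrow>\<^sub>0 nat" and x y
    unfolding sym_const_def mult_single single_add[symmetric] add_0 c[of x y, symmetric] ..
  show ?thesis
    unfolding sym_vec_def sum_distrib_left sum.distrib[symmetric] fst_conv snd_conv inner_zero_left
    by (intro sum.cong refl sc)
qed

lemma group_alg_mult_group_elt: "group_alg_mult (group_elt g) (group_elt h) = group_elt (g \<circ> h)"
  by (simp add: group_alg_mult_def group_elt_def)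

lemma group_elt_group_alg: "g \<in> G \<Longrightarrow> group_elt g \<in> group_alg G"
  by (simp add: group_alg_def group_elt_def)

text \<open>Separates the algebra from the function space. The operators are controlled only on the
  subspace B, and one relation with data L and c replaces the separate ones for reflections and
  length-zero elements: \<open>T_D\<close> is the operator form of \<open>G_vec\<close>. Generation
  by G is phrased as an induction principle.\<close>

locale A_representation = A_algebra R X F \<theta> k scale iS iW + F: vector_space scaleF
  for R X F :: "'v::euclidean_space dual set"
    and \<theta> :: "'v dual"
    and k :: "('v \<Rightarrow> real) \<Rightarrow> complex"
    and scale :: "complex \<Rightarrow> 'a::ring_1 \<Rightarrow> 'a"
    and iS :: "'v sym_alg \<Rightarrow> 'a"
    and iW :: "(('v \<Rightarrow> 'v) \<Rightarrow>\<^sub>0 complex) \<Rightarrow> 'a"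
    and scaleF :: "complex \<Rightarrow> 'f::ab_group_add \<Rightarrow> 'f" +
  fixes B :: "'f set"
    and D :: "'v \<Rightarrow> 'f \<Rightarrow> 'f"
    and T :: "('v \<Rightarrow> 'v) \<Rightarrow> 'f \<Rightarrow> 'f"
    and G :: "('v \<Rightarrow> 'v) set"
    and L :: "('v \<Rightarrow> 'v) \<Rightarrow> 'v \<Rightarrow> 'v"
    and c :: "('v \<Rightarrow> 'v) \<Rightarrow> 'v \<Rightarrow> complex"
  assumes B_subspace: "F.subspace B"
    and D_B: "f \<in> B \<Longrightarrow> D v f \<in> B"
    and D_add: "f \<in> B \<Longrightarrow> f' \<in> B \<Longrightarrow> D v (f + f') = D v f + D v f'"
    and D_scale: "f \<in> B \<Longrightarrow> D v (scaleF t f) = scaleF t (D v f)"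
    and D_linear: "f \<in> B \<Longrightarrow> D (r *\<^sub>R v + u) f = scaleF (of_real r) (D v f) + D u f"
    and D_commute: "f \<in> B \<Longrightarrow> D v (D u f) = D u (D v f)"
    and T_B: "w \<in> aff_weyl R X \<Longrightarrow> f \<in> B \<Longrightarrow> T w f \<in> B"
    and T_add: "w \<in> aff_weyl R X \<Longrightarrow> f \<in> B \<Longrightarrow> f' \<in> B \<Longrightarrow> T w (f + f') = T w f + T w f'"
    and T_scale: "w \<in> aff_weyl R X \<Longrightarrow> f \<in> B \<Longrightarrow> T w (scaleF t f) = scaleF t (T w f)"
    and T_id: "f \<in> B \<Longrightarrow> T id f = f"
    and T_comp: "w \<in> aff_weyl R X \<Longrightarrow> w' \<in> aff_weyl R X \<Longrightarrow> f \<in> B \<Longrightarrow> T (w \<circ> w') f = T w (T w' f)"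
    and id_aff_weyl: "id \<in> aff_weyl R X"
    and comp_aff_weyl: "w \<in> aff_weyl R X \<Longrightarrow> w' \<in> aff_weyl R X \<Longrightarrow> w \<circ> w' \<in> aff_weyl R X"
    and G_aff_weyl: "g \<in> G \<Longrightarrow> g \<in> aff_weyl R X"
    and aff_weyl_generated: "\<lbrakk>\<forall>g\<in>G. Q g; \<forall>g\<in>G. \<forall>w\<in>aff_weyl R X. Q w \<longrightarrow> Q (g \<circ> w)\<rbrakk>
        \<Longrightarrow> \<forall>w\<in>aff_weyl R X. Q w"
    and G_vec: "g \<in> G \<Longrightarrow> iW (group_elt g) * iS (sym_vec z)
        = iS (sym_vec (cvec_map (L g) z)) * iW (group_elt g)
          + scale (c g (fst z) + \<i> * c g (snd z)) 1"
    and T_D: "g \<in> G \<Longrightarrow> f \<in> B \<Longrightarrow> T g (D v f) = D (L g v) (T g f) + scaleF (c g v) f"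
begin

lemma B_add: "f \<in> B \<Longrightarrow> g \<in> B \<Longrightarrow> f + g \<in> B"
  and B_scale: "f \<in> B \<Longrightarrow> scaleF t f \<in> B"
  and B_0: "0 \<in> B"
  using B_subspace by (auto simp: F.subspace_def)

lemma B_sum: "(\<And>i. i \<in> I \<Longrightarrow> f i \<in> B) \<Longrightarrow> (\<Sum>i\<in>I. f i) \<in> B"
  by (rule F.subspace_sum[OF B_subspace])

section \<open>The symmetric algebra acting through commuting operators\<close>

definition linear_op :: "('f \<Rightarrow> 'f) \<Rightarrow> bool" where
  "linear_op S \<longleftrightarrow> (\<forall>f\<in>B. S f \<in> B) \<and> (\<forall>f\<in>B. \<forall>g\<in>B. S (f + g) = S f + S g) \<and>
     (\<forall>f\<in>B. \<forall>t. S (scaleF t f) = scaleF t (S f))"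

lemma linear_opD:
  assumes "linear_op S"
  shows "f \<in> B \<Longrightarrow> S f \<in> B" "f \<in> B \<Longrightarrow> g \<in> B \<Longrightarrow> S (f + g) = S f + S g"
    "f \<in> B \<Longrightarrow> S (scaleF t f) = scaleF t (S f)"
  using assms unfolding linear_op_def by auto

lemma linear_op_0: "linear_op S \<Longrightarrow> S 0 = 0"
  using linear_opD(3)[of S 0 0] B_0 by simp

lemma linear_op_D: "linear_op (D v)"
  unfolding linear_op_def by (simp add: D_B D_add D_scale)

lemma linear_op_T: "w \<in> aff_weyl R X \<Longrightarrow> linear_op (T w)"
  unfolding linear_op_def by (simp add: T_B T_add T_scale)

lemma linear_op_comp: "linear_op S \<Longrightarrow> linear_op S' \<Longrightarrow> linear_op (\<lambda>f. S (S' f))"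
  unfolding linear_op_def by simp

lemma linear_op_funpow: "linear_op S \<Longrightarrow> linear_op (S ^^ j)"
proof (induction j)
  case 0
  show ?case by (simp add: linear_op_def)
next
  case (Suc j)
  then show ?case using linear_op_comp[of S "S ^^ j"] by (simp add: o_def)
qed

lemma linear_op_lincomb:
  assumes "\<And>i. i \<in> I \<Longrightarrow> linear_op (S i)"
  shows "linear_op (\<lambda>f. \<Sum>i\<in>I. scaleF (t i) (S i f))"
  unfolding linear_op_def
proof (intro conjI ballI allI)
  fix f g r assume f: "f \<in> B"
  show "(\<Sum>i\<in>I. scaleF (t i) (S i f)) \<in> B"
    by (intro B_sum B_scale linear_opD(1)[OF assms] f)
  show "(\<Sum>i\<in>I. scaleF (t i) (S i (scaleF r f))) = scaleF r (\<Sum>i\<in>I. scaleF (t i) (S i f))"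
    using linear_opD(3)[OF assms f] by (simp add: F.scale_sum_right mult.commute)
  assume g: "g \<in> B"
  show "(\<Sum>i\<in>I. scaleF (t i) (S i (f + g))) = (\<Sum>i\<in>I. scaleF (t i) (S i f)) + (\<Sum>i\<in>I. scaleF (t i) (S i g))"
    using linear_opD(2)[OF assms f g] by (simp add: F.scale_right_distrib sum.distrib)
qed

primrec mon_list :: "'v coord list \<Rightarrow> ('v coord \<Rightarrow>\<^sub>0 nat) \<Rightarrow> 'f \<Rightarrow> 'f" where
  "mon_list [] n f = f"
| "mon_list (b # bs) n f = (D (Rep_coord b) ^^ Poly_Mapping.lookup n b) (mon_list bs n f)"

lemma linear_op_mon_list: "linear_op (mon_list bs n)"
proof (induction bs)
  case Nil
  show ?case by (simp add: linear_op_def)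
next
  case (Cons b bs)
  then show ?case using linear_op_comp[OF linear_op_funpow[OF linear_op_D] Cons] by simp
qed

lemma mon_list_0: "mon_list bs 0 f = f"
  by (induction bs) auto

lemma funpow_commute_on:
  assumes "linear_op S" "linear_op S'" "\<And>f. f \<in> B \<Longrightarrow> S (S' f) = S' (S f)" "f \<in> B"
  shows "S ((S' ^^ j) f) = (S' ^^ j) (S f)"
proof (induction j)
  case (Suc j)
  have "(S' ^^ j) f \<in> B" by (rule linear_opD(1)[OF linear_op_funpow[OF assms(2)] assms(4)])
  then show ?case using Suc assms(3) by simp
qed simp

lemma mon_list_commute:
  assumes "linear_op S" "\<And>v f. f \<in> B \<Longrightarrow> S (D v f) = D v (S f)" "f \<in> B"
  shows "S (mon_list bs n f) = mon_list bs n (S f)"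
proof (induction bs)
  case (Cons b bs)
  have m: "mon_list bs n f \<in> B" by (rule linear_opD(1)[OF linear_op_mon_list assms(3)])
  have "S ((D (Rep_coord b) ^^ j) (mon_list bs n f)) = (D (Rep_coord b) ^^ j) (S (mon_list bs n f))" for j
    by (rule funpow_commute_on[OF assms(1) linear_op_D _ m]) (rule assms(2))
  then show ?case by (simp only: mon_list.simps Cons)
qed simp

text \<open>Collecting the powers of one coordinate moves a power of D past a monomial operator;
  here the commutativity of the operators D enters.\<close>

lemma mon_list_add:
  assumes "f \<in> B"
  shows "mon_list bs (n + m) f = mon_list bs n (mon_list bs m f)"
proof (induction bs)
  case (Cons b bs)
  let ?d = "D (Rep_coord b)"
  have m: "mon_list bs m f \<in> B" by (rule linear_opD(1)[OF linear_op_mon_list assms])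
  have dc: "(?d ^^ j) (D v g) = D v ((?d ^^ j) g)" if "g \<in> B" for v g j
    by (rule funpow_commute_on[OF linear_op_D linear_op_D _ that, symmetric]) (rule D_commute)
  have c: "(?d ^^ j) (mon_list bs n g) = mon_list bs n ((?d ^^ j) g)" if "g \<in> B" for g j
    by (rule mon_list_commute[OF linear_op_funpow[OF linear_op_D] _ that]) (rule dc)
  show ?case unfolding mon_list.simps lookup_add funpow_add o_apply Cons c[OF m] ..
qed simp

lemma mon_list_single: 
  "distinct bs \<Longrightarrow> mon_list bs (Poly_Mapping.single b 1) f = (if b \<in> set bs then D (Rep_coord b) f else f)"
  by (induction bs) (auto simp: lookup_single when_def)

definition coord_list :: "'v coord list" where
  "coord_list = (SOME bs. set bs = UNIV \<and> distinct bs)"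

lemma coord_list: "set coord_list = UNIV" "distinct coord_list"
  using someI_ex[OF finite_distinct_list[of "UNIV :: 'v coord set"]] unfolding coord_list_def by auto

text \<open>The evaluation of a polynomial at the commuting coordinate operators.\<close>

definition \<sigma> :: "'v sym_alg \<Rightarrow> 'f \<Rightarrow> 'f" where
  "\<sigma> p f = (\<Sum>n\<in>Poly_Mapping.keys p. scaleF (Poly_Mapping.lookup p n) (mon_list coord_list n f))"

lemma linear_op_\<sigma>: "linear_op (\<sigma> p)"
  unfolding \<sigma>_def[abs_def] by (rule linear_op_lincomb[OF linear_op_mon_list])

lemma \<sigma>_B: "f \<in> B \<Longrightarrow> \<sigma> p f \<in> B"
  by (rule linear_opD(1)[OF linear_op_\<sigma>])

lemma \<sigma>_0: "\<sigma> 0 f = 0"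
  by (simp add: \<sigma>_def)

lemma \<sigma>_add: "\<sigma> (p + q) f = \<sigma> p f + \<sigma> q f"
  unfolding \<sigma>_def by (rule setsum_keys_plus_distrib) (auto simp: F.scale_left_distrib)

lemma \<sigma>_single: "\<sigma> (Poly_Mapping.single n t) f = scaleF t (mon_list coord_list n f)"
  by (simp add: \<sigma>_def)

lemma \<sigma>_const: "\<sigma> (sym_const t) f = scaleF t f"
  by (simp add: sym_const_def \<sigma>_single mon_list_0)

lemma \<sigma>_mult: 
  assumes f: "f \<in> B" shows "\<sigma> (p * q) f = \<sigma> p (\<sigma> q f)"
proof (induction p rule: poly_mapping_additive_induct)
  case (single n t)
  show ?case
  proof (induction q rule: poly_mapping_additive_induct)
    case (single m s)
    have "mon_list coord_list m f \<in> B" by (rule linear_opD(1)[OF linear_op_mon_list f])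
    then show ?case
      by (simp add: mult_single \<sigma>_single mon_list_add[OF f] linear_opD(3)[OF linear_op_mon_list])
  next
    case (add p q)
    then show ?case by (simp add: distrib_left \<sigma>_add linear_opD(2)[OF linear_op_\<sigma>] \<sigma>_B[OF f])
  qed (simp add: \<sigma>_0 linear_op_0[OF linear_op_\<sigma>])
next
  case (add p p')
  then show ?case by (simp add: distrib_right \<sigma>_add)
qed (simp add: \<sigma>_0)

lemma D_sum:
  assumes f: "f \<in> B" and "finite I"
  shows "D (\<Sum>i\<in>I. r i *\<^sub>R v i) f = (\<Sum>i\<in>I. scaleF (of_real (r i)) (D (v i) f))"
  using assms(2)
proof (induction I)
  case empty
  have "D 0 f = D 0 f + D 0 f" using D_linear[OF f, of 1 0 0] by simp
  then show ?case by simp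
qed (simp add: D_linear[OF f])

definition Dc :: "'v cvec \<Rightarrow> 'f \<Rightarrow> 'f" where
  "Dc z f = D (fst z) f + scaleF \<i> (D (snd z) f)"

lemma \<sigma>_vec:
  assumes f: "f \<in> B" shows "\<sigma> (sym_vec z) f = Dc z f"
proof -
  have rep: "x = (\<Sum>b\<in>UNIV. (x \<bullet> Rep_coord b) *\<^sub>R Rep_coord b)" for x :: 'v
  proof -
    have "bij_betw Rep_coord (UNIV :: 'v coord set) Basis"
      by (metis bij_betw_imageI inj_on_def Rep_coord_inject type_definition.Rep_range[OF type_definition_coord])
    from sum.reindex_bij_betw[OF this, of "\<lambda>b. (x \<bullet> b) *\<^sub>R b"] show ?thesis
      by (simp add: euclidean_representation)
  qed
  have Dx: "D x f = (\<Sum>b\<in>UNIV. scaleF (of_real (x \<bullet> Rep_coord b)) (D (Rep_coord b) f))" for x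
    using D_sum[OF f, of UNIV "\<lambda>b. x \<bullet> Rep_coord b" Rep_coord] rep[of x] by simp
  have s: "\<sigma> (\<Sum>b\<in>I. p b) f = (\<Sum>b\<in>I. \<sigma> (p b) f)" for I and p :: "'v coord \<Rightarrow> 'v sym_alg"
    by (induction I rule: infinite_finite_induct) (auto simp: \<sigma>_0 \<sigma>_add)
  have "\<sigma> (sym_vec z) f = (\<Sum>b\<in>UNIV. scaleF (Complex (fst z \<bullet> Rep_coord b) (snd z \<bullet> Rep_coord b)) (D (Rep_coord b) f))"
    unfolding sym_vec_def s \<sigma>_single by (simp add: mon_list_single[unfolded One_nat_def] coord_list)
  also have "\<dots> = (\<Sum>b\<in>UNIV. scaleF (of_real (fst z \<bullet> Rep_coord b)) (D (Rep_coord b) f)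
      + scaleF \<i> (scaleF (of_real (snd z \<bullet> Rep_coord b)) (D (Rep_coord b) f)))"
    by (intro sum.cong refl) (simp add: Complex_eq F.scale_left_distrib)
  also have "\<dots> = Dc z f"
    by (simp add: Dc_def Dx[of "fst z"] Dx[of "snd z"] sum.distrib F.scale_sum_right)
  finally show ?thesis .
qed

section \<open>The action transported along the multiplication isomorphism\<close>

lemma iS_0: "iS 0 = 0"
  using iS_add[of 0 0] by simp

lemma iS_const: "iS (sym_const t) = scale t 1"
  using iS_scale[of t 1] by (simp add: iS_one)

lemma iW_comp:
  "g \<in> aff_weyl R X \<Longrightarrow> h \<in> aff_weyl R X \<Longrightarrow> iW (group_elt (g \<circ> h)) = iW (group_elt g) * iW (group_elt h)"
  using iW_mult[OF group_elt_group_alg group_elt_group_alg, of g h] by (simp add: group_alg_mult_group_elt)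

definition \<Phi> :: "(('v \<Rightarrow> 'v) \<Rightarrow>\<^sub>0 'v sym_alg) \<Rightarrow> 'a" where
  "\<Phi> p = (\<Sum>w\<in>Poly_Mapping.keys p. iS (Poly_Mapping.lookup p w) * iW (group_elt w))"

definition carrier_\<Phi> :: "(('v \<Rightarrow> 'v) \<Rightarrow>\<^sub>0 'v sym_alg) set" where
  "carrier_\<Phi> = {p. Poly_Mapping.keys p \<subseteq> aff_weyl R X}"

lemma \<Phi>_bij: "bij_betw \<Phi> carrier_\<Phi> UNIV"
  using mult_iso unfolding \<Phi>_def[abs_def] carrier_\<Phi>_def .

lemma \<Phi>_add: "\<Phi> (p + q) = \<Phi> p + \<Phi> q"
  unfolding \<Phi>_def by (rule setsum_keys_plus_distrib) (auto simp: iS_0 iS_add distrib_right)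

lemma \<Phi>_single: "\<Phi> (Poly_Mapping.single w q) = iS q * iW (group_elt w)"
  by (simp add: \<Phi>_def iS_0)

lemma carrier_\<Phi>_add: "p \<in> carrier_\<Phi> \<Longrightarrow> q \<in> carrier_\<Phi> \<Longrightarrow> p + q \<in> carrier_\<Phi>"
  unfolding carrier_\<Phi>_def using keys_add[of p q] by blast

lemma carrier_\<Phi>_single: "w \<in> aff_weyl R X \<Longrightarrow> Poly_Mapping.single w q \<in> carrier_\<Phi>"
  unfolding carrier_\<Phi>_def by simp

text \<open>The unique expression of x as a sum of products q w acts by applying T w and then
  \<sigma> q. Additivity comes with the construction; multiplicativity does not.\<close>

definition \<pi> :: "'a \<Rightarrow> 'f \<Rightarrow> 'f" where
  "\<pi> x f = (let p = inv_into carrier_\<Phi> \<Phi> x in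
     \<Sum>w\<in>Poly_Mapping.keys p. \<sigma> (Poly_Mapping.lookup p w) (T w f))"

lemma \<pi>_\<Phi>: "p \<in> carrier_\<Phi> \<Longrightarrow> \<pi> (\<Phi> p) f = (\<Sum>w\<in>Poly_Mapping.keys p. \<sigma> (Poly_Mapping.lookup p w) (T w f))"
  using bij_betw_inv_into_left[OF \<Phi>_bij, of p] by (simp add: \<pi>_def)

lemma \<Phi>_cases: obtains p where "p \<in> carrier_\<Phi>" "x = \<Phi> p"
  using \<Phi>_bij unfolding bij_betw_def by blast

lemma \<pi>_add: "\<pi> (x + y) f = \<pi> x f + \<pi> y f"
proof -
  obtain p where p: "p \<in> carrier_\<Phi>" "x = \<Phi> p" by (rule \<Phi>_cases)
  obtain q where q: "q \<in> carrier_\<Phi>" "y = \<Phi> q" by (rule \<Phi>_cases)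
  show ?thesis
    unfolding p(2) q(2) \<Phi>_add[symmetric] \<pi>_\<Phi>[OF p(1)] \<pi>_\<Phi>[OF q(1)] \<pi>_\<Phi>[OF carrier_\<Phi>_add[OF p(1) q(1)]]
    by (rule setsum_keys_plus_distrib) (auto simp: \<sigma>_0 \<sigma>_add)
qed

lemma \<pi>_basic: "w \<in> aff_weyl R X \<Longrightarrow> \<pi> (iS q * iW (group_elt w)) f = \<sigma> q (T w f)"
  using \<pi>_\<Phi>[OF carrier_\<Phi>_single, of w q f] by (simp add: \<Phi>_single \<sigma>_0)

lemma \<pi>_iS: "f \<in> B \<Longrightarrow> \<pi> (iS q) f = \<sigma> q f"
  using \<pi>_basic[OF id_aff_weyl, of q f] by (simp add: iW_one T_id)

lemma \<pi>_iW: "w \<in> aff_weyl R X \<Longrightarrow> \<pi> (iW (group_elt w)) f = T w f"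
  using \<pi>_basic[of w 1 f] \<sigma>_const[of 1 "T w f"] by (simp add: iS_one sym_const_def)

lemma A_induct [case_names basic add]:
  assumes basic: "\<And>q w. w \<in> aff_weyl R X \<Longrightarrow> Q (iS q * iW (group_elt w))"
    and add: "\<And>x y. Q x \<Longrightarrow> Q y \<Longrightarrow> Q (x + y)"
  shows "Q x"
proof -
  have Q0: "Q 0" using basic[OF id_aff_weyl, of 0] by (simp add: iS_0)
  obtain p where p: "p \<in> carrier_\<Phi>" "x = \<Phi> p" by (rule \<Phi>_cases)
  have "Q (\<Sum>w\<in>I. iS (Poly_Mapping.lookup p w) * iW (group_elt w))" if "finite I" "I \<subseteq> aff_weyl R X" for I
    using that by (induction I) (auto intro: Q0 basic add)
  then show ?thesis using p by (simp add: \<Phi>_def carrier_\<Phi>_def)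
qed

lemma linear_op_\<pi>: "linear_op (\<pi> x)"
proof (induction x rule: A_induct)
  case (basic q w)
  then show ?case using linear_op_comp[OF linear_op_\<sigma> linear_op_T] by (simp add: linear_op_def \<pi>_basic)
next
  case (add x y)
  then show ?case unfolding linear_op_def by (simp add: \<pi>_add B_add F.scale_right_distrib add_ac)
qed

lemma \<pi>_B: "f \<in> B \<Longrightarrow> \<pi> x f \<in> B"
  by (rule linear_opD(1)[OF linear_op_\<pi>])

lemma \<pi>_scale: assumes "f \<in> B" shows "\<pi> (scale t x) f = scaleF t (\<pi> x f)"
proof (induction x rule: A_induct)
  case (basic q w)
  have "scale t (iS q * iW (group_elt w)) = iS (sym_const t * q) * iW (group_elt w)"
    by (simp add: iS_scale scale_mult_left)
  then show ?case using basic assms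
    by (simp add: \<pi>_basic \<sigma>_mult[OF T_B] \<sigma>_const)
next
  case (add x y)
  then show ?case by (simp add: scale_right_distrib \<pi>_add F.scale_right_distrib)
qed

text \<open>The algebra and the operators are rewritten in parallel with the same witnesses. Mere
  existence of q1 and q2 is enough, so no closed formula of divided differences is computed.\<close>

lemma G_poly:
  assumes g: "g \<in> G"
  shows "\<exists>q1 q2. iW (group_elt g) * iS q = iS q1 * iW (group_elt g) + iS q2 \<and>
    (\<forall>f\<in>B. T g (\<sigma> q f) = \<sigma> q1 (T g f) + \<sigma> q2 f)"
proof (induction q rule: sym_alg_induct)
  case (const t)
  have "iW (group_elt g) * iS (sym_const t) = iS (sym_const t) * iW (group_elt g) + iS 0"
    by (simp add: iS_const iS_0 scale_mult_left scale_mult_right)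
  moreover have "T g (\<sigma> (sym_const t) f) = \<sigma> (sym_const t) (T g f) + \<sigma> 0 f" if "f \<in> B" for f
    using that by (simp add: \<sigma>_const \<sigma>_0 T_scale[OF G_aff_weyl[OF g]])
  ultimately show ?case by blast
next
  case (add p q)
  then obtain p1 p2 q1 q2 where
    p: "iW (group_elt g) * iS p = iS p1 * iW (group_elt g) + iS p2"
       "\<And>f. f \<in> B \<Longrightarrow> T g (\<sigma> p f) = \<sigma> p1 (T g f) + \<sigma> p2 f" and
    q: "iW (group_elt g) * iS q = iS q1 * iW (group_elt g) + iS q2"
       "\<And>f. f \<in> B \<Longrightarrow> T g (\<sigma> q f) = \<sigma> q1 (T g f) + \<sigma> q2 f"
    by blast
  have "iW (group_elt g) * iS (p + q) = iS (p1 + q1) * iW (group_elt g) + iS (p2 + q2)"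
    by (simp add: iS_add distrib_left distrib_right p q)
  moreover have "T g (\<sigma> (p + q) f) = \<sigma> (p1 + q1) (T g f) + \<sigma> (p2 + q2) f" if "f \<in> B" for f
    using that by (simp add: \<sigma>_add T_add[OF G_aff_weyl[OF g]] \<sigma>_B p q)
  ultimately show ?case by blast
next
  case (vec z p)
  then obtain p1 p2 where
    p: "iW (group_elt g) * iS p = iS p1 * iW (group_elt g) + iS p2"
       "\<And>f. f \<in> B \<Longrightarrow> T g (\<sigma> p f) = \<sigma> p1 (T g f) + \<sigma> p2 f"
    by blast
  let ?z = "cvec_map (L g) z" and ?t = "c g (fst z) + \<i> * c g (snd z)"
  have gW: "g \<in> aff_weyl R X" by (rule G_aff_weyl[OF g])
  have "iW (group_elt g) * iS (sym_vec z * p) = (iW (group_elt g) * iS (sym_vec z)) * iS p"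
    by (simp add: iS_mult mult.assoc)
  also have "\<dots> = iS (sym_vec ?z) * (iW (group_elt g) * iS p) + scale ?t 1 * iS p"
    unfolding G_vec[OF g] by (simp add: distrib_right mult.assoc)
  also have "\<dots> = iS (sym_vec ?z * p1) * iW (group_elt g) + iS (sym_vec ?z * p2 + sym_const ?t * p)"
    unfolding p by (simp add: iS_mult iS_add iS_const distrib_left mult.assoc)
  finally have A: "iW (group_elt g) * iS (sym_vec z * p)
      = iS (sym_vec ?z * p1) * iW (group_elt g) + iS (sym_vec ?z * p2 + sym_const ?t * p)" .
  have TD: "T g (Dc z f) = Dc ?z (T g f) + scaleF ?t f" if "f \<in> B" for f
    using that by (simp add: Dc_def cvec_map_def T_add[OF gW] T_scale[OF gW] T_D[OF g] D_B B_scale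
        F.scale_right_distrib F.scale_left_distrib)
  have "T g (\<sigma> (sym_vec z * p) f) = \<sigma> (sym_vec ?z * p1) (T g f) + \<sigma> (sym_vec ?z * p2 + sym_const ?t * p) f"
    if f: "f \<in> B" for f
  proof -
    have Tf: "T g f \<in> B" by (rule T_B[OF gW f])
    have "T g (\<sigma> (sym_vec z * p) f) = Dc ?z (T g (\<sigma> p f)) + scaleF ?t (\<sigma> p f)"
      by (simp add: \<sigma>_mult[OF f] \<sigma>_vec[OF \<sigma>_B[OF f]] TD[OF \<sigma>_B[OF f]])
    also have "Dc ?z (T g (\<sigma> p f)) = \<sigma> (sym_vec ?z) (\<sigma> p1 (T g f) + \<sigma> p2 f)"
      using p(2)[OF f] \<sigma>_vec B_add \<sigma>_B Tf f by simp
    also have "\<dots> = \<sigma> (sym_vec ?z) (\<sigma> p1 (T g f)) + \<sigma> (sym_vec ?z) (\<sigma> p2 f)"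
      by (rule linear_opD(2)[OF linear_op_\<sigma> \<sigma>_B[OF Tf] \<sigma>_B[OF f]])
    finally show ?thesis by (simp add: \<sigma>_add \<sigma>_mult[OF f] \<sigma>_mult[OF Tf] \<sigma>_const)
  qed
  with A show ?case by blast
qed

section \<open>Multiplicativity and uniqueness\<close>

text \<open>Fixing the left factor and leaving the right one arbitrary makes the property closed
  under sums and, by associativity, under products.\<close>

definition mult_ok :: "'a \<Rightarrow> bool" where
  "mult_ok x \<longleftrightarrow> (\<forall>y. \<forall>f\<in>B. \<pi> (x * y) f = \<pi> x (\<pi> y f))"

lemma mult_ok_mult: "mult_ok x \<Longrightarrow> mult_ok y \<Longrightarrow> mult_ok (x * y)"
  unfolding mult_ok_def by (simp add: mult.assoc \<pi>_B)

lemma mult_ok_add: "mult_ok x \<Longrightarrow> mult_ok y \<Longrightarrow> mult_ok (x + y)"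
  unfolding mult_ok_def by (simp add: distrib_right \<pi>_add)

lemma mult_ok_iS: "mult_ok (iS q)"
  unfolding mult_ok_def
proof (intro allI ballI)
  fix y f assume f: "f \<in> B"
  show "\<pi> (iS q * y) f = \<pi> (iS q) (\<pi> y f)"
  proof (induction y rule: A_induct)
    case (basic p w)
    have "iS q * (iS p * iW (group_elt w)) = iS (q * p) * iW (group_elt w)"
      by (simp add: iS_mult mult.assoc)
    then show ?case using basic f by (simp add: \<pi>_basic \<pi>_iS \<sigma>_mult T_B \<sigma>_B)
  next
    case (add x y)
    then show ?case by (simp add: distrib_left \<pi>_add linear_opD(2)[OF linear_op_\<pi>] \<pi>_B f)
  qed
qed

lemma mult_ok_G: assumes g: "g \<in> G" shows "mult_ok (iW (group_elt g))"
  unfolding mult_ok_def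
proof (intro allI ballI)
  fix y f assume f: "f \<in> B"
  have gW: "g \<in> aff_weyl R X" by (rule G_aff_weyl[OF g])
  show "\<pi> (iW (group_elt g) * y) f = \<pi> (iW (group_elt g)) (\<pi> y f)"
  proof (induction y rule: A_induct)
    case (basic p w)
    obtain p1 p2 where
      p: "iW (group_elt g) * iS p = iS p1 * iW (group_elt g) + iS p2"
         "\<And>f. f \<in> B \<Longrightarrow> T g (\<sigma> p f) = \<sigma> p1 (T g f) + \<sigma> p2 f"
      using G_poly[OF g] by blast
    have "iW (group_elt g) * (iS p * iW (group_elt w)) = (iW (group_elt g) * iS p) * iW (group_elt w)"
      by (simp add: mult.assoc)
    also have "\<dots> = iS p1 * iW (group_elt (g \<circ> w)) + iS p2 * iW (group_elt w)"
      unfolding p iW_comp[OF gW basic] by (simp add: distrib_right mult.assoc)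
    finally show ?case
      using basic f gW
      by (simp add: \<pi>_add \<pi>_basic comp_aff_weyl \<pi>_iW p(2) T_B T_comp)
  next
    case (add x y)
    then show ?case by (simp add: distrib_left \<pi>_add linear_opD(2)[OF linear_op_\<pi>] \<pi>_B f)
  qed
qed

lemma mult_ok_all: "mult_ok x"
proof -
  have "\<forall>w\<in>aff_weyl R X. mult_ok (iW (group_elt w))"
    by (rule aff_weyl_generated)
       (use mult_ok_G mult_ok_mult iW_comp[OF G_aff_weyl] in auto)
  then show ?thesis
    by (induction x rule: A_induct) (auto intro: mult_ok_mult mult_ok_iS mult_ok_add)
qed

lemma \<pi>_mult: "f \<in> B \<Longrightarrow> \<pi> (x * y) f = \<pi> x (\<pi> y f)"
  using mult_ok_all unfolding mult_ok_def by blast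

lemma \<pi>_one: "f \<in> B \<Longrightarrow> \<pi> 1 f = f"
  using \<pi>_iW[OF id_aff_weyl, of f] by (simp add: iW_one T_id)

lemma \<pi>_vec: "f \<in> B \<Longrightarrow> \<pi> (iS (sym_vec (v, 0))) f = D v f"
  using D_sum[of f "{}"] by (simp add: \<pi>_iS \<sigma>_vec Dc_def)

text \<open>Vectors and constants determine a homomorphism on polynomials, multiplicativity then on
  products q w, and additivity on all sums of these.\<close>

lemma \<pi>_unique:
  assumes one: "\<And>f. f \<in> B \<Longrightarrow> \<rho> 1 f = f"
    and add: "\<And>x y f. f \<in> B \<Longrightarrow> \<rho> (x + y) f = \<rho> x f + \<rho> y f"
    and scl: "\<And>t x f. f \<in> B \<Longrightarrow> \<rho> (scale t x) f = scaleF t (\<rho> x f)"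
    and mlt: "\<And>x y f. f \<in> B \<Longrightarrow> \<rho> (x * y) f = \<rho> x (\<rho> y f)"
    and vec: "\<And>v f. f \<in> B \<Longrightarrow> \<rho> (iS (sym_vec (v, 0))) f = D v f"
    and grp: "\<And>w f. w \<in> aff_weyl R X \<Longrightarrow> f \<in> B \<Longrightarrow> \<rho> (iW (group_elt w)) f = T w f"
    and f: "f \<in> B"
  shows "\<rho> x f = \<pi> x f"
proof (induction x rule: A_induct)
  case (basic q w)
  have "\<rho> (iS q) g = \<sigma> q g" if g: "g \<in> B" for g
  proof (induction q rule: sym_alg_induct)
    case (const t)
    show ?case by (simp add: iS_const scl[OF g] one[OF g] \<sigma>_const)
  next
    case (add p q)
    then show ?case by (simp add: iS_add \<sigma>_add assms(2)[OF g])
  next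
    case (vec z p)
    have "\<rho> (iS (sym_vec z)) h = Dc z h" if h: "h \<in> B" for h
      by (subst sym_vec_complex)
         (simp add: iS_add iS_scale assms(2)[OF h] scl[OF h] assms(5)[OF h] Dc_def)
    then show ?case using vec by (simp add: iS_mult mlt[OF g] \<sigma>_mult[OF g] \<sigma>_B[OF g] \<sigma>_vec)
  qed
  then show ?case using basic f by (simp add: mlt[OF f] grp \<pi>_basic T_B)
next
  case (add x y)
  then show ?case by (simp add: assms(2)[OF f] \<pi>_add)
qed

end

section \<open>The representation on piecewise analytic functions\<close>

theorem theorem4p5:
  fixes R X F :: "'v::euclidean_space dual set"
    and \<theta> :: "'v dual"
    and k :: "('v \<Rightarrow> real) \<Rightarrow> complex"
    and scaleM :: "complex \<Rightarrow> 'm::ab_group_add \<Rightarrow> 'm"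
    and act :: "('v \<Rightarrow> 'v) \<Rightarrow> 'm \<Rightarrow> 'm"
    and scaleA :: "complex \<Rightarrow> 'a::ring_1 \<Rightarrow> 'a"
    and iS :: "'v sym_alg \<Rightarrow> 'a"
    and iW :: "(('v \<Rightarrow> 'v) \<Rightarrow>\<^sub>0 complex) \<Rightarrow> 'a"
  assumes "affine_root_datum R X F \<theta>"
    and "multiplicity_function R X k"
    and "aff_weyl_module R X scaleM act"
    and "A_algebra R X F \<theta> k scaleA iS iW"
  shows "\<exists>!\<pi>. algebra_hom_to_End scaleA scaleM (B_space R F scaleM) \<pi> \<and>
     (\<forall>v. \<forall>f\<in>B_space R F scaleM. \<pi> (iS (sym_vec (v, 0))) f = dunkl R F k scaleM act v f) \<and>
     (\<forall>w\<in>aff_weyl R X. \<forall>f\<in>B_space R F scaleM. \<pi> (iW (group_elt w)) f = fun_act act w f)"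
proof -
  interpret dunkl_datum R X F \<theta> scaleM act k
    using assms(1-3) by (simp add: dunkl_datum_def dunkl_datum_axioms_def)
  interpret A: A_algebra R X F \<theta> k scaleA iS iW by (rule assms(4))
  define scaleF :: "complex \<Rightarrow> ('v \<Rightarrow> 'm) \<Rightarrow> ('v \<Rightarrow> 'm)" where "scaleF t f = (\<lambda>v. scaleM t (f v))" for t f
  define S where "S = aff_refl ` Fa"
  \<comment> \<open>The map g determines its simple root, but only the existence of one is used.\<close>
  define c where "c g v = (if g \<in> alcove_stab then 0
     else - (k (SOME a. a \<in> Fa \<and> g = aff_refl a) * of_real (blinfun_apply (grad (SOME a. a \<in> Fa \<and> g = aff_refl a)) v)))" for g v
  \<comment> \<open>An element of both kinds would fall under the first branch of c, hence the
    second premise.\<close>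
  have refl: "\<exists>a\<in>Fa. g = aff_refl a \<and> lin_part R X g = root_refl (grad a) \<and>
      (\<forall>v. c g v = - (k a * of_real (blinfun_apply (grad a) v)))" if "g \<in> S" "g \<notin> alcove_stab" for g
  proof -
    define a where "a = (SOME a. a \<in> Fa \<and> g = aff_refl a)"
    have "a \<in> Fa \<and> g = aff_refl a" unfolding a_def
      by (rule someI_ex[of "\<lambda>a. a \<in> Fa \<and> g = aff_refl a"]) (use that(1) in \<open>auto simp: S_def\<close>)
    moreover from this have "lin_part R X g = root_refl (grad a)"
      using aff_refl_Wa(2)[OF simple_in_aff_roots] by blast
    moreover have "c g v = - (k a * of_real (blinfun_apply (grad a) v))" for v
      using that(2) by (simp only: c_def a_def if_False)
    ultimately show ?thesis by blast
  qed
  interpret rep: A_representation R X F \<theta> k scaleA iS iW scaleF Bsp Du wact "alcove_stab \<union> S" "lin_part R X" c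
  proof (intro A_representation.intro A_representation_axioms.intro assms(4))
    show vs: "vector_space scaleF"
      by unfold_locales (auto simp: scaleF_def plus_fun_def M.scale_right_distrib M.scale_left_distrib)
    show "module.subspace scaleF Bsp"
      using Bsp_0 Bsp_add Bsp_scale
      by (simp add: module.subspace_def[OF vs[unfolded vector_space_def module_def[symmetric] module_iff_vector_space[symmetric]]] scaleF_def plus_fun_def zero_fun_def)
    fix v u :: 'v and r :: real and t :: complex and f g :: "'v \<Rightarrow> 'm" and w w' :: "'v \<Rightarrow> 'v" and z :: "'v cvec"
    show "f \<in> Bsp \<Longrightarrow> Du v f \<in> Bsp" by (rule Du_Bsp)
    show "f \<in> Bsp \<Longrightarrow> g \<in> Bsp \<Longrightarrow> Du v (f + g) = Du v f + Du v g"
      unfolding plus_fun_def by (rule Du_add)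
    show "f \<in> Bsp \<Longrightarrow> Du v (scaleF t f) = scaleF t (Du v f)"
      unfolding scaleF_def by (rule Du_scale)
    show "f \<in> Bsp \<Longrightarrow> Du (r *\<^sub>R v + u) f = scaleF (complex_of_real r) (Du v f) + Du u f"
      unfolding scaleF_def plus_fun_def by (rule Du_linear)
    show "f \<in> Bsp \<Longrightarrow> Du v (Du u f) = Du u (Du v f)" by (rule Du_commute)
    show "w \<in> Wa \<Longrightarrow> f \<in> Bsp \<Longrightarrow> wact w f \<in> Bsp" by (rule wact_Bsp)
    show "w \<in> Wa \<Longrightarrow> f \<in> Bsp \<Longrightarrow> g \<in> Bsp \<Longrightarrow> wact w (f + g) = wact w f + wact w g"
      unfolding plus_fun_def by (rule wact_add)
    show "w \<in> Wa \<Longrightarrow> f \<in> Bsp \<Longrightarrow> wact w (scaleF t f) = scaleF t (wact w f)"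
      unfolding scaleF_def by (rule wact_scale)
    show "f \<in> Bsp \<Longrightarrow> wact id f = f" by (rule wact_id)
    show "w \<in> Wa \<Longrightarrow> w' \<in> Wa \<Longrightarrow> f \<in> Bsp \<Longrightarrow> wact (w \<circ> w') f = wact w (wact w' f)"
      by (rule wact_comp)
    show "id \<in> Wa" by (rule Wa_id)
    show "w \<in> Wa \<Longrightarrow> w' \<in> Wa \<Longrightarrow> w \<circ> w' \<in> Wa" by (rule Wa_comp)
    show "w \<in> alcove_stab \<union> S \<Longrightarrow> w \<in> Wa"
      using aff_refl_Wa(1)[OF simple_in_aff_roots] by (auto simp: S_def alcove_stab_def)
    show "\<forall>w\<in>Wa. Q w" if "\<forall>g\<in>alcove_stab \<union> S. Q g" "\<forall>g\<in>alcove_stab \<union> S. \<forall>w\<in>Wa. Q w \<longrightarrow> Q (g \<circ> w)" for Q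
    proof
      fix w assume "w \<in> Wa"
      then show "Q w"
      proof (induction rule: Wa_induct)
        case (stab w)
        with that(1) show ?case by blast
      next
        case (refl a w)
        then have "aff_refl a \<in> alcove_stab \<union> S" by (simp add: S_def)
        with that(2) refl(2,3) show ?case by blast
      qed
    qed
    show "iW (group_elt w) * iS (sym_vec z) = iS (sym_vec (cvec_map (lin_part R X w) z)) * iW (group_elt w)
          + scaleA (c w (fst z) + \<i> * c w (snd z)) 1" if w: "w \<in> alcove_stab \<union> S"
    proof (cases "w \<in> alcove_stab")
      case True
      then have l: "w \<in> length_zero R X F" using alcove_stab_length_zero by (rule set_mp[rotated])
      show ?thesis using True by (simp add: c_def A.length_zero_relation[OF l])
    next
      case False
      then obtain a where a: "a \<in> Fa" "w = aff_refl a" "lin_part R X w = root_refl (grad a)"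
        "\<And>v. c w v = - (k a * of_real (blinfun_apply (grad a) v))" using refl w by blast
      have "c w (fst z) + \<i> * c w (snd z) = - (k a * cvec_eval (grad a) z)"
        by (simp add: a(4) cvec_eval_def Complex_eq algebra_simps)
      then show ?thesis using A.cross_relation[OF a(1), of z] unfolding a(3) unfolding a(2)
        by (simp add: diff_eq_eq add.commute)
    qed
    show "wact w (Du v f) = Du (lin_part R X w v) (wact w f) + scaleF (c w v) f"
      if w: "w \<in> alcove_stab \<union> S" and f: "f \<in> Bsp"
    proof (cases "w \<in> alcove_stab")
      case True
      then show ?thesis using stab_Du[OF True f] by (simp add: c_def scaleF_def plus_fun_def)
    next
      case False
      then obtain a where a: "a \<in> Fa" "w = aff_refl a" "lin_part R X w = root_refl (grad a)"
        "\<And>v. c w v = - (k a * of_real (blinfun_apply (grad a) v))" using refl w by blast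
      show ?thesis unfolding a(3,4) unfolding a(2) refl_Du[OF a(1) f] scaleF_def plus_fun_def ..
    qed
  qed
  show ?thesis
  \<comment> \<open>Restriction matches the normalisation of \<open>endomorphisms\<close> outside
    the function space, on which uniqueness as a function depends.\<close>
  proof (rule ex1I[of _ "\<lambda>x. restrict (rep.\<pi> x) Bsp"], intro conjI)
    have endo: "restrict (rep.\<pi> x) Bsp \<in> endomorphisms scaleM Bsp" for x
      using rep.linear_opD[OF rep.linear_op_\<pi>[of x]] Bsp_add Bsp_scale
      unfolding endomorphisms_def scaleF_def plus_fun_def by auto
    show "algebra_hom_to_End scaleA scaleM Bsp (\<lambda>x. restrict (rep.\<pi> x) Bsp)"
      unfolding algebra_hom_to_End_def
      using endo rep.\<pi>_one rep.\<pi>_B rep.\<pi>_mult rep.\<pi>_add[unfolded plus_fun_def] 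
      by (simp add: rep.\<pi>_scale, simp add: scaleF_def)
    show "\<forall>v. \<forall>f\<in>Bsp. restrict (rep.\<pi> (iS (sym_vec (v, 0)))) Bsp f = Du v f"
      by (simp add: rep.\<pi>_vec)
    show "\<forall>w\<in>Wa. \<forall>f\<in>Bsp. restrict (rep.\<pi> (iW (group_elt w))) Bsp f = wact w f"
      by (simp add: rep.\<pi>_iW)
  next
    fix \<rho> assume \<rho>: "algebra_hom_to_End scaleA scaleM Bsp \<rho> \<and>
      (\<forall>v. \<forall>f\<in>Bsp. \<rho> (iS (sym_vec (v, 0))) f = Du v f) \<and> (\<forall>w\<in>Wa. \<forall>f\<in>Bsp. \<rho> (iW (group_elt w)) f = wact w f)"
    show "\<rho> = (\<lambda>x. restrict (rep.\<pi> x) Bsp)"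
    proof (intro ext)
      fix x f v
      show "\<rho> x f v = restrict (rep.\<pi> x) Bsp f v"
      proof (cases "f \<in> Bsp")
        case True
        have "\<rho> x f = rep.\<pi> x f"
          by (rule rep.\<pi>_unique)
             (use \<rho> True in \<open>auto simp: algebra_hom_to_End_def scaleF_def plus_fun_def\<close>)
        then show ?thesis using True by simp
      next
        case False
        have "\<rho> x \<in> extensional Bsp"
          using \<rho> unfolding algebra_hom_to_End_def endomorphisms_def by (auto simp: PiE_def)
        then show ?thesis using False by (simp add: extensional_def)
      qed
    qed
  qed
qed

end
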